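(* Let $B$ be a standard Koszul algebra with weight poset $\Gamma$. For any strongly linear $B$-module $M$ and any integer $i\ge 0$, the module $M_{\geq i}\langle -i\rangle$ is also strongly linear.
   Context: Algebras and modules are finite dimensional over an algebraically closed field $k$. For a graded algebra $B$, $\operatorname{ext}^n_B$ denotes Ext in the category of graded $B$-modules, $N\langle r\rangle_i:=N_{i-r}$, and $M_{\ge i}:=\bigoplus_{j\ge i}M_j$. A positively graded algebra $B$ is Koszul if $B_0$ is semisimple and $\operatorname{ext}^n_B(L,L'\langle r\rangle)\neq0$ implies $n=r$ for irreducible $B$-modules $L,L'$ in pure grade $0$. A graded quasi-hereditary algebra with weight poset $\Gamma$ is a quasi-hereditary algebra with a positive grading; it has graded irreducible modules $L_B(\gamma)$ (pure grade $0$), graded standard modules $\Delta^B(\gamma)$ with head $L_B(\gamma)$ in grade $0$, and graded costandard modules $\nabla_B(\gamma)$ with socle $L_B(\gamma)$ in grade $0$, $\gamma\in\Gamma$. $B$ is standard Koszul if it is Koszul and graded quasi-hereditary (for the same grading), and for all $\lambda,\mu\in\Gamma$, $n\in\mathbb N$, $r\in\mathbb Z$: $\operatorname{ext}^n_B(\Delta^B(\lambda),L_B(\mu)\langle r\rangle)\ne0\Rightarrow n=r$, and $\operatorname{ext}^n_B(L_B(\mu),\nabla_B(\lambda)\langle r\rangle)\neq0\Rightarrow n=r$. A graded $B$-module $M$ is strongly linear if for all $\gamma\in\Gamma$, $n\in\mathbb N$, $r\in\mathbb Z$, $\operatorname{ext}^n_B(M,\nabla_B(\gamma)\langle r\rangle)\ne0$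 implies $n=r$. *)

theory Defs
  imports "HOL-Computational_Algebra.Polynomial" "HOL-Library.Function_Algebras"
begin

section \<open>Graded algebras\<close>

text \<open>
  The carrier of an algebra is a whole type \<open>'b\<close> with its class operations. The sort
  \<open>{ring, monoid_mult}\<close> is used instead of \<open>ring_1\<close> so that the zero algebra is
  not excluded.
\<close>

record ('k, 'b) alg =
  scal :: "'k \<Rightarrow> 'b \<Rightarrow> 'b"

record ('k, 'b) graded_alg = "('k, 'b) alg" +
  grading :: "nat \<Rightarrow> 'b set"

definition fd_algebra ::
    "('k::field, 'b::{ring,monoid_mult}, 'z) alg_scheme \<Rightarrow> bool" where
  "fd_algebra B \<longleftrightarrow>
     vector_space (scal B) \<and>
     (\<forall>c x y. scal B c (x * y) = scal B c x * y \<and> scal B c (x * y) = x * scal B c y) \<and>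
     (\<exists>S. finite S \<and> module.span (scal B) S = UNIV)"

definition add_subgroup :: "'a::ab_group_add set \<Rightarrow> bool" where
  "add_subgroup S \<longleftrightarrow> 0 \<in> S \<and> (\<forall>x\<in>S. \<forall>y\<in>S. x + y \<in> S) \<and> (\<forall>x\<in>S. - x \<in> S)"

definition direct_sum_decomposition :: "('i \<Rightarrow> 'a::ab_group_add set) \<Rightarrow> 'a set \<Rightarrow> bool" where
  "direct_sum_decomposition W V \<longleftrightarrow>
     add_subgroup V \<and> (\<forall>i. add_subgroup (W i) \<and> W i \<subseteq> V) \<and>
     (\<forall>v\<in>V. \<exists>!f. (\<forall>i. f i \<in> W i) \<and> finite {i. f i \<noteq> 0} \<and> (\<Sum>i | f i \<noteq> 0. f i) = v)"

definition positively_graded_algebra ::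
    "('k::field, 'b::{ring,monoid_mult}) graded_alg \<Rightarrow> bool" where
  "positively_graded_algebra B \<longleftrightarrow>
     fd_algebra B \<and>
     direct_sum_decomposition (grading B) UNIV \<and>
     (\<forall>n c. \<forall>x\<in>grading B n. scal B c x \<in> grading B n) \<and>
     1 \<in> grading B 0 \<and>
     (\<forall>m n. \<forall>x\<in>grading B m. \<forall>y\<in>grading B n. x * y \<in> grading B (m + n))"

definition left_ideal_of :: "'b::{ring,monoid_mult} set \<Rightarrow> 'b set \<Rightarrow> bool" where
  "left_ideal_of R I \<longleftrightarrow> add_subgroup I \<and> I \<subseteq> R \<and> (\<forall>r\<in>R. \<forall>x\<in>I. r * x \<in> I)"

text \<open>A subring \<open>R\<close> is semisimple if its left regular module is, i.e. if every left ideal is a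
  direct summand.\<close>

definition semisimple_subring :: "'b::{ring,monoid_mult} set \<Rightarrow> bool" where
  "semisimple_subring R \<longleftrightarrow>
     (\<forall>I. left_ideal_of R I \<longrightarrow>
        (\<exists>J. left_ideal_of R J \<and> I \<inter> J = {0} \<and> {x + y |x y. x \<in> I \<and> y \<in> J} = R))"


section \<open>Modules and graded modules\<close>

text \<open>
  A module has as carrier a subset of an abelian group type, whose addition it inherits; its
  action is only relevant on that carrier. The scalars \<open>c\<close> of the ground field act through
  \<open>scal B c 1\<close>.
\<close>

record ('b, 'm) bmod =
  carr :: "'m set"
  act :: "'b \<Rightarrow> 'm \<Rightarrow> 'm"

record ('b, 'm) gmod = "('b, 'm) bmod" +
  gr :: "int \<Rightarrow> 'm set"

text \<open>
  Every finite dimensional module over a \<open>'k\<close>-algebra is isomorphic to one whose carrier lies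
  in \<open>nat \<Rightarrow> 'k\<close> (with pointwise addition). Hence quantifying over the modules on this type
  amounts to quantifying over all finite dimensional modules.
\<close>

type_synonym ('k, 'b) umod = "('b, nat \<Rightarrow> 'k) bmod"
type_synonym ('k, 'b) ugmod = "('b, nat \<Rightarrow> 'k) gmod"

definition fd_module ::
    "('k::field, 'b::{ring,monoid_mult}, 'z) alg_scheme \<Rightarrow>
     ('b, 'm::ab_group_add, 'w) bmod_scheme \<Rightarrow> bool" where
  "fd_module B M \<longleftrightarrow>
     add_subgroup (carr M) \<and>
     (\<forall>b. \<forall>v\<in>carr M. act M b v \<in> carr M) \<and>
     (\<forall>b. \<forall>v\<in>carr M. \<forall>w\<in>carr M. act M b (v + w) = act M b v + act M b w) \<and>
     (\<forall>a b. \<forall>v\<in>carr M. act M (a + b) v = act M a v + act M b v) \<and>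
     (\<forall>a b. \<forall>v\<in>carr M. act M (a * b) v = act M a (act M b v)) \<and>
     (\<forall>v\<in>carr M. act M 1 v = v) \<and>
     (\<exists>S. finite S \<and> S \<subseteq> carr M \<and>
        (\<forall>v\<in>carr M. \<exists>c. v = (\<Sum>s\<in>S. act M (scal B (c s) 1) s)))"

definition graded_module ::
    "('k::field, 'b::{ring,monoid_mult}) graded_alg \<Rightarrow> ('b, 'm::ab_group_add) gmod \<Rightarrow> bool" where
  "graded_module B M \<longleftrightarrow>
     fd_module B M \<and>
     direct_sum_decomposition (gr M) (carr M) \<and>
     (\<forall>n j. \<forall>b\<in>grading B n. \<forall>v\<in>gr M j. act M b v \<in> gr M (int n + j))"

definition pure_grade :: "int \<Rightarrow> ('b, 'm) gmod \<Rightarrow> bool" where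
  "pure_grade j M \<longleftrightarrow> gr M j = carr M"

definition shift :: "int \<Rightarrow> ('b, 'm) gmod \<Rightarrow> ('b, 'm) gmod" where
  "shift r M = M\<lparr>gr := (\<lambda>i. gr M (i - r))\<rparr>"

definition truncate_ge :: "int \<Rightarrow> ('b, 'm::ab_group_add) gmod \<Rightarrow> ('b, 'm) gmod" where
  "truncate_ge i M =
     M\<lparr>carr := {\<Sum>j\<in>J. f j |J f. finite J \<and> J \<subseteq> {i..} \<and> (\<forall>j\<in>J. f j \<in> gr M j)},
       gr := (\<lambda>j. if j \<ge> i then gr M j else {0})\<rparr>"

definition mod_hom ::
    "('b, 'm::ab_group_add, 'w) bmod_scheme \<Rightarrow> ('b, 'n::ab_group_add, 'v) bmod_scheme
      \<Rightarrow> ('m \<Rightarrow> 'n) set" where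
  "mod_hom M N =
     {f. (\<forall>v\<in>carr M. f v \<in> carr N) \<and>
         (\<forall>v\<in>carr M. \<forall>w\<in>carr M. f (v + w) = f v + f w) \<and>
         (\<forall>b. \<forall>v\<in>carr M. f (act M b v) = act N b (f v))}"

definition graded_hom ::
    "('b, 'm::ab_group_add) gmod \<Rightarrow> ('b, 'n::ab_group_add) gmod \<Rightarrow> ('m \<Rightarrow> 'n) set" where
  "graded_hom M N = {f \<in> mod_hom M N. \<forall>j. \<forall>v\<in>gr M j. f v \<in> gr N j}"

definition mod_ker ::
    "('b, 'm, 'w) bmod_scheme \<Rightarrow> ('m \<Rightarrow> 'n::zero) \<Rightarrow> 'm set" where
  "mod_ker M f = {v \<in> carr M. f v = 0}"

definition mod_iso ::
    "('b, 'm::ab_group_add, 'w) bmod_scheme \<Rightarrow> ('b, 'n::ab_group_add, 'v) bmod_scheme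
      \<Rightarrow> bool" where
  "mod_iso M N \<longleftrightarrow> (\<exists>f\<in>mod_hom M N. bij_betw f (carr M) (carr N))"

definition submodule :: "('b, 'm::ab_group_add, 'w) bmod_scheme \<Rightarrow> 'm set \<Rightarrow> bool" where
  "submodule M S \<longleftrightarrow> add_subgroup S \<and> S \<subseteq> carr M \<and> (\<forall>b. \<forall>v\<in>S. act M b v \<in> S)"

text \<open>A module of pure grade is irreducible as a graded module iff it is irreducible.\<close>

definition irreducible_module ::
    "('k::field, 'b::{ring,monoid_mult}, 'z) alg_scheme \<Rightarrow>
     ('b, 'm::ab_group_add, 'w) bmod_scheme \<Rightarrow> bool" where
  "irreducible_module B M \<longleftrightarrow>
     fd_module B M \<and> carr M \<noteq> {0} \<and> (\<forall>S. submodule M S \<longrightarrow> S = {0} \<or> S = carr M)"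

definition radical :: "('b, 'm::ab_group_add, 'w) bmod_scheme \<Rightarrow> 'm set" where
  "radical M =
     {v \<in> carr M. \<forall>S. submodule M S \<and> S \<noteq> carr M \<and>
        (\<forall>T. submodule M T \<and> S \<subseteq> T \<longrightarrow> T = S \<or> T = carr M) \<longrightarrow> v \<in> S}"

text \<open>The socle is the sum of the irreducible submodules, i.e. the smallest submodule
  containing all of them.\<close>

definition socle ::
    "('k::field, 'b::{ring,monoid_mult}, 'z) alg_scheme \<Rightarrow>
     ('b, 'm::ab_group_add, 'w) bmod_scheme \<Rightarrow> 'm set" where
  "socle B M =
     \<Inter>{S. submodule M S \<and>
          (\<forall>T. submodule M T \<and> irreducible_module B (M\<lparr>carr := T\<rparr>) \<longrightarrow> T \<subseteq> S)}"

definition head_map ::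
    "('b, 'm::ab_group_add, 'w) bmod_scheme \<Rightarrow> ('b, 'n::ab_group_add, 'v) bmod_scheme \<Rightarrow>
     ('m \<Rightarrow> 'n) \<Rightarrow> bool" where
  "head_map M X p \<longleftrightarrow> p \<in> mod_hom M X \<and> p ` carr M = carr X \<and> mod_ker M p = radical M"

definition socle_map ::
    "('k::field, 'b::{ring,monoid_mult}, 'z) alg_scheme \<Rightarrow>
     ('b, 'm::ab_group_add, 'w) bmod_scheme \<Rightarrow> ('b, 'n::ab_group_add, 'v) bmod_scheme \<Rightarrow>
     ('n \<Rightarrow> 'm) \<Rightarrow> bool" where
  "socle_map B M X e \<longleftrightarrow> e \<in> mod_hom X M \<and> inj_on e (carr X) \<and> e ` carr X = socle B M"

text \<open>\<open>X\<close> is a composition factor of \<open>M\<close> iff it is irreducible and a quotient of a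
  submodule of \<open>M\<close>.\<close>

definition composition_factor ::
    "('k::field, 'b::{ring,monoid_mult}, 'z) alg_scheme \<Rightarrow>
     ('b, 'm::ab_group_add, 'w) bmod_scheme \<Rightarrow> ('b, 'n::ab_group_add, 'v) bmod_scheme \<Rightarrow>
     bool" where
  "composition_factor B M X \<longleftrightarrow>
     irreducible_module B X \<and>
     (\<exists>T f. submodule M T \<and> f \<in> mod_hom (M\<lparr>carr := T\<rparr>) X \<and> f ` T = carr X)"

definition projective_module ::
    "('k::field, 'b::{ring,monoid_mult}, 'z) alg_scheme \<Rightarrow>
     ('b, 'm::ab_group_add, 'w) bmod_scheme \<Rightarrow> bool" where
  "projective_module B P \<longleftrightarrow>
     fd_module B P \<and>
     (\<forall>(X :: ('k, 'b) umod) (Y :: ('k, 'b) umod) g h.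
        fd_module B X \<and> fd_module B Y \<and>
        g \<in> mod_hom X Y \<and> g ` carr X = carr Y \<and> h \<in> mod_hom P Y \<longrightarrow>
        (\<exists>h'\<in>mod_hom P X. \<forall>v\<in>carr P. g (h' v) = h v))"

definition injective_module ::
    "('k::field, 'b::{ring,monoid_mult}, 'z) alg_scheme \<Rightarrow>
     ('b, 'm::ab_group_add, 'w) bmod_scheme \<Rightarrow> bool" where
  "injective_module B I \<longleftrightarrow>
     fd_module B I \<and>
     (\<forall>(X :: ('k, 'b) umod) (Y :: ('k, 'b) umod) g h.
        fd_module B X \<and> fd_module B Y \<and>
        g \<in> mod_hom X Y \<and> inj_on g (carr X) \<and> h \<in> mod_hom X I \<longrightarrow>
        (\<exists>h'\<in>mod_hom Y I. \<forall>v\<in>carr X. h' (g v) = h v))"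

definition graded_projective ::
    "('k::field, 'b::{ring,monoid_mult}) graded_alg \<Rightarrow> ('b, 'm::ab_group_add) gmod \<Rightarrow> bool" where
  "graded_projective B P \<longleftrightarrow>
     graded_module B P \<and>
     (\<forall>(X :: ('k, 'b) ugmod) (Y :: ('k, 'b) ugmod) g h.
        graded_module B X \<and> graded_module B Y \<and>
        g \<in> graded_hom X Y \<and> g ` carr X = carr Y \<and> h \<in> graded_hom P Y \<longrightarrow>
        (\<exists>h'\<in>graded_hom P X. \<forall>v\<in>carr P. g (h' v) = h v))"


section \<open>Graded Ext\<close>

definition graded_projective_resolution ::
    "('k::field, 'b::{ring,monoid_mult}) graded_alg \<Rightarrow> ('b, 'm::ab_group_add) gmod \<Rightarrow>
     (nat \<Rightarrow> ('k, 'b) ugmod) \<Rightarrow> (nat \<Rightarrow> (nat \<Rightarrow> 'k) \<Rightarrow> (nat \<Rightarrow> 'k)) \<Rightarrow> ((nat \<Rightarrow> 'k) \<Rightarrow> 'm) \<Rightarrow>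
     bool" where
  "graded_projective_resolution B M P d \<epsilon> \<longleftrightarrow>
     (\<forall>n. graded_projective B (P n)) \<and>
     (\<forall>n. d n \<in> graded_hom (P (Suc n)) (P n)) \<and>
     \<epsilon> \<in> graded_hom (P 0) M \<and> \<epsilon> ` carr (P 0) = carr M \<and>
     mod_ker (P 0) \<epsilon> = d 0 ` carr (P 1) \<and>
     (\<forall>n. mod_ker (P (Suc n)) (d n) = d (Suc n) ` carr (P (Suc (Suc n))))"

definition ext_cocycles ::
    "(nat \<Rightarrow> ('b, 'p::ab_group_add) gmod) \<Rightarrow> (nat \<Rightarrow> 'p \<Rightarrow> 'p) \<Rightarrow> nat \<Rightarrow>
     ('b, 'n::ab_group_add) gmod \<Rightarrow> ('p \<Rightarrow> 'n) set" where
  "ext_cocycles P d n N =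
     {f \<in> graded_hom (P n) N. \<forall>x\<in>carr (P (Suc n)). f (d n x) = 0}"

definition ext_coboundaries ::
    "(nat \<Rightarrow> ('b, 'p::ab_group_add) gmod) \<Rightarrow> (nat \<Rightarrow> 'p \<Rightarrow> 'p) \<Rightarrow> nat \<Rightarrow>
     ('b, 'n::ab_group_add) gmod \<Rightarrow> ('p \<Rightarrow> 'n) set" where
  "ext_coboundaries P d n N =
     (case n of
        0 \<Rightarrow> {f \<in> graded_hom (P 0) N. \<forall>x\<in>carr (P 0). f x = 0}
      | Suc m \<Rightarrow> {f \<in> graded_hom (P (Suc m)) N.
                   \<exists>g\<in>graded_hom (P m) N. \<forall>x\<in>carr (P (Suc m)). f x = g (d m x)})"

text \<open>
  \<open>ext_nonzero B n M N\<close> says that \<open>ext\<close> of degree \<open>n\<close> from \<open>M\<close> to \<open>N\<close>, computed as the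
  \<open>n\<close>-th cohomology of \<open>hom(P, N)\<close> for a graded projective resolution \<open>P\<close> of \<open>M\<close>, does not
  vanish. Resolutions by finite dimensional projectives always exist, and the cohomology does
  not depend on the choice.
\<close>

definition ext_nonzero ::
    "('k::field, 'b::{ring,monoid_mult}) graded_alg \<Rightarrow> nat \<Rightarrow> ('b, 'm::ab_group_add) gmod \<Rightarrow>
     ('b, 'n::ab_group_add) gmod \<Rightarrow> bool" where
  "ext_nonzero B n M N \<longleftrightarrow>
     (\<exists>P d \<epsilon>. graded_projective_resolution B M P d \<epsilon> \<and>
        ext_cocycles P d n N \<noteq> ext_coboundaries P d n N)"


section \<open>Quasi-hereditary algebras\<close>

definition classifies_irreducibles ::
    "('k::field, 'b::{ring,monoid_mult}, 'z) alg_scheme \<Rightarrow> 'g set \<Rightarrow>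
     ('g \<Rightarrow> ('b, nat \<Rightarrow> 'k, 'w) bmod_scheme) \<Rightarrow> bool" where
  "classifies_irreducibles B \<Gamma> L \<longleftrightarrow>
     (\<forall>\<gamma>\<in>\<Gamma>. irreducible_module B (L \<gamma>)) \<and>
     (\<forall>X :: ('k, 'b) umod. irreducible_module B X \<longrightarrow> (\<exists>!\<gamma>. \<gamma> \<in> \<Gamma> \<and> mod_iso X (L \<gamma>)))"

definition factors_in ::
    "('k::field, 'b::{ring,monoid_mult}, 'z) alg_scheme \<Rightarrow>
     ('g \<Rightarrow> ('b, nat \<Rightarrow> 'k, 'w) bmod_scheme) \<Rightarrow> 'g set \<Rightarrow>
     ('b, 'm::ab_group_add, 'v) bmod_scheme \<Rightarrow> bool" where
  "factors_in B L \<Theta> M \<longleftrightarrow>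
     (\<forall>X :: ('k, 'b) umod. composition_factor B M X \<longrightarrow> (\<exists>\<mu>\<in>\<Theta>. mod_iso X (L \<mu>)))"

text \<open>\<open>projective_cover B X P\<close>, for irreducible \<open>X\<close>: \<open>P\<close> is projective with head \<open>X\<close>.\<close>

definition projective_cover ::
    "('k::field, 'b::{ring,monoid_mult}, 'z) alg_scheme \<Rightarrow>
     ('b, nat \<Rightarrow> 'k, 'w) bmod_scheme \<Rightarrow> ('k, 'b) umod \<Rightarrow> bool" where
  "projective_cover B X P \<longleftrightarrow> projective_module B P \<and> (\<exists>p. head_map P X p)"

definition injective_envelope ::
    "('k::field, 'b::{ring,monoid_mult}, 'z) alg_scheme \<Rightarrow>
     ('b, nat \<Rightarrow> 'k, 'w) bmod_scheme \<Rightarrow> ('k, 'b) umod \<Rightarrow> bool" where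
  "injective_envelope B X I \<longleftrightarrow> injective_module B I \<and> (\<exists>e. socle_map B I X e)"

text \<open>The standard module of weight \<open>\<gamma>\<close> is the largest quotient of the projective cover of
  \<open>L \<gamma>\<close> all of whose composition factors are \<open>L \<mu>\<close> with \<open>\<mu> \<le> \<gamma>\<close>; dually, the costandard
  module is the largest such submodule of the injective envelope.\<close>

definition standard_module ::
    "('k::field, 'b::{ring,monoid_mult}, 'z) alg_scheme \<Rightarrow> 'g::order set \<Rightarrow>
     ('g \<Rightarrow> ('b, nat \<Rightarrow> 'k, 'w) bmod_scheme) \<Rightarrow> 'g \<Rightarrow>
     ('b, nat \<Rightarrow> 'k, 'v) bmod_scheme \<Rightarrow> bool" where
  "standard_module B \<Gamma> L \<gamma> D \<longleftrightarrow>
     fd_module B D \<and> factors_in B L {\<mu> \<in> \<Gamma>. \<mu> \<le> \<gamma>} D \<and>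
     (\<exists>P p. projective_cover B (L \<gamma>) P \<and> p \<in> mod_hom P D \<and> p ` carr P = carr D \<and>
        (\<forall>(X :: ('k, 'b) umod) q.
           fd_module B X \<and> factors_in B L {\<mu> \<in> \<Gamma>. \<mu> \<le> \<gamma>} X \<and>
           q \<in> mod_hom P X \<and> q ` carr P = carr X \<longrightarrow> mod_ker P p \<subseteq> mod_ker P q))"

definition costandard_module ::
    "('k::field, 'b::{ring,monoid_mult}, 'z) alg_scheme \<Rightarrow> 'g::order set \<Rightarrow>
     ('g \<Rightarrow> ('b, nat \<Rightarrow> 'k, 'w) bmod_scheme) \<Rightarrow> 'g \<Rightarrow>
     ('b, nat \<Rightarrow> 'k, 'v) bmod_scheme \<Rightarrow> bool" where
  "costandard_module B \<Gamma> L \<gamma> N \<longleftrightarrow>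
     fd_module B N \<and> factors_in B L {\<mu> \<in> \<Gamma>. \<mu> \<le> \<gamma>} N \<and>
     (\<exists>I e. injective_envelope B (L \<gamma>) I \<and> e \<in> mod_hom N I \<and> inj_on e (carr N) \<and>
        (\<forall>S. submodule I S \<and> factors_in B L {\<mu> \<in> \<Gamma>. \<mu> \<le> \<gamma>} (I\<lparr>carr := S\<rparr>) \<longrightarrow>
           S \<subseteq> e ` carr N))"

text \<open>\<open>filtered_by M K F\<close>: the submodule \<open>K\<close> of \<open>M\<close> has a finite filtration with sections
  isomorphic to members of \<open>F\<close>.\<close>

definition filtered_by ::
    "('b, 'm::ab_group_add, 'w) bmod_scheme \<Rightarrow> 'm set \<Rightarrow>
     ('b, 'n::ab_group_add, 'v) bmod_scheme set \<Rightarrow> bool" where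
  "filtered_by M K F \<longleftrightarrow>
     (\<exists>m S. S 0 = {0} \<and> S m = K \<and>
        (\<forall>k<m::nat. submodule M (S (Suc k)) \<and> S k \<subseteq> S (Suc k) \<and>
           (\<exists>D\<in>F. \<exists>f\<in>mod_hom (M\<lparr>carr := S (Suc k)\<rparr>) D.
              f ` S (Suc k) = carr D \<and> {v \<in> S (Suc k). f v = 0} = S k)))"

text \<open>
  The algebra is quasi-hereditary if its module category is a highest weight category in the
  sense of Cline, Parshall and Scott: the composition factors of the radical of the standard
  module of weight \<open>\<gamma>\<close> are \<open>L \<mu>\<close> with \<open>\<mu> < \<gamma>\<close>, and the kernel of the map to it from the
  projective cover of \<open>L \<gamma>\<close> is filtered by standard modules of weights \<open>\<mu> > \<gamma>\<close>.
\<close>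

definition quasi_hereditary ::
    "('k::field, 'b::{ring,monoid_mult}, 'z) alg_scheme \<Rightarrow> 'g::order set \<Rightarrow>
     ('g \<Rightarrow> ('b, nat \<Rightarrow> 'k, 'w) bmod_scheme) \<Rightarrow> bool" where
  "quasi_hereditary B \<Gamma> L \<longleftrightarrow>
     fd_algebra B \<and> finite \<Gamma> \<and> classifies_irreducibles B \<Gamma> L \<and>
     (\<exists>D :: 'g \<Rightarrow> ('k, 'b) umod. \<forall>\<gamma>\<in>\<Gamma>.
        standard_module B \<Gamma> L \<gamma> (D \<gamma>) \<and>
        factors_in B L {\<mu> \<in> \<Gamma>. \<mu> < \<gamma>} ((D \<gamma>)\<lparr>carr := radical (D \<gamma>)\<rparr>) \<and>
        (\<exists>P p. projective_cover B (L \<gamma>) P \<and> p \<in> mod_hom P (D \<gamma>) \<and> p ` carr P = carr (D \<gamma>) \<and>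
           filtered_by P (mod_ker P p) (D ` {\<mu> \<in> \<Gamma>. \<gamma> < \<mu>})))"

definition graded_quasi_hereditary ::
    "('k::field, 'b::{ring,monoid_mult}) graded_alg \<Rightarrow> 'g::order set \<Rightarrow>
     ('g \<Rightarrow> ('k, 'b) ugmod) \<Rightarrow> ('g \<Rightarrow> ('k, 'b) ugmod) \<Rightarrow> ('g \<Rightarrow> ('k, 'b) ugmod) \<Rightarrow> bool" where
  "graded_quasi_hereditary B \<Gamma> L \<Delta> nabla \<longleftrightarrow>
     positively_graded_algebra B \<and> quasi_hereditary B \<Gamma> L \<and>
     (\<forall>\<gamma>\<in>\<Gamma>.
        graded_module B (L \<gamma>) \<and> pure_grade 0 (L \<gamma>) \<and>
        graded_module B (\<Delta> \<gamma>) \<and> standard_module B \<Gamma> L \<gamma> (\<Delta> \<gamma>) \<and>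
        (\<exists>p\<in>graded_hom (\<Delta> \<gamma>) (L \<gamma>). head_map (\<Delta> \<gamma>) (L \<gamma>) p) \<and>
        graded_module B (nabla \<gamma>) \<and> costandard_module B \<Gamma> L \<gamma> (nabla \<gamma>) \<and>
        (\<exists>e\<in>graded_hom (L \<gamma>) (nabla \<gamma>). socle_map B (nabla \<gamma>) (L \<gamma>) e))"


section \<open>Koszul conditions and strong linearity\<close>

definition koszul :: "('k::field, 'b::{ring,monoid_mult}) graded_alg \<Rightarrow> bool" where
  "koszul B \<longleftrightarrow>
     positively_graded_algebra B \<and> semisimple_subring (grading B 0) \<and>
     (\<forall>(X :: ('k, 'b) ugmod) (Y :: ('k, 'b) ugmod) n r.
        graded_module B X \<and> irreducible_module B X \<and> pure_grade 0 X \<and>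
        graded_module B Y \<and> irreducible_module B Y \<and> pure_grade 0 Y \<and>
        ext_nonzero B n X (shift r Y) \<longrightarrow> int n = r)"

definition standard_koszul ::
    "('k::field, 'b::{ring,monoid_mult}) graded_alg \<Rightarrow> 'g::order set \<Rightarrow>
     ('g \<Rightarrow> ('k, 'b) ugmod) \<Rightarrow> ('g \<Rightarrow> ('k, 'b) ugmod) \<Rightarrow> ('g \<Rightarrow> ('k, 'b) ugmod) \<Rightarrow> bool" where
  "standard_koszul B \<Gamma> L \<Delta> nabla \<longleftrightarrow>
     koszul B \<and> graded_quasi_hereditary B \<Gamma> L \<Delta> nabla \<and>
     (\<forall>\<gamma>\<in>\<Gamma>. \<forall>\<mu>\<in>\<Gamma>. \<forall>n r.
        (ext_nonzero B n (\<Delta> \<gamma>) (shift r (L \<mu>)) \<longrightarrow> int n = r) \<and>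
        (ext_nonzero B n (L \<mu>) (shift r (nabla \<gamma>)) \<longrightarrow> int n = r))"

definition strongly_linear ::
    "('k::field, 'b::{ring,monoid_mult}) graded_alg \<Rightarrow> 'g set \<Rightarrow>
     ('g \<Rightarrow> ('k, 'b) ugmod) \<Rightarrow> ('b, 'm::ab_group_add) gmod \<Rightarrow> bool" where
  "strongly_linear B \<Gamma> nabla M \<longleftrightarrow>
     graded_module B M \<and>
     (\<forall>\<gamma>\<in>\<Gamma>. \<forall>n r. ext_nonzero B n M (shift r (nabla \<gamma>)) \<longrightarrow> int n = r)"

end

theory Submission
  imports Defs
begin

text \<open>
  The proof compares two bounds on the degree in which Ext can live. Let \<open>\<nabla>\<close> be a costandard
  module, \<open>M\<close> strongly linear, and consider the exact sequence
  \<open>0 \<rightarrow> M\<^bsub>\<ge>i\<^esub> \<rightarrow> M \<rightarrow> M'' \<rightarrow> 0\<close>, where \<open>M''\<close> lives in degrees \<open>j < i\<close>.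

  A graded module \<open>X\<close> has a filtration with sections \<open>L(\<mu>)\<langle>j\<rangle>\<close>, where \<open>j\<close> runs through degrees of
  \<open>X\<close>. As \<open>ext\<^sup>n(L(\<mu>), \<nabla>\<langle>r\<rangle>) \<noteq> 0\<close> forces \<open>n = r\<close>, devissage yields: if \<open>ext\<^sup>n(X, \<nabla>\<langle>r\<rangle>) \<noteq> 0\<close>, then
  \<open>r = n + j\<close> for some \<open>j\<close> with \<open>X\<^sub>j \<noteq> 0\<close> (lemma \<open>ext_degree\<close>). For \<open>X = M\<^bsub>\<ge>i\<^esub>\<close> this shows
  \<open>r \<ge> n + i\<close>. On the other hand, the long exact sequence makes \<open>ext\<^sup>n(M, \<nabla>\<langle>r\<rangle>)\<close> or
  \<open>ext\<^bsup>n+1\<^esup>(M'', \<nabla>\<langle>r\<rangle>)\<close> nonzero (lemma \<open>ext_nonzero_sub\<close>). In the first case \<open>r = n \<le> n + i\<close>; in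
  the second, \<open>r = n + 1 + j\<close> with \<open>j < i\<close>, so again \<open>r \<le> n + i\<close>. Hence \<open>r = n + i\<close>, which is
  strong linearity of \<open>M\<^bsub>\<ge>i\<^esub>\<langle>-i\<rangle>\<close>.

  Nonvanishing of Ext means nonvanishing for some projective resolution, so the two consequences of
  the long exact sequence that are needed must be proved without presupposing that the choice of
  resolution is irrelevant. The mapping cone achieves this. Given any resolutions \<open>Q\<close> of \<open>M'\<close> and
  \<open>P\<close> of \<open>M\<close>, an inclusion \<open>M' \<rightarrow> M\<close> lifts to a chain map \<open>Q \<rightarrow> P\<close>, whose cone resolves \<open>M/M'\<close>
  (lemma \<open>cone_resolution\<close>). The resolution that witnesses nonvanishing can be prescribed on
  \<open>M\<close> (lemma \<open>ext_nonzero_middle\<close>, used for devissage) or on \<open>M'\<close> (lemma \<open>ext_nonzero_sub\<close>), while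
  the other one is any resolution obtained from graded free modules.

  Projective modules live on the type \<open>nat \<Rightarrow> 'k\<close>. Quotients are moved to that type by coordinate
  functions (lemma \<open>coordinates\<close>), direct sums by interleaving sequences.
\<close>

section \<open>Homogeneous components\<close>

definition hcomp :: "('i \<Rightarrow> 'a::ab_group_add set) \<Rightarrow> 'a \<Rightarrow> 'i \<Rightarrow> 'a" where
  "hcomp W v = (THE f. (\<forall>i. f i \<in> W i) \<and> finite {i. f i \<noteq> 0} \<and> (\<Sum>i | f i \<noteq> 0. f i) = v)"

lemma add_subgroup_0: "add_subgroup S \<Longrightarrow> 0 \<in> S"
  and add_subgroup_add: "add_subgroup S \<Longrightarrow> x \<in> S \<Longrightarrow> y \<in> S \<Longrightarrow> x + y \<in> S"
  and add_subgroup_uminus: "add_subgroup S \<Longrightarrow> x \<in> S \<Longrightarrow> - x \<in> S"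
  by (auto simp: add_subgroup_def)

lemma add_subgroup_diff:
  "add_subgroup S \<Longrightarrow> x \<in> S \<Longrightarrow> y \<in> S \<Longrightarrow> x - y \<in> S"
  using add_subgroup_add[of S x "- y"] add_subgroup_uminus[of S y] by simp

lemma add_subgroup_sum:
  "add_subgroup S \<Longrightarrow> (\<And>i. i \<in> J \<Longrightarrow> f i \<in> S) \<Longrightarrow> (\<Sum>i\<in>J. f i) \<in> S"
  by (induction J rule: infinite_finite_induct) (auto simp: add_subgroup_def)

lemma add_subgroup_zero [simp]: "add_subgroup {0}"
  by (auto simp: add_subgroup_def)

lemma additive_on_0:
  fixes f :: "'a::ab_group_add \<Rightarrow> 'c::ab_group_add"
  assumes "add_subgroup V" "\<And>v w. v \<in> V \<Longrightarrow> w \<in> V \<Longrightarrow> f (v + w) = f v + f w"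
  shows "f 0 = 0"
  using assms(2)[of 0 0] add_subgroup_0[OF assms(1)] by simp

lemma additive_on_uminus:
  fixes f :: "'a::ab_group_add \<Rightarrow> 'c::ab_group_add"
  assumes "add_subgroup V" "\<And>v w. v \<in> V \<Longrightarrow> w \<in> V \<Longrightarrow> f (v + w) = f v + f w" "v \<in> V"
  shows "f (- v) = - f v"
  using assms(2)[of v "- v"] additive_on_0[of V f] add_subgroup_uminus[OF assms(1,3)] assms
  by (simp add: eq_neg_iff_add_eq_0 add.commute)

lemma additive_on_diff:
  fixes f :: "'a::ab_group_add \<Rightarrow> 'c::ab_group_add"
  assumes "add_subgroup V" "\<And>v w. v \<in> V \<Longrightarrow> w \<in> V \<Longrightarrow> f (v + w) = f v + f w"
    "v \<in> V" "w \<in> V"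
  shows "f (v - w) = f v - f w"
  using assms(2)[of v "- w"] additive_on_uminus[of V f w] add_subgroup_uminus[OF assms(1,4)] assms
  by simp

lemma additive_on_sum:
  fixes f :: "'a::ab_group_add \<Rightarrow> 'c::ab_group_add"
  assumes "add_subgroup V" "\<And>v w. v \<in> V \<Longrightarrow> w \<in> V \<Longrightarrow> f (v + w) = f v + f w"
    "\<And>j. j \<in> J \<Longrightarrow> g j \<in> V"
  shows "f (\<Sum>j\<in>J. g j) = (\<Sum>j\<in>J. f (g j))"
  using assms(3)
proof (induction J rule: infinite_finite_induct)
  case (insert j J)
  then show ?case
    using assms(2)[of "g j" "sum g J"] add_subgroup_sum[OF assms(1), of J g] by simp
qed (simp_all add: additive_on_0[OF assms(1,2)])

context
  fixes W :: "'i \<Rightarrow> 'a::ab_group_add set" and V :: "'a set"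
  assumes dsd: "direct_sum_decomposition W V"
begin

lemma dsd_subgroups: "add_subgroup V" "add_subgroup (W i)" "W i \<subseteq> V"
  using dsd by (auto simp: direct_sum_decomposition_def)

lemma hcomp_props:
  assumes "v \<in> V"
  shows "hcomp W v i \<in> W i" "finite {i. hcomp W v i \<noteq> 0}"
    "(\<Sum>i | hcomp W v i \<noteq> 0. hcomp W v i) = v"
proof -
  have "\<exists>!f. (\<forall>i. f i \<in> W i) \<and> finite {i. f i \<noteq> 0} \<and> (\<Sum>i | f i \<noteq> 0. f i) = v"
    using dsd assms by (auto simp: direct_sum_decomposition_def)
  from theI'[OF this] show "hcomp W v i \<in> W i" "finite {i. hcomp W v i \<noteq> 0}"
    "(\<Sum>i | hcomp W v i \<noteq> 0. hcomp W v i) = v"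
    unfolding hcomp_def[of W v, symmetric] by auto
qed

lemma hcomp_sum:
  assumes "v \<in> V"
  obtains J where "finite J" "\<And>i. i \<notin> J \<Longrightarrow> hcomp W v i = 0" "v = (\<Sum>i\<in>J. hcomp W v i)"
  using hcomp_props(2,3)[OF assms] by (metis (mono_tags, lifting) mem_Collect_eq)

lemma hcomp_unique:
  assumes "\<And>i. f i \<in> W i" "finite J" "\<And>i. i \<notin> J \<Longrightarrow> f i = 0" "v = (\<Sum>i\<in>J. f i)"
  shows "hcomp W v = f"
proof -
  have "v \<in> V"
    unfolding assms(4) using assms(1) dsd_subgroups by (intro add_subgroup_sum) blast+
  then have ex: "\<exists>!f. (\<forall>i. f i \<in> W i) \<and> finite {i. f i \<noteq> 0} \<and> (\<Sum>i | f i \<noteq> 0. f i) = v"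
    using dsd by (auto simp: direct_sum_decomposition_def)
  have sub: "{i. f i \<noteq> 0} \<subseteq> J" using assms(3) by blast
  have "(\<Sum>i | f i \<noteq> 0. f i) = v"
    unfolding assms(4) using sub assms(2) by (intro sum.mono_neutral_left) auto
  then show ?thesis
    unfolding hcomp_def using ex assms(1) finite_subset[OF sub assms(2)]
    by (intro the1_equality) auto
qed

lemma hcomp_add:
  assumes "v \<in> V" "w \<in> V"
  shows "hcomp W (v + w) i = hcomp W v i + hcomp W w i"
proof -
  have "hcomp W (v + w) = (\<lambda>i. hcomp W v i + hcomp W w i)"
  proof (rule hcomp_unique)
    let ?J = "{i. hcomp W v i \<noteq> 0} \<union> {i. hcomp W w i \<noteq> 0}"
    show "hcomp W v i + hcomp W w i \<in> W i" for i
      using hcomp_props(1) assms dsd_subgroups by (intro add_subgroup_add) auto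
    show fin: "finite ?J" using hcomp_props(2) assms by simp
    show "i \<notin> ?J \<Longrightarrow> hcomp W v i + hcomp W w i = 0" for i by auto
    have "(\<Sum>i\<in>?J. hcomp W u i) = u" if "u \<in> {v, w}" for u
    proof -
      have "(\<Sum>i\<in>?J. hcomp W u i) = (\<Sum>i | hcomp W u i \<noteq> 0. hcomp W u i)"
        using that fin by (intro sum.mono_neutral_right) auto
      then show ?thesis using hcomp_props(3) that assms by auto
    qed
    then show "v + w = (\<Sum>i\<in>?J. hcomp W v i + hcomp W w i)" by (simp add: sum.distrib)
  qed
  then show ?thesis by simp
qed

lemma hcomp_homogeneous:
  assumes "w \<in> W j"
  shows "hcomp W w i = (if i = j then w else 0)"
proof -
  have "hcomp W w = (\<lambda>i. if i = j then w else 0)"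
    using assms dsd_subgroups by (intro hcomp_unique[where J = "{j}"]) (auto simp: add_subgroup_0)
  then show ?thesis by simp
qed

lemma hcomp_0: "hcomp W 0 i = 0"
  using hcomp_homogeneous[of 0 i i] dsd_subgroups(2) by (simp add: add_subgroup_0)

lemma hcomp_uminus: "v \<in> V \<Longrightarrow> hcomp W (- v) i = - hcomp W v i"
  using additive_on_uminus[OF dsd_subgroups(1), of "\<lambda>v. hcomp W v i" v] hcomp_add by blast

lemma hcomp_eqI: 
  assumes "v \<in> V" "w \<in> V" "\<And>i. hcomp W v i = hcomp W w i"
  shows "v = w"
proof -
  have "hcomp W v = hcomp W w" using assms(3) by (rule ext)
  then show ?thesis using hcomp_props(3)[OF assms(1)] hcomp_props(3)[OF assms(2)] by metis
qed

end

text \<open>A decomposition is most easily recognised from its projections: these are additive and act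
  on the summands as the identity or as zero, which forces uniqueness.\<close>

lemma direct_sum_decompositionI:
  fixes W :: "'i \<Rightarrow> 'a::ab_group_add set"
  assumes V: "add_subgroup V" and W: "\<And>i. add_subgroup (W i)" "\<And>i. W i \<subseteq> V"
    and c: "\<And>v i. v \<in> V \<Longrightarrow> c v i \<in> W i"
    and fin: "\<And>v. v \<in> V \<Longrightarrow> \<exists>J. finite J \<and> (\<forall>i. i \<notin> J \<longrightarrow> c v i = 0) \<and> v = (\<Sum>i\<in>J. c v i)"
    and add: "\<And>v w i. v \<in> V \<Longrightarrow> w \<in> V \<Longrightarrow> c (v + w) i = c v i + c w i"
    and hom: "\<And>w i j. w \<in> W j \<Longrightarrow> c w i = (if i = j then w else 0)"
  shows "direct_sum_decomposition W V"
  unfolding direct_sum_decomposition_def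
proof (intro conjI allI ballI V W)
  fix v assume v: "v \<in> V"
  obtain J where J: "finite J" "\<forall>i. i \<notin> J \<longrightarrow> c v i = 0" "v = (\<Sum>i\<in>J. c v i)"
    using fin[OF v] by blast
  have sub: "{i. c v i \<noteq> 0} \<subseteq> J" using J by blast
  have sum: "(\<Sum>i | c v i \<noteq> 0. c v i) = v"
    using J(3) sum.mono_neutral_left[OF J(1) sub, of "c v"] by simp
  show "\<exists>!f. (\<forall>i. f i \<in> W i) \<and> finite {i. f i \<noteq> 0} \<and> (\<Sum>i | f i \<noteq> 0. f i) = v"
  proof (intro ex1I[of _ "c v"] conjI allI)
    show "c v i \<in> W i" for i by (rule c[OF v])
    show "finite {i. c v i \<noteq> 0}" using sub J(1) finite_subset by blast
    show "(\<Sum>i | c v i \<noteq> 0. c v i) = v" by (rule sum)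
    fix f assume f: "(\<forall>i. f i \<in> W i) \<and> finite {i. f i \<noteq> 0} \<and> (\<Sum>i | f i \<noteq> 0. f i) = v"
    show "f = c v"
    proof
      fix j
      have "c v j = c (\<Sum>i | f i \<noteq> 0. f i) j" using f by simp
      also have "\<dots> = (\<Sum>i | f i \<noteq> 0. c (f i) j)"
        using f W by (intro additive_on_sum[OF V, where f = "\<lambda>v. c v j"]) (auto simp: add)
      also have "\<dots> = (\<Sum>i | f i \<noteq> 0. if i = j then f i else 0)"
        using hom[of "f i" i j for i] f by (intro sum.cong refl) simp
      also have "\<dots> = f j" using f by (simp add: sum.delta')
      finally show "f j = c v j" by simp
    qed
  qed
qed


section \<open>Finite dimensional modules over a positively graded algebra\<close>

text \<open>The module axioms without finite generation, which is phrased separately by \<open>spanning\<close> below so that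
  it can be transported along maps without manipulating linear combinations.\<close>

definition is_module :: "('b::{ring,monoid_mult}, 'm::ab_group_add) gmod \<Rightarrow> bool" where
  "is_module M \<longleftrightarrow>
     add_subgroup (carr M) \<and>
     (\<forall>b. \<forall>v\<in>carr M. act M b v \<in> carr M) \<and>
     (\<forall>b. \<forall>v\<in>carr M. \<forall>w\<in>carr M. act M b (v + w) = act M b v + act M b w) \<and>
     (\<forall>a b. \<forall>v\<in>carr M. act M (a + b) v = act M a v + act M b v) \<and>
     (\<forall>a b. \<forall>v\<in>carr M. act M (a * b) v = act M a (act M b v)) \<and>
     (\<forall>v\<in>carr M. act M 1 v = v)"

context
  fixes M :: "('b::{ring,monoid_mult}, 'm::ab_group_add) gmod"
  assumes M: "is_module M"
begin

lemma is_moduleD: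
  "add_subgroup (carr M)"
  "v \<in> carr M \<Longrightarrow> act M b v \<in> carr M"
  "v \<in> carr M \<Longrightarrow> w \<in> carr M \<Longrightarrow> act M b (v + w) = act M b v + act M b w"
  "v \<in> carr M \<Longrightarrow> act M (a + b) v = act M a v + act M b v"
  "v \<in> carr M \<Longrightarrow> act M (a * b) v = act M a (act M b v)"
  "v \<in> carr M \<Longrightarrow> act M 1 v = v"
  using M by (auto simp: is_module_def)

lemma act_0: "act M b 0 = 0"
  by (rule additive_on_0[OF is_moduleD(1), where f = "act M b"]) (rule is_moduleD(3))

lemma act_uminus: "v \<in> carr M \<Longrightarrow> act M b (- v) = - act M b v"
  by (rule additive_on_uminus[OF is_moduleD(1), where f = "act M b"]) (rule is_moduleD(3))

lemma act_sum: "(\<And>j. j \<in> J \<Longrightarrow> g j \<in> carr M) \<Longrightarrow> act M b (\<Sum>j\<in>J. g j) = (\<Sum>j\<in>J. act M b (g j))"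
  by (rule additive_on_sum[OF is_moduleD(1), where f = "act M b"]) (rule is_moduleD(3))

lemma act_zero_left: "v \<in> carr M \<Longrightarrow> act M 0 v = 0"
  using is_moduleD(4)[of v 0 0] by simp

lemma act_uminus_left: "v \<in> carr M \<Longrightarrow> act M (- b) v = - act M b v"
  using is_moduleD(4)[of v b "- b"] act_zero_left by (simp add: eq_neg_iff_add_eq_0 add.commute)

lemma act_sum_left: "v \<in> carr M \<Longrightarrow> act M (\<Sum>j\<in>J. g j) v = (\<Sum>j\<in>J. act M (g j) v)"
  by (rule additive_on_sum[of UNIV "\<lambda>b. act M b v"]) (auto intro: is_moduleD(4) simp: add_subgroup_def)

end

locale pos_graded_algebra =
  fixes B :: "('k::field, 'b::{ring,monoid_mult}) graded_alg"
  assumes pos_graded: "positively_graded_algebra B"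
begin

sublocale vector_space "scal B"
  using pos_graded by (simp add: positively_graded_algebra_def fd_algebra_def)

lemma scal_mult: "scal B c x * y = scal B c (x * y)" "x * scal B c y = scal B c (x * y)"
  using pos_graded unfolding positively_graded_algebra_def fd_algebra_def by metis+

lemma scal_1_grading: "scal B c 1 \<in> grading B 0"
  using pos_graded by (simp add: positively_graded_algebra_def)

lemma grading_dsd: "direct_sum_decomposition (grading B) UNIV"
  using pos_graded by (simp add: positively_graded_algebra_def)

definition scalar_act :: "('b, 'm::ab_group_add) gmod \<Rightarrow> 'k \<Rightarrow> 'm \<Rightarrow> 'm" where
  "scalar_act M c v = act M (scal B c 1) v"

lemma scalar_act_props:
  assumes "is_module M" "v \<in> carr M" "w \<in> carr M"
  shows "scalar_act M c v \<in> carr M" "scalar_act M c (v + w) = scalar_act M c v + scalar_act M c w"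
    "scalar_act M (c + d) v = scalar_act M c v + scalar_act M d v" "scalar_act M (c * d) v = scalar_act M c (scalar_act M d v)"
    "scalar_act M 1 v = v" "scalar_act M 0 v = 0" "scalar_act M (- c) v = - scalar_act M c v" "scalar_act M c 0 = 0"
    "scalar_act M c (- v) = - scalar_act M c v"
proof -
  have *: "scal B (c * d) 1 = scal B c 1 * scal B d 1" by (simp add: scal_mult)
  show "scalar_act M c v \<in> carr M" "scalar_act M c (v + w) = scalar_act M c v + scalar_act M c w"
    "scalar_act M (c + d) v = scalar_act M c v + scalar_act M d v" "scalar_act M (c * d) v = scalar_act M c (scalar_act M d v)"
    "scalar_act M 1 v = v" "scalar_act M 0 v = 0" "scalar_act M (- c) v = - scalar_act M c v" "scalar_act M c 0 = 0"
    "scalar_act M c (- v) = - scalar_act M c v"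
    using assms(2,3) unfolding scalar_act_def *
    by (simp_all add: is_moduleD[OF assms(1)] scale_left_distrib act_zero_left[OF assms(1)]
        act_uminus_left[OF assms(1)] act_0[OF assms(1)] act_uminus[OF assms(1)])
qed

definition subspace_of :: "('b, 'm::ab_group_add) gmod \<Rightarrow> 'm set \<Rightarrow> bool" where
  "subspace_of M W \<longleftrightarrow> add_subgroup W \<and> W \<subseteq> carr M \<and> (\<forall>c. \<forall>v\<in>W. scalar_act M c v \<in> W)"

text \<open>Closure, unlike the existence of coefficients, passes directly to images and sums, because it can
  be tested on preimages of subspaces.\<close>

definition spanning :: "('b, 'm::ab_group_add) gmod \<Rightarrow> 'm set \<Rightarrow> bool" where
  "spanning M S \<longleftrightarrow> S \<subseteq> carr M \<and> (\<forall>W. subspace_of M W \<and> S \<subseteq> W \<longrightarrow> carr M \<subseteq> W)"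

lemma subspace_of_carr: "is_module M \<Longrightarrow> subspace_of M (carr M)"
  by (auto simp: subspace_of_def is_moduleD scalar_act_def)

lemma submodule_subspace_of: "submodule M W \<Longrightarrow> subspace_of M W"
  by (auto simp: subspace_of_def submodule_def scalar_act_def)

text \<open>The linear combinations of a finite set form a subspace that contains the set, which is why the
  closure formulation agrees with the explicit one.\<close>

lemma fd_module_iff:
  fixes M :: "('b, 'm::ab_group_add) gmod"
  shows "fd_module B M \<longleftrightarrow> is_module M \<and> (\<exists>S. finite S \<and> spanning M S)"
proof -
  have *: "(S \<subseteq> carr M \<and> (\<forall>v\<in>carr M. \<exists>c. v = (\<Sum>s\<in>S. act M (scal B (c s) 1) s))) \<longleftrightarrow> spanning M S"
    if M: "is_module M" and fin: "finite S" for S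
  proof (intro iffI conjI)
    assume S: "S \<subseteq> carr M \<and> (\<forall>v\<in>carr M. \<exists>c. v = (\<Sum>s\<in>S. act M (scal B (c s) 1) s))"
    show "spanning M S" unfolding spanning_def
    proof (intro conjI allI impI subsetI)
      fix W v assume W: "subspace_of M W \<and> S \<subseteq> W" and "v \<in> carr M"
      then obtain c where "v = (\<Sum>s\<in>S. scalar_act M (c s) s)" using S unfolding scalar_act_def by blast
      then show "v \<in> W" using W by (auto simp: subspace_of_def intro!: add_subgroup_sum)
    qed (use S in auto)
  next
    assume S: "spanning M S"
    then show SM: "S \<subseteq> carr M" by (simp add: spanning_def)
    let ?W = "{\<Sum>s\<in>S. scalar_act M (c s) s |c. True}"
    note sm = scalar_act_props[OF M]
    have "subspace_of M ?W"
      unfolding subspace_of_def add_subgroup_def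
    proof (intro conjI ballI allI)
      have "(\<Sum>s\<in>S. scalar_act M 0 s) = 0" using SM sm(6) by (intro sum.neutral) blast
      then show "0 \<in> ?W" by (auto intro!: exI[of _ "\<lambda>_. 0"])
      show "?W \<subseteq> carr M" using SM sm(1) by (auto intro!: add_subgroup_sum is_moduleD(1)[OF M])
    next
      fix x y assume "x \<in> ?W" "y \<in> ?W"
      then obtain c d where "x = (\<Sum>s\<in>S. scalar_act M (c s) s)" "y = (\<Sum>s\<in>S. scalar_act M (d s) s)" by blast
      then have "x + y = (\<Sum>s\<in>S. scalar_act M (c s + d s) s)"
        using SM sm(3) by (auto simp: sum.distrib[symmetric] intro!: sum.cong)
      then show "x + y \<in> ?W" by (auto intro!: exI[of _ "\<lambda>s. c s + d s"])
    next
      fix x assume "x \<in> ?W"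
      then obtain c where "x = (\<Sum>s\<in>S. scalar_act M (c s) s)" by blast
      then have "- x = (\<Sum>s\<in>S. scalar_act M (- c s) s)"
        using SM sm(7) by (auto simp: sum_negf[symmetric] intro!: sum.cong)
      then show "- x \<in> ?W" by (auto intro!: exI[of _ "\<lambda>s. - c s"])
    next
      fix e x assume "x \<in> ?W"
      then obtain c where x: "x = (\<Sum>s\<in>S. scalar_act M (c s) s)" by blast
      have "scalar_act M e x = (\<Sum>s\<in>S. scalar_act M e (scalar_act M (c s) s))"
        unfolding x using SM sm(1,2)
        by (intro additive_on_sum[OF is_moduleD(1)[OF M]]) auto
      also have "\<dots> = (\<Sum>s\<in>S. scalar_act M (e * c s) s)"
        using SM sm(4) by (auto intro!: sum.cong)
      finally show "scalar_act M e x \<in> ?W" by (auto intro!: exI[of _ "\<lambda>s. e * c s"])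
    qed
    moreover have "S \<subseteq> ?W"
    proof
      fix s assume s: "s \<in> S"
      have "(\<Sum>t\<in>S. scalar_act M (if t = s then 1 else 0) t) = (\<Sum>t\<in>S. if t = s then t else 0)"
        using SM sm(5,6) by (intro sum.cong) auto
      also have "\<dots> = s" using s fin by simp
      finally show "s \<in> ?W" by (auto intro!: exI[of _ "\<lambda>t. if t = s then 1 else 0"])
    qed
    ultimately have "carr M \<subseteq> ?W" using S by (simp add: spanning_def)
    then show "\<forall>v\<in>carr M. \<exists>c. v = (\<Sum>s\<in>S. act M (scal B (c s) 1) s)"
      unfolding scalar_act_def by blast
  qed
  have "fd_module B M \<longleftrightarrow> is_module M \<and> (\<exists>S. finite S \<and> S \<subseteq> carr M \<and>
      (\<forall>v\<in>carr M. \<exists>c. v = (\<Sum>s\<in>S. act M (scal B (c s) 1) s)))"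
    by (simp only: fd_module_def is_module_def conj_assoc)
  also have "\<dots> \<longleftrightarrow> is_module M \<and> (\<exists>S. finite S \<and> spanning M S)"
    by (intro conj_cong refl ex_cong1) (rule *)
  finally show ?thesis .
qed

end


section \<open>Subspaces, coordinates and dimension\<close>

definition additive_on :: "'a::ab_group_add set \<Rightarrow> ('a \<Rightarrow> 'c::ab_group_add) \<Rightarrow> bool" where
  "additive_on V f \<longleftrightarrow> (\<forall>v\<in>V. \<forall>w\<in>V. f (v + w) = f v + f w)"

context pos_graded_algebra
begin

lemma fd_moduleD:
  fixes M :: "('b, 'm::ab_group_add) gmod"
  shows "fd_module B M \<Longrightarrow> is_module M"
  by (simp add: fd_module_iff)

lemma subspace_ofD:
  assumes "subspace_of M W"
  shows "add_subgroup W" "W \<subseteq> carr M" "v \<in> W \<Longrightarrow> scalar_act M c v \<in> W"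
  using assms by (auto simp: subspace_of_def)

lemma subspace_of_zero: "is_module M \<Longrightarrow> subspace_of M {0}"
  by (auto simp: subspace_of_def is_moduleD(1) add_subgroup_0 scalar_act_def act_0)

lemma subspace_of_Int: "subspace_of M U \<Longrightarrow> subspace_of M W \<Longrightarrow> subspace_of M (U \<inter> W)"
  by (auto simp: subspace_of_def add_subgroup_def)

definition line_ext :: "('b, 'm::ab_group_add) gmod \<Rightarrow> 'm set \<Rightarrow> 'm \<Rightarrow> 'm set" where
  "line_ext M V t = {v + scalar_act M c t |v c. v \<in> V}"

context
  fixes M :: "('b, 'm::ab_group_add) gmod" and V t
  assumes M: "is_module M" and V: "subspace_of M V" and t: "t \<in> carr M"
begin

lemma subspace_of_line_ext: "subspace_of M (line_ext M V t)"
  unfolding subspace_of_def add_subgroup_def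
proof (intro conjI ballI allI)
  note sm = scalar_act_props[OF M _ t] scalar_act_props[OF M t]
  show "0 \<in> line_ext M V t"
    using sm(6)[OF t] add_subgroup_0[OF subspace_ofD(1)[OF V]]
    by (auto simp: line_ext_def intro!: exI[of _ 0])
  show "line_ext M V t \<subseteq> carr M"
    using subspace_ofD(2)[OF V] sm(1)[OF t] by (auto simp: line_ext_def intro!: add_subgroup_add is_moduleD(1)[OF M])
next
  fix x y assume "x \<in> line_ext M V t" "y \<in> line_ext M V t"
  then obtain v c w d where *: "x = v + scalar_act M c t" "y = w + scalar_act M d t" "v \<in> V" "w \<in> V"
    by (auto simp: line_ext_def)
  then have "x + y = (v + w) + scalar_act M (c + d) t" using scalar_act_props(3)[OF M t t] by simp
  moreover have "v + w \<in> V" using * add_subgroup_add[OF subspace_ofD(1)[OF V]] by blast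
  ultimately show "x + y \<in> line_ext M V t" unfolding line_ext_def by blast
next
  fix x assume "x \<in> line_ext M V t"
  then obtain v c where *: "x = v + scalar_act M c t" "v \<in> V" by (auto simp: line_ext_def)
  then have "- x = - v + scalar_act M (- c) t" using scalar_act_props(7)[OF M t t] by simp
  moreover have "- v \<in> V" using * add_subgroup_uminus[OF subspace_ofD(1)[OF V]] by blast
  ultimately show "- x \<in> line_ext M V t" unfolding line_ext_def by blast
next
  fix e x assume "x \<in> line_ext M V t"
  then obtain v c where *: "x = v + scalar_act M c t" "v \<in> V" by (auto simp: line_ext_def)
  then have "scalar_act M e x = scalar_act M e v + scalar_act M (e * c) t"
    using scalar_act_props(1,4)[OF M t t] scalar_act_props(2)[OF M, of v "scalar_act M c t"] subspace_ofD(2)[OF V] by auto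
  moreover have "scalar_act M e v \<in> V" using * subspace_ofD(3)[OF V] by blast
  ultimately show "scalar_act M e x \<in> line_ext M V t" unfolding line_ext_def by blast
qed

lemma line_ext_supset: "V \<subseteq> line_ext M V t" "t \<in> line_ext M V t"
proof -
  show "V \<subseteq> line_ext M V t"
  proof
    fix v assume "v \<in> V"
    moreover have "v = v + scalar_act M 0 t" using scalar_act_props(6)[OF M t t] by simp
    ultimately show "v \<in> line_ext M V t" unfolding line_ext_def by blast
  qed
  have "t = 0 + scalar_act M 1 t" using scalar_act_props(5)[OF M t t] by simp
  then show "t \<in> line_ext M V t"
    using add_subgroup_0[OF subspace_ofD(1)[OF V]] unfolding line_ext_def by blast
qed

lemma line_ext_unique:
  assumes "t \<notin> V" "v \<in> V" "w \<in> V" "v + scalar_act M c t = w + scalar_act M d t"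
  shows "v = w \<and> c = d"
proof -
  have "c = d"
  proof (rule ccontr)
    assume "c \<noteq> d"
    then have "t = scalar_act M (inverse (c - d) * (c - d)) t" using scalar_act_props(5)[OF M t t] by simp
    also have "\<dots> = scalar_act M (inverse (c - d)) (scalar_act M (c - d) t)" by (rule scalar_act_props(4)[OF M t t])
    also have "scalar_act M (c - d) t = w - v"
    proof -
      have "scalar_act M (c - d) t = scalar_act M c t - scalar_act M d t"
        using scalar_act_props(3)[OF M t t, of c "- d"] scalar_act_props(7)[OF M t t, of d] by simp
      moreover have "scalar_act M c t = w + scalar_act M d t - v" using assms(4) by (simp add: eq_diff_eq add.commute)
      ultimately show ?thesis by simp
    qed
    finally have "t = scalar_act M (inverse (c - d)) (w - v)" .
    then show False
      using assms(1-3) subspace_ofD(3)[OF V] add_subgroup_diff[OF subspace_ofD(1)[OF V]] by metis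
  qed
  then show ?thesis using assms(4) by simp
qed

end

text \<open>Linear algebra by induction on the number of generators: both coordinates and dimension are built
  up one line at a time.\<close>

lemma fd_module_induct:
  fixes M :: "('b, 'm::ab_group_add) gmod"
  assumes M: "fd_module B M" and S: "subspace_of M S" "P S"
    and step: "\<And>V t. subspace_of M V \<Longrightarrow> S \<subseteq> V \<Longrightarrow> t \<in> carr M \<Longrightarrow> t \<notin> V \<Longrightarrow> P V \<Longrightarrow> P (line_ext M V t)"
  shows "P (carr M)"
proof -
  have mod: "is_module M" using M by (rule fd_moduleD)
  obtain T where T: "finite T" "spanning M T" using M by (auto simp: fd_module_iff)
  have "\<exists>V. subspace_of M V \<and> S \<subseteq> V \<and> F \<subseteq> V \<and> P V" if "finite F" "F \<subseteq> carr M" for F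
    using that
  proof (induction F)
    case (insert t F)
    then obtain V where V: "subspace_of M V" "S \<subseteq> V" "F \<subseteq> V" "P V" by auto
    show ?case
    proof (cases "t \<in> V")
      case False
      have t: "t \<in> carr M" using insert.prems by simp
      then show ?thesis
        using V step[OF V(1,2) t False V(4)] subspace_of_line_ext[OF mod V(1) t]
          line_ext_supset[OF mod V(1) t]
        by (intro exI[of _ "line_ext M V t"]) auto
    qed (use V in auto)
  qed (use S in auto)
  then obtain V where V: "subspace_of M V" "T \<subseteq> V" "P V" using T unfolding spanning_def by metis
  then have "V = carr M" using T(2) by (auto simp: spanning_def subspace_of_def)
  then show ?thesis using V(3) by simp
qed

text \<open>Each line added to \<open>S\<close> contributes one new coordinate, prepended to the previous ones. The
  coordinate function embeds \<open>M/S\<close> into \<open>nat \<Rightarrow> 'k\<close>, for \<open>M\<close> on any type.\<close>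

lemma coordinates:
  fixes M :: "('b, 'm::ab_group_add) gmod"
  assumes M: "fd_module B M" and S: "subspace_of M S"
  shows "\<exists>\<kappa> :: 'm \<Rightarrow> nat \<Rightarrow> 'k. additive_on (carr M) \<kappa> \<and> {v \<in> carr M. \<kappa> v = 0} = S"
proof (rule fd_module_induct[OF M S, where P =
    "\<lambda>V. \<exists>\<kappa> :: 'm \<Rightarrow> nat \<Rightarrow> 'k. additive_on V \<kappa> \<and> {v \<in> V. \<kappa> v = 0} = S"])
  show "\<exists>\<kappa> :: 'm \<Rightarrow> nat \<Rightarrow> 'k. additive_on S \<kappa> \<and> {v \<in> S. \<kappa> v = 0} = S"
    by (intro exI[of _ "\<lambda>_. 0"]) (simp add: additive_on_def)
next
  fix V t
  assume V: "subspace_of M V" "S \<subseteq> V" and t: "t \<in> carr M" "t \<notin> V"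
    and "\<exists>\<kappa> :: 'm \<Rightarrow> nat \<Rightarrow> 'k. additive_on V \<kappa> \<and> {v \<in> V. \<kappa> v = 0} = S"
  then obtain \<kappa> :: "'m \<Rightarrow> nat \<Rightarrow> 'k" where *: "additive_on V \<kappa>" "{v \<in> V. \<kappa> v = 0} = S"
    by blast
  have \<kappa>: "\<kappa> (v + w) = \<kappa> v + \<kappa> w" if "v \<in> V" "w \<in> V" for v w
    using *(1) that by (simp add: additive_on_def)
  have ker: "\<kappa> v = 0 \<longleftrightarrow> v \<in> S" if "v \<in> V" for v
    using *(2) that by auto
  have mod: "is_module M" using M by (rule fd_moduleD)
  define q where "q x = (SOME p. fst p \<in> V \<and> x = fst p + scalar_act M (snd p) t)" for x
  have q: "q (v + scalar_act M c t) = (v, c)" if "v \<in> V" for v c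
  proof -
    have "fst (q (v + scalar_act M c t)) \<in> V \<and>
      v + scalar_act M c t = fst (q (v + scalar_act M c t)) + scalar_act M (snd (q (v + scalar_act M c t))) t"
      unfolding q_def by (rule someI[of _ "(v, c)"]) (use that in simp)
    then have "v = fst (q (v + scalar_act M c t)) \<and> c = snd (q (v + scalar_act M c t))"
      using that by (intro line_ext_unique[OF mod V(1) t]) auto
    then show ?thesis by (metis prod.collapse)
  qed
  define \<kappa>' where "\<kappa>' x = case_nat (snd (q x)) (\<kappa> (fst (q x)))" for x
  have \<kappa>': "\<kappa>' (v + scalar_act M c t) = case_nat c (\<kappa> v)" if "v \<in> V" for v c
    using q[OF that] by (simp add: \<kappa>'_def)
  have case_nat_0: "case_nat c f = 0 \<longleftrightarrow> c = 0 \<and> f = 0" for c :: 'k and f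
    by (auto simp: fun_eq_iff split: nat.split)
  show "\<exists>\<kappa> :: 'm \<Rightarrow> nat \<Rightarrow> 'k. additive_on (line_ext M V t) \<kappa> \<and> {v \<in> line_ext M V t. \<kappa> v = 0} = S"
  proof (intro exI[of _ \<kappa>'] conjI)
    show "additive_on (line_ext M V t) \<kappa>'"
      unfolding additive_on_def
    proof (intro ballI)
      fix x y assume "x \<in> line_ext M V t" "y \<in> line_ext M V t"
      then obtain v c w d where *: "x = v + scalar_act M c t" "y = w + scalar_act M d t" "v \<in> V" "w \<in> V"
        by (auto simp: line_ext_def)
      then have "x + y = (v + w) + scalar_act M (c + d) t" using scalar_act_props(3)[OF mod t(1) t(1)] by simp
      moreover have "v + w \<in> V" using * add_subgroup_add[OF subspace_ofD(1)[OF V(1)]] by blast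
      ultimately have "\<kappa>' (x + y) = case_nat (c + d) (\<kappa> v + \<kappa> w)" using \<kappa>' \<kappa> * by metis
      also have "\<dots> = \<kappa>' x + \<kappa>' y"
        using * by (auto simp: \<kappa>' fun_eq_iff split: nat.split)
      finally show "\<kappa>' (x + y) = \<kappa>' x + \<kappa>' y" .
    qed
  next
    have "\<kappa>' x = 0 \<longleftrightarrow> x \<in> S" if "x \<in> line_ext M V t" for x
    proof -
      from that obtain v c where *: "x = v + scalar_act M c t" "v \<in> V" by (auto simp: line_ext_def)
      show "\<kappa>' x = 0 \<longleftrightarrow> x \<in> S"
      proof
        assume "\<kappa>' x = 0"
        then show "x \<in> S" using * \<kappa>' ker scalar_act_props(6)[OF mod t(1) t(1)] by (simp add: case_nat_0)
      next
        assume x: "x \<in> S"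
        show "\<kappa>' x = 0"
          using \<kappa>'[of x 0] ker[of x] V(2) x scalar_act_props(6)[OF mod t(1) t(1)]
          by (auto simp: case_nat_0)
      qed
    qed
    moreover have "S \<subseteq> line_ext M V t" using V(2) line_ext_supset(1)[OF mod V(1) t(1)] by blast
    ultimately show "{v \<in> line_ext M V t. \<kappa>' v = 0} = S" by blast
  qed
qed

text \<open>Adding a line to \<open>V\<close> raises the dimension of \<open>U\<close> over that of \<open>U \<inter> V\<close> by at most one, and
  exactly by one unless \<open>U \<subseteq> V\<close>. This determines the dimension recursively.\<close>

lemma dimension_function:
  fixes M :: "('b, 'm::ab_group_add) gmod"
  assumes M: "fd_module B M"
  obtains \<delta> :: "'m set \<Rightarrow> nat" where
    "\<And>U W. subspace_of M U \<Longrightarrow> subspace_of M W \<Longrightarrow> U \<subset> W \<Longrightarrow> \<delta> U < \<delta> W"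
proof -
  have mod: "is_module M" using M by (rule fd_moduleD)
  let ?P = "\<lambda>V. \<exists>\<delta> :: 'm set \<Rightarrow> nat. \<forall>U W. subspace_of M U \<longrightarrow> subspace_of M W \<longrightarrow> U \<subset> W \<longrightarrow> W \<subseteq> V \<longrightarrow> \<delta> U < \<delta> W"
  have "?P (carr M)"
  proof (rule fd_module_induct[OF M subspace_of_zero[OF mod]])
    show "?P {0}"
      by (intro exI[of _ "\<lambda>_. 0"]) (auto dest!: subspace_ofD(1) add_subgroup_0)
  next
    fix V t
    assume V: "subspace_of M V" and t: "t \<in> carr M" "t \<notin> V" and "?P V"
    then obtain \<delta> :: "'m set \<Rightarrow> nat" where
      \<delta>: "subspace_of M U \<Longrightarrow> subspace_of M W \<Longrightarrow> U \<subset> W \<Longrightarrow> W \<subseteq> V \<Longrightarrow> \<delta> U < \<delta> W" for U W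
      by blast
    define \<delta>' where "\<delta>' U = \<delta> (U \<inter> V) + (if U \<subseteq> V then 0 else 1)" for U
    have "\<delta>' U < \<delta>' W"
      if U: "subspace_of M U" and W: "subspace_of M W" and less: "U \<subset> W" "W \<subseteq> line_ext M V t" for U W
    proof (cases "U \<inter> V = W \<inter> V")
      case False
      then have "\<delta> (U \<inter> V) < \<delta> (W \<inter> V)"
        using less by (intro \<delta> subspace_of_Int U W V) auto
      then show ?thesis using less by (auto simp: \<delta>'_def)
    next
      case True
      have "U \<subseteq> V"
      proof (rule ccontr)
        assume "\<not> U \<subseteq> V"
        then obtain u where u: "u \<in> U" "u \<notin> V" by blast
        then obtain v c where uv: "u = v + scalar_act M c t" "v \<in> V"
          using less unfolding line_ext_def by blast
        have c: "c \<noteq> 0" using u uv scalar_act_props(6)[OF mod t(1) t(1)] by auto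
        have "w \<in> U" if "w \<in> W" for w
        proof -
          obtain v' c' where wv: "w = v' + scalar_act M c' t" "v' \<in> V"
            using less \<open>w \<in> W\<close> unfolding line_ext_def by blast
          let ?u = "scalar_act M (c' / c) u"
          have "?u = scalar_act M (c' / c) v + scalar_act M (c' / c) (scalar_act M c t)"
            using uv V t scalar_act_props(1)[OF mod t(1) t(1)] subspace_ofD(2)
            by (auto intro!: scalar_act_props(2)[OF mod])
          also have "scalar_act M (c' / c) (scalar_act M c t) = scalar_act M c' t"
            using scalar_act_props(4)[OF mod t(1) t(1), of "c' / c" c] c by simp
          finally have "w - ?u = v' - scalar_act M (c' / c) v" using wv by simp
          then have "w - ?u \<in> V"
            using wv uv V add_subgroup_diff[OF subspace_ofD(1)[OF V]] subspace_ofD(3)[OF V] by metis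
          moreover have u': "?u \<in> U" using u U subspace_ofD(3) by blast
          then have "w - ?u \<in> W"
            using \<open>w \<in> W\<close> less add_subgroup_diff[OF subspace_ofD(1)[OF W]] by blast
          ultimately have "w - ?u \<in> U" using True by blast
          then have "(w - ?u) + ?u \<in> U" using u' add_subgroup_add[OF subspace_ofD(1)[OF U]] by blast
          then show ?thesis by simp
        qed
        then show False using less by blast
      qed
      moreover have "\<not> W \<subseteq> V" using True less \<open>U \<subseteq> V\<close> by blast
      ultimately show ?thesis using True by (simp add: \<delta>'_def)
    qed
    then show "?P (line_ext M V t)" by blast
  qed
  then obtain \<delta> :: "'m set \<Rightarrow> nat" where
    "\<forall>U W. subspace_of M U \<longrightarrow> subspace_of M W \<longrightarrow> U \<subset> W \<longrightarrow> W \<subseteq> carr M \<longrightarrow> \<delta> U < \<delta> W" ..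
  then have "\<delta> U < \<delta> W" if "subspace_of M U" "subspace_of M W" "U \<subset> W" for U W
    using that subspace_ofD(2)[OF that(2)] by simp
  then show ?thesis by (rule that)
qed

text \<open>Among the subspaces spanned by finite subsets of \<open>W\<close>, one of maximal dimension must be \<open>W\<close>.\<close>

lemma subspace_of_finitely_generated:
  fixes M :: "('b, 'm::ab_group_add) gmod"
  assumes M: "fd_module B M" and W: "subspace_of M W"
  obtains F where "finite F" "F \<subseteq> W" "\<And>U. subspace_of M U \<Longrightarrow> F \<subseteq> U \<Longrightarrow> W \<subseteq> U"
proof -
  have mod: "is_module M" using M by (rule fd_moduleD)
  obtain \<delta> :: "'m set \<Rightarrow> nat" where
    \<delta>: "\<And>U W. subspace_of M U \<Longrightarrow> subspace_of M W \<Longrightarrow> U \<subset> W \<Longrightarrow> \<delta> U < \<delta> W"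
    using dimension_function[OF M] by blast
  define H where "H F = \<Inter>{U. subspace_of M U \<and> F \<subseteq> U}" for F
  have H: "subspace_of M (H F)" if "F \<subseteq> W" for F
    unfolding subspace_of_def add_subgroup_def
  proof (intro conjI ballI allI)
    show "0 \<in> H F" by (auto simp: H_def subspace_of_def add_subgroup_0)
    show "H F \<subseteq> carr M" using that W subspace_ofD(2)[OF W] by (auto simp: H_def)
    show "x + y \<in> H F" if "x \<in> H F" "y \<in> H F" for x y
      using that by (simp add: H_def subspace_of_def add_subgroup_add)
    show "- x \<in> H F" if "x \<in> H F" for x
      using that by (simp add: H_def subspace_of_def add_subgroup_uminus)
    show "scalar_act M c x \<in> H F" if "x \<in> H F" for c x
      using that by (simp add: H_def subspace_of_def)
  qed
  let ?Q = "\<lambda>F. finite F \<and> F \<subseteq> W"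
  have HW: "H F \<subseteq> W" if "F \<subseteq> W" for F using that W by (auto simp: H_def)
  have "\<forall>F. ?Q F \<longrightarrow> \<delta> (H F) < Suc (\<delta> W)"
    using \<delta>[OF H W] HW by (metis less_Suc_eq psubsetI)
  then obtain F where F: "?Q F" and max: "\<And>G. ?Q G \<Longrightarrow> \<delta> (H G) \<le> \<delta> (H F)"
    using ex_has_greatest_nat[of ?Q "{}" "\<lambda>F. \<delta> (H F)" "Suc (\<delta> W)"] by auto
  have "W \<subseteq> H F"
  proof
    fix w assume w: "w \<in> W"
    show "w \<in> H F"
    proof (rule ccontr)
      assume "w \<notin> H F"
      moreover have "w \<in> H (insert w F)" "H F \<subseteq> H (insert w F)" by (auto simp: H_def)
      ultimately have "\<delta> (H F) < \<delta> (H (insert w F))"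
        using F w by (intro \<delta> H) auto
      then show False using max[of "insert w F"] F w by simp
    qed
  qed
  then show ?thesis using that[of F] F by (auto simp: H_def)
qed

end


section \<open>Graded modules: submodules, quotients, shifts, sums\<close>

definition sub_gmod :: "('b, 'm) gmod \<Rightarrow> 'm set \<Rightarrow> ('b, 'm) gmod" where
  "sub_gmod M S = M\<lparr>carr := S, gr := (\<lambda>j. gr M j \<inter> S)\<rparr>"

lemma sub_gmod_simps [simp]:
  "carr (sub_gmod M S) = S" "act (sub_gmod M S) = act M" "gr (sub_gmod M S) j = gr M j \<inter> S"
  by (simp_all add: sub_gmod_def)

definition homogeneous_submodule :: "('b, 'm::ab_group_add) gmod \<Rightarrow> 'm set \<Rightarrow> bool" where
  "homogeneous_submodule M S \<longleftrightarrow> submodule M S \<and> (\<forall>v\<in>S. \<forall>j. hcomp (gr M) v j \<in> S)"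

lemma submoduleD:
  assumes "submodule M S"
  shows "add_subgroup S" "S \<subseteq> carr M" "v \<in> S \<Longrightarrow> act M b v \<in> S"
  using assms by (auto simp: submodule_def)

lemma homogeneous_submoduleD:
  assumes "homogeneous_submodule M S"
  shows "submodule M S" "v \<in> S \<Longrightarrow> hcomp (gr M) v j \<in> S"
  using assms by (auto simp: homogeneous_submodule_def)

lemma shift_simps [simp]:
  "carr (shift r M) = carr M" "act (shift r M) = act M" "gr (shift r M) j = gr M (j - r)"
  by (simp_all add: shift_def)

lemma shift_shift: "shift r (shift s M) = shift (r + s) M"
  by (simp add: shift_def algebra_simps)

lemma shift_0 [simp]: "shift 0 M = M"
  by (simp add: shift_def)

lemma mod_homD:
  assumes "f \<in> mod_hom M N"
  shows "v \<in> carr M \<Longrightarrow> f v \<in> carr N"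
    "v \<in> carr M \<Longrightarrow> w \<in> carr M \<Longrightarrow> f (v + w) = f v + f w"
    "v \<in> carr M \<Longrightarrow> f (act M b v) = act N b (f v)"
  using assms by (auto simp: mod_hom_def)

lemma graded_homD:
  assumes "f \<in> graded_hom M N"
  shows "v \<in> carr M \<Longrightarrow> f v \<in> carr N"
    "v \<in> carr M \<Longrightarrow> w \<in> carr M \<Longrightarrow> f (v + w) = f v + f w"
    "v \<in> carr M \<Longrightarrow> f (act M b v) = act N b (f v)"
    "v \<in> gr M j \<Longrightarrow> f v \<in> gr N j"
  using assms by (auto simp: graded_hom_def mod_hom_def)

lemma graded_homI:
  assumes "\<And>v. v \<in> carr M \<Longrightarrow> f v \<in> carr N"
    "\<And>v w. v \<in> carr M \<Longrightarrow> w \<in> carr M \<Longrightarrow> f (v + w) = f v + f w"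
    "\<And>b v. v \<in> carr M \<Longrightarrow> f (act M b v) = act N b (f v)"
    "\<And>j v. v \<in> gr M j \<Longrightarrow> f v \<in> gr N j"
  shows "f \<in> graded_hom M N"
  using assms by (auto simp: graded_hom_def mod_hom_def)

lemma graded_hom_shift:
  fixes M :: "('b, 'm::ab_group_add) gmod" and N :: "('b, 'n::ab_group_add) gmod"
  shows "graded_hom (shift r M) (shift r N) = graded_hom M N"
proof -
  have "(\<forall>j. \<forall>v\<in>gr M (j - r). f v \<in> gr N (j - r)) \<longleftrightarrow> (\<forall>j. \<forall>v\<in>gr M j. f v \<in> gr N j)" for f :: "'m \<Rightarrow> 'n"
    by (metis add_diff_cancel_right')
  then show ?thesis unfolding graded_hom_def mod_hom_def by simp
qed

definition zero_gmod :: "('b, 'm::zero) gmod" where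
  "zero_gmod = \<lparr>carr = {0}, act = (\<lambda>_ _. 0), gr = (\<lambda>_. {0})\<rparr>"

lemma zero_gmod_simps [simp]:
  "carr zero_gmod = {0}" "act zero_gmod b v = 0" "gr zero_gmod j = {0}"
  by (simp_all add: zero_gmod_def)

text \<open>The bijection \<open>(nat \<Rightarrow> 'k)\<^sup>2 \<cong> (nat \<Rightarrow> 'k)\<close> by interleaving makes room for direct sums
  of modules on the type \<open>nat \<Rightarrow> 'k\<close>.\<close>

definition interleave :: "(nat \<Rightarrow> 'k) \<Rightarrow> (nat \<Rightarrow> 'k) \<Rightarrow> nat \<Rightarrow> 'k" where
  "interleave x y = (\<lambda>n. if even n then x (n div 2) else y (n div 2))"

definition evens :: "(nat \<Rightarrow> 'k) \<Rightarrow> nat \<Rightarrow> 'k" where "evens z = (\<lambda>n. z (2 * n))"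
definition odds :: "(nat \<Rightarrow> 'k) \<Rightarrow> nat \<Rightarrow> 'k" where "odds z = (\<lambda>n. z (2 * n + 1))"

lemma interleave_simps [simp]: "evens (interleave x y) = x" "odds (interleave x y) = y" "interleave (evens z) (odds z) = z"
  by (auto simp: interleave_def evens_def odds_def fun_eq_iff elim: oddE)

lemma interleave_eqI: "evens z = evens z' \<Longrightarrow> odds z = odds z' \<Longrightarrow> z = z'"
  by (metis interleave_simps(3))

lemma interleave_additive [simp]:
  fixes x y z z' :: "nat \<Rightarrow> 'k::ab_group_add"
  shows "evens (z + z') = evens z + evens z'" "odds (z + z') = odds z + odds z'" "evens 0 = 0" "odds 0 = 0"
    "evens (- z) = - evens z" "odds (- z) = - odds z"
  by (auto simp: evens_def odds_def fun_eq_iff)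

lemma interleave_add: 
  fixes x y x' y' :: "nat \<Rightarrow> 'k::ab_group_add"
  shows "interleave (x + x') (y + y') = interleave x y + interleave x' y'"
  by (rule interleave_eqI) simp_all

lemma interleave_0 [simp]: "interleave 0 0 = (0 :: nat \<Rightarrow> 'k::ab_group_add)"
  by (rule interleave_eqI) simp_all

lemma interleave_sum:
  fixes f g :: "'i \<Rightarrow> nat \<Rightarrow> 'k::ab_group_add"
  shows "interleave (\<Sum>i\<in>J. f i) (\<Sum>i\<in>J. g i) = (\<Sum>i\<in>J. interleave (f i) (g i))"
proof -
  have "evens (\<Sum>i\<in>J. interleave (f i) (g i)) = (\<Sum>i\<in>J. f i)"
    using additive_on_sum[of UNIV evens J "\<lambda>i. interleave (f i) (g i)"] by (simp add: add_subgroup_def)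
  moreover have "odds (\<Sum>i\<in>J. interleave (f i) (g i)) = (\<Sum>i\<in>J. g i)"
    using additive_on_sum[of UNIV odds J "\<lambda>i. interleave (f i) (g i)"] by (simp add: add_subgroup_def)
  ultimately show ?thesis by (metis interleave_simps(3))
qed

definition sum_gmod :: "('b, nat \<Rightarrow> 'k) gmod \<Rightarrow> ('b, nat \<Rightarrow> 'k) gmod \<Rightarrow> ('b, nat \<Rightarrow> 'k) gmod" where
  "sum_gmod M N = \<lparr>carr = {z. evens z \<in> carr M \<and> odds z \<in> carr N},
     act = (\<lambda>b z. interleave (act M b (evens z)) (act N b (odds z))),
     gr = (\<lambda>j. {z. evens z \<in> gr M j \<and> odds z \<in> gr N j})\<rparr>"

lemma sum_gmod_simps [simp]:
  "z \<in> carr (sum_gmod M N) \<longleftrightarrow> evens z \<in> carr M \<and> odds z \<in> carr N"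
  "act (sum_gmod M N) b z = interleave (act M b (evens z)) (act N b (odds z))"
  "z \<in> gr (sum_gmod M N) j \<longleftrightarrow> evens z \<in> gr M j \<and> odds z \<in> gr N j"
  by (simp_all add: sum_gmod_def)

context pos_graded_algebra
begin

lemma graded_moduleD:
  fixes M :: "('b, 'm::ab_group_add) gmod"
  assumes "graded_module B M"
  shows "fd_module B M" "is_module M" "direct_sum_decomposition (gr M) (carr M)"
    "add_subgroup (carr M)" "add_subgroup (gr M j)" "gr M j \<subseteq> carr M" "0 \<in> carr M" "0 \<in> gr M j"
    "b \<in> grading B n \<Longrightarrow> v \<in> gr M j \<Longrightarrow> act M b v \<in> gr M (int n + j)"
proof -
  show *: "fd_module B M" "direct_sum_decomposition (gr M) (carr M)"
    using assms by (auto simp: graded_module_def)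
  from fd_moduleD[OF *(1)] dsd_subgroups[OF *(2)]
  show "is_module M" "add_subgroup (carr M)" "add_subgroup (gr M j)" "gr M j \<subseteq> carr M"
    "0 \<in> carr M" "0 \<in> gr M j" by (auto simp: add_subgroup_0)
  show "b \<in> grading B n \<Longrightarrow> v \<in> gr M j \<Longrightarrow> act M b v \<in> gr M (int n + j)"
    using assms by (auto simp: graded_module_def)
qed

lemma graded_hom_0:
  fixes M :: "('b, 'm::ab_group_add) gmod" and N :: "('b, 'n::ab_group_add) gmod"
  assumes "graded_module B M" "f \<in> graded_hom M N"
  shows "f 0 = 0"
  using graded_moduleD(4)[OF assms(1)] graded_homD(2)[OF assms(2)]
  by (rule additive_on_0)

lemma graded_hom_uminus:
  fixes M :: "('b, 'm::ab_group_add) gmod" and N :: "('b, 'n::ab_group_add) gmod"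
  assumes "graded_module B M" "f \<in> graded_hom M N" "v \<in> carr M"
  shows "f (- v) = - f v"
  using graded_moduleD(4)[OF assms(1)] graded_homD(2)[OF assms(2)] assms(3)
  by (rule additive_on_uminus)

lemma graded_hom_diff:
  fixes M :: "('b, 'm::ab_group_add) gmod" and N :: "('b, 'n::ab_group_add) gmod"
  assumes "graded_module B M" "f \<in> graded_hom M N" "v \<in> carr M" "w \<in> carr M"
  shows "f (v - w) = f v - f w"
  using graded_moduleD(4)[OF assms(1)] graded_homD(2)[OF assms(2)] assms(3,4)
  by (rule additive_on_diff)

lemma graded_hom_comp:
  "f \<in> graded_hom M N \<Longrightarrow> g \<in> graded_hom N K \<Longrightarrow> (\<lambda>x. g (f x)) \<in> graded_hom M K"
  by (auto simp: graded_hom_def mod_hom_def)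

text \<open>Graded homomorphisms preserve decompositions, and decompositions are unique. Homogeneity of kernels
  and compatibility of components with submodules all reduce to this.\<close>

lemma hcomp_graded_hom:
  fixes M :: "('b, 'm::ab_group_add) gmod" and N :: "('b, 'n::ab_group_add) gmod"
  assumes M: "graded_module B M" and N: "graded_module B N" and f: "f \<in> graded_hom M N"
    and v: "v \<in> carr M"
  shows "hcomp (gr N) (f v) j = f (hcomp (gr M) v j)"
proof -
  note dM = graded_moduleD(3)[OF M] and dN = graded_moduleD(3)[OF N]
  obtain J where J: "finite J" "\<And>i. i \<notin> J \<Longrightarrow> hcomp (gr M) v i = 0"
    "v = (\<Sum>i\<in>J. hcomp (gr M) v i)"
    using hcomp_sum[OF dM v] by blast
  have "hcomp (gr N) (f v) = (\<lambda>j. f (hcomp (gr M) v j))"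
  proof (rule hcomp_unique[OF dN _ J(1)])
    show "f (hcomp (gr M) v i) \<in> gr N i" for i
      using graded_homD(4)[OF f] hcomp_props(1)[OF dM v] .
    show "i \<notin> J \<Longrightarrow> f (hcomp (gr M) v i) = 0" for i using J(2) graded_hom_0[OF M f] by simp
    have "f v = f (\<Sum>i\<in>J. hcomp (gr M) v i)" using J(3) by simp
    also have "\<dots> = (\<Sum>i\<in>J. f (hcomp (gr M) v i))"
      using graded_moduleD(6)[OF M] hcomp_props(1)[OF dM v]
      by (intro additive_on_sum[OF graded_moduleD(4)[OF M] graded_homD(2)[OF f]]) auto
    finally show "f v = (\<Sum>i\<in>J. f (hcomp (gr M) v i))" .
  qed
  then show ?thesis by simp
qed

lemma hcomp_carr:
  fixes M :: "('b, 'm::ab_group_add) gmod"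
  assumes M: "graded_module B M" "v \<in> carr M"
  shows "hcomp (gr M) v j \<in> carr M"
  using hcomp_props(1)[OF graded_moduleD(3)[OF M(1)] M(2)] graded_moduleD(6)[OF M(1)] by blast

lemma is_module_sub:
  "is_module M \<Longrightarrow> submodule M S \<Longrightarrow> is_module (sub_gmod M S)"
  unfolding is_module_def submodule_def sub_gmod_simps by blast

lemma graded_module_sub:
  fixes M :: "('b, 'm::ab_group_add) gmod"
  assumes M: "graded_module B M" and S: "homogeneous_submodule M S"
  shows "graded_module B (sub_gmod M S)"
  unfolding graded_module_def
proof (intro conjI allI ballI)
  note sub = submoduleD[OF homogeneous_submoduleD(1)[OF S]] and d = graded_moduleD(3)[OF M]
  have subspace_of_iff: "subspace_of (sub_gmod M S) W \<longleftrightarrow> subspace_of M W \<and> W \<subseteq> S" for W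
    using sub(2) by (auto simp: subspace_of_def scalar_act_def)
  obtain F where "finite F" "F \<subseteq> S" "\<And>U. subspace_of M U \<Longrightarrow> F \<subseteq> U \<Longrightarrow> S \<subseteq> U"
    using subspace_of_finitely_generated[OF graded_moduleD(1)[OF M] submodule_subspace_of[OF homogeneous_submoduleD(1)[OF S]]]
    by blast
  then have "finite F" "spanning (sub_gmod M S) F" by (auto simp: spanning_def subspace_of_iff)
  then show "fd_module B (sub_gmod M S)"
    unfolding fd_module_iff using is_module_sub[OF graded_moduleD(2)[OF M] homogeneous_submoduleD(1)[OF S]] by blast
  show "direct_sum_decomposition (gr (sub_gmod M S)) (carr (sub_gmod M S))"
  proof (rule direct_sum_decompositionI[where c = "hcomp (gr M)"])
    fix v assume "v \<in> carr (sub_gmod M S)"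
    then have v: "v \<in> S" "v \<in> carr M" using sub by auto
    show "hcomp (gr M) v i \<in> gr (sub_gmod M S) i" for i
      using hcomp_props(1)[OF d v(2)] homogeneous_submoduleD(2)[OF S v(1)] by simp
    show "\<exists>J. finite J \<and> (\<forall>i. i \<notin> J \<longrightarrow> hcomp (gr M) v i = 0) \<and> v = (\<Sum>i\<in>J. hcomp (gr M) v i)"
      using hcomp_sum[OF d v(2)] by metis
    show "hcomp (gr M) (v + w) i = hcomp (gr M) v i + hcomp (gr M) w i"
      if "w \<in> carr (sub_gmod M S)" for w i
      using hcomp_add[OF d v(2)] that sub(2) by auto
  next
    show "hcomp (gr M) w i = (if i = j then w else 0)" if "w \<in> gr (sub_gmod M S) j" for w i j
      using hcomp_homogeneous[OF d] that by auto
  qed (use sub graded_moduleD(5)[OF M] in \<open>auto simp: add_subgroup_def\<close>)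
next
  fix n j b v assume "b \<in> grading B n" "v \<in> gr (sub_gmod M S) j"
  then show "act (sub_gmod M S) b v \<in> gr (sub_gmod M S) (int n + j)"
    using graded_moduleD(9)[OF M] submoduleD(3)[OF homogeneous_submoduleD(1)[OF S]] by simp
qed

lemma hcomp_sub:
  fixes M :: "('b, 'm::ab_group_add) gmod"
  assumes M: "graded_module B M" and S: "homogeneous_submodule M S" and v: "v \<in> S"
  shows "hcomp (gr (sub_gmod M S)) v j = hcomp (gr M) v j"
proof -
  have "(\<lambda>x. x) \<in> graded_hom (sub_gmod M S) M"
    using submoduleD(2)[OF homogeneous_submoduleD(1)[OF S]] by (auto intro!: graded_homI)
  from hcomp_graded_hom[OF graded_module_sub[OF M S] M this] v show ?thesis by simp
qed

lemma homogeneous_submodule_ker: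
  fixes M :: "('b, 'm::ab_group_add) gmod" and N :: "('b, 'n::ab_group_add) gmod"
  assumes M: "graded_module B M" and N: "graded_module B N" and f: "f \<in> graded_hom M N"
  shows "homogeneous_submodule M (mod_ker M f)"
  unfolding homogeneous_submodule_def submodule_def add_subgroup_def mod_ker_def
  using graded_moduleD(4)[OF M] is_moduleD(2)[OF graded_moduleD(2)[OF M]] hcomp_carr[OF M]
  by (auto simp: graded_hom_0[OF M f] graded_homD(2,3)[OF f] graded_hom_uminus[OF M f]
      add_subgroup_0 add_subgroup_add add_subgroup_uminus act_0[OF graded_moduleD(2)[OF N]]
      hcomp_graded_hom[OF M N f, symmetric] hcomp_0[OF graded_moduleD(3)[OF N]])

lemma graded_module_zero: "graded_module B (zero_gmod :: ('b, 'm::ab_group_add) gmod)"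
  unfolding graded_module_def
proof (intro conjI allI ballI)
  have "is_module (zero_gmod :: ('b, 'm) gmod)" by (auto simp: is_module_def)
  moreover have "spanning (zero_gmod :: ('b, 'm) gmod) {}"
    by (auto simp: spanning_def subspace_of_def add_subgroup_0)
  ultimately show "fd_module B (zero_gmod :: ('b, 'm) gmod)" by (auto simp: fd_module_iff)
  show "direct_sum_decomposition (gr zero_gmod) (carr (zero_gmod :: ('b, 'm) gmod))"
    by (rule direct_sum_decompositionI[where c = "\<lambda>_ _. 0"]) (auto intro: exI[of _ "{}"])
qed simp

lemma graded_module_shift:
  fixes M :: "('b, 'm::ab_group_add) gmod"
  assumes M: "graded_module B M"
  shows "graded_module B (shift r M)"
  unfolding graded_module_def
proof (intro conjI allI ballI)
  show "fd_module B (shift r M)"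
    using graded_moduleD(1)[OF M] by (simp add: fd_module_def)
  note d = graded_moduleD(3)[OF M]
  show "direct_sum_decomposition (gr (shift r M)) (carr (shift r M))"
  proof (rule direct_sum_decompositionI[where c = "\<lambda>v i. hcomp (gr M) v (i - r)"])
    fix v assume "v \<in> carr (shift r M)"
    then have v: "v \<in> carr M" by simp
    obtain J where J: "finite J" "\<And>i. i \<notin> J \<Longrightarrow> hcomp (gr M) v i = 0"
      "v = (\<Sum>i\<in>J. hcomp (gr M) v i)"
      using hcomp_sum[OF d v] by blast
    show "\<exists>J. finite J \<and> (\<forall>i. i \<notin> J \<longrightarrow> hcomp (gr M) v (i - r) = 0) \<and>
        v = (\<Sum>i\<in>J. hcomp (gr M) v (i - r))"
    proof (intro exI[of _ "(\<lambda>i. i + r) ` J"] conjI allI impI)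
      show "hcomp (gr M) v (i - r) = 0" if "i \<notin> (\<lambda>i. i + r) ` J" for i
        using that J(2)[of "i - r"] by (force simp: image_iff)
      show "v = (\<Sum>i\<in>(\<lambda>i. i + r) ` J. hcomp (gr M) v (i - r))"
        using J(3) by (simp add: sum.reindex)
    qed (use J in simp)
  next
    show "hcomp (gr M) w (i - r) = (if i = j then w else 0)" if "w \<in> gr (shift r M) j" for w i j
      using hcomp_homogeneous[OF d, of w "j - r" "i - r"] that by auto
  qed (use graded_moduleD(4-6)[OF M] hcomp_props(1)[OF d] hcomp_add[OF d] in auto)
next
  fix n j b v assume "b \<in> grading B n" "v \<in> gr (shift r M) j"
  then show "act (shift r M) b v \<in> gr (shift r M) (int n + j)"
    using graded_moduleD(9)[OF M, of b n v "j - r"] by (simp add: algebra_simps)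
qed

lemma spanningD:
  assumes "spanning M S"
  shows "S \<subseteq> carr M" "subspace_of M W \<Longrightarrow> S \<subseteq> W \<Longrightarrow> carr M \<subseteq> W"
  using assms by (auto simp: spanning_def)

lemma subspace_of_vimage:
  fixes M :: "('b, 'm::ab_group_add) gmod" and N :: "('b, 'n::ab_group_add) gmod"
  assumes M: "is_module M" and N: "is_module N"
    and add: "\<And>v w. v \<in> carr M \<Longrightarrow> w \<in> carr M \<Longrightarrow> f (v + w) = f v + f w"
    and sm: "\<And>c v. v \<in> carr M \<Longrightarrow> f (scalar_act M c v) = scalar_act N c (f v)"
    and W: "subspace_of N W"
  shows "subspace_of M {x \<in> carr M. f x \<in> W}"
  unfolding subspace_of_def add_subgroup_def
proof (intro conjI ballI allI)
  note cM = is_moduleD(1)[OF M] is_moduleD(2)[OF M]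
  show "0 \<in> {x \<in> carr M. f x \<in> W}"
    using additive_on_0[of "carr M" f, OF cM(1) add] subspace_ofD(1)[OF W] cM by (simp add: add_subgroup_0)
  show "- x \<in> {x \<in> carr M. f x \<in> W}" if "x \<in> {x \<in> carr M. f x \<in> W}" for x
    using that additive_on_uminus[of "carr M" f, OF cM(1) add] subspace_ofD(1)[OF W] cM
    by (simp add: add_subgroup_uminus)
  show "x + y \<in> {x \<in> carr M. f x \<in> W}"
    if "x \<in> {x \<in> carr M. f x \<in> W}" "y \<in> {x \<in> carr M. f x \<in> W}" for x y
    using that subspace_ofD(1)[OF W] cM by (simp add: add_subgroup_add add)
  show "scalar_act M c x \<in> {x \<in> carr M. f x \<in> W}" if "x \<in> {x \<in> carr M. f x \<in> W}" for c x
    using that subspace_ofD(3)[OF W] scalar_act_props(1)[OF M, of x x] by (simp add: sm)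
qed simp

lemma graded_module_sum:
  fixes M N :: "('k, 'b) ugmod"
  assumes M: "graded_module B M" and N: "graded_module B N"
  shows "graded_module B (sum_gmod M N)"
  unfolding graded_module_def
proof (intro conjI allI ballI)
  note mM = is_moduleD[OF graded_moduleD(2)[OF M]] and mN = is_moduleD[OF graded_moduleD(2)[OF N]]
  have grp: "add_subgroup {z. evens z \<in> U \<and> odds z \<in> V}"
    if "add_subgroup U" "add_subgroup V" for U V :: "(nat \<Rightarrow> 'k) set"
    using that by (auto simp: add_subgroup_def)
  have mod: "is_module (sum_gmod M N)"
    unfolding is_module_def
    using grp[OF mM(1) mN(1)] by (auto simp: mM mN interleave_add sum_gmod_def)
  obtain S where S: "finite S" "spanning M S"
    using graded_moduleD(1)[OF M] by (auto simp: fd_module_iff)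
  obtain T where T: "finite T" "spanning N T"
    using graded_moduleD(1)[OF N] by (auto simp: fd_module_iff)
  have "spanning (sum_gmod M N) ((\<lambda>x. interleave x 0) ` S \<union> (\<lambda>y. interleave 0 y) ` T)"
    unfolding spanning_def
  proof (intro conjI allI impI subsetI)
    show "z \<in> carr (sum_gmod M N)" if "z \<in> (\<lambda>x. interleave x 0) ` S \<union> (\<lambda>y. interleave 0 y) ` T" for z
      using that S T graded_moduleD(7)[OF M] graded_moduleD(7)[OF N] by (auto simp: spanning_def)
  next
    fix W z assume W: "subspace_of (sum_gmod M N) W \<and> (\<lambda>x. interleave x 0) ` S \<union> (\<lambda>y. interleave 0 y) ` T \<subseteq> W"
      and z: "z \<in> carr (sum_gmod M N)"
    have W1: "add_subgroup W" using W by (auto simp: subspace_of_def)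
    have "subspace_of M {x \<in> carr M. interleave x 0 \<in> W}"
      by (rule subspace_of_vimage[OF graded_moduleD(2)[OF M] mod])
        (use W in \<open>auto simp: interleave_add[symmetric] scalar_act_def act_0[OF graded_moduleD(2)[OF N]]\<close>)
    then have "carr M \<subseteq> {x \<in> carr M. interleave x 0 \<in> W}"
      by (rule spanningD(2)[OF S(2)]) (use W spanningD(1)[OF S(2)] in auto)
    moreover have "subspace_of N {x \<in> carr N. interleave 0 x \<in> W}"
      by (rule subspace_of_vimage[OF graded_moduleD(2)[OF N] mod])
        (use W in \<open>auto simp: interleave_add[symmetric] scalar_act_def act_0[OF graded_moduleD(2)[OF M]]\<close>)
    then have "carr N \<subseteq> {x \<in> carr N. interleave 0 x \<in> W}"
      by (rule spanningD(2)[OF T(2)]) (use W spanningD(1)[OF T(2)] in auto)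
    ultimately have "interleave (evens z) 0 \<in> W" "interleave 0 (odds z) \<in> W" using z by auto
    then have "interleave (evens z) 0 + interleave 0 (odds z) \<in> W" using W1 by (simp add: add_subgroup_add)
    then show "z \<in> W" by (simp add: interleave_add[symmetric])
  qed
  moreover have "finite ((\<lambda>x. interleave x 0) ` S \<union> (\<lambda>y. interleave 0 y) ` T)" using S(1) T(1) by simp
  ultimately show "fd_module B (sum_gmod M N)" using mod unfolding fd_module_iff by blast
  note dM = graded_moduleD(3)[OF M] and dN = graded_moduleD(3)[OF N]
  show "direct_sum_decomposition (gr (sum_gmod M N)) (carr (sum_gmod M N))"
  proof (rule direct_sum_decompositionI
      [where c = "\<lambda>z i. interleave (hcomp (gr M) (evens z) i) (hcomp (gr N) (odds z) i)"])
    fix z assume "z \<in> carr (sum_gmod M N)"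
    then have z: "evens z \<in> carr M" "odds z \<in> carr N" by auto
    let ?J = "{i. hcomp (gr M) (evens z) i \<noteq> 0} \<union> {i. hcomp (gr N) (odds z) i \<noteq> 0}"
    have fin: "finite ?J" using hcomp_props(2)[OF dM z(1)] hcomp_props(2)[OF dN z(2)] by simp
    have "(\<Sum>i\<in>?J. hcomp (gr M) (evens z) i) = (\<Sum>i | hcomp (gr M) (evens z) i \<noteq> 0. hcomp (gr M) (evens z) i)"
      by (rule sum.mono_neutral_right[OF fin]) auto
    then have l: "(\<Sum>i\<in>?J. hcomp (gr M) (evens z) i) = evens z"
      using hcomp_props(3)[OF dM z(1)] by (rule trans)
    have "(\<Sum>i\<in>?J. hcomp (gr N) (odds z) i) = (\<Sum>i | hcomp (gr N) (odds z) i \<noteq> 0. hcomp (gr N) (odds z) i)"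
      by (rule sum.mono_neutral_right[OF fin]) auto
    then have r: "(\<Sum>i\<in>?J. hcomp (gr N) (odds z) i) = odds z"
      using hcomp_props(3)[OF dN z(2)] by (rule trans)
    have "z = (\<Sum>i\<in>?J. interleave (hcomp (gr M) (evens z) i) (hcomp (gr N) (odds z) i))"
      unfolding interleave_sum[symmetric] l r by simp
    then show "\<exists>J. finite J \<and> (\<forall>i. i \<notin> J \<longrightarrow> interleave (hcomp (gr M) (evens z) i) (hcomp (gr N) (odds z) i) = 0) \<and>
        z = (\<Sum>i\<in>J. interleave (hcomp (gr M) (evens z) i) (hcomp (gr N) (odds z) i))"
      using fin by (intro exI[of _ ?J]) auto
  next
    show "add_subgroup (carr (sum_gmod M N))" using mod by (simp add: is_module_def)
    show "add_subgroup (gr (sum_gmod M N) i)" for i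
      using grp[OF graded_moduleD(5)[OF M] graded_moduleD(5)[OF N], of i i]
      by (simp add: sum_gmod_def)
    show "gr (sum_gmod M N) i \<subseteq> carr (sum_gmod M N)" for i
      using graded_moduleD(6)[OF M, of i] graded_moduleD(6)[OF N, of i] by auto
  qed (auto simp: hcomp_props(1)[OF dM] hcomp_props(1)[OF dN] hcomp_add[OF dM] hcomp_add[OF dN]
      hcomp_homogeneous[OF dM] hcomp_homogeneous[OF dN] interleave_add)
next
  fix n j b v assume "b \<in> grading B n" "v \<in> gr (sum_gmod M N) j"
  then show "act (sum_gmod M N) b v \<in> gr (sum_gmod M N) (int n + j)"
    using graded_moduleD(9)[OF M] graded_moduleD(9)[OF N] by simp
qed

text \<open>Quotients are realised on the type \<open>nat \<Rightarrow> 'k\<close>, through coordinates modulo the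
  submodule.\<close>

lemma quotient_gmod:
  fixes M :: "('b, 'm::ab_group_add) gmod"
  assumes M: "graded_module B M" and S: "homogeneous_submodule M S"
  obtains Y :: "('k, 'b) ugmod" and \<kappa> where "graded_module B Y" "\<kappa> \<in> graded_hom M Y"
    "\<kappa> ` carr M = carr Y" "mod_ker M \<kappa> = S" "\<And>j. gr Y j = \<kappa> ` gr M j"
proof -
  note mM = is_moduleD[OF graded_moduleD(2)[OF M]] and d = graded_moduleD(3)[OF M]
  note sub = submoduleD[OF homogeneous_submoduleD(1)[OF S]]
  obtain \<kappa> :: "'m \<Rightarrow> nat \<Rightarrow> 'k" where *: "additive_on (carr M) \<kappa>" "{v \<in> carr M. \<kappa> v = 0} = S"
    using coordinates[OF graded_moduleD(1)[OF M] submodule_subspace_of[OF homogeneous_submoduleD(1)[OF S]]] by blast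
  have add: "\<kappa> (v + w) = \<kappa> v + \<kappa> w" if "v \<in> carr M" "w \<in> carr M" for v w
    using *(1) that by (simp add: additive_on_def)
  have ker: "\<kappa> v = 0 \<longleftrightarrow> v \<in> S" if "v \<in> carr M" for v
    using *(2) that by blast
  have \<kappa>0: "\<kappa> 0 = 0" using mM(1) add by (rule additive_on_0)
  have neg: "\<kappa> (- v) = - \<kappa> v" if "v \<in> carr M" for v
    using mM(1) add that by (rule additive_on_uminus)
  have diff: "\<kappa> (v - w) = \<kappa> v - \<kappa> w" if "v \<in> carr M" "w \<in> carr M" for v w
    using mM(1) add that by (rule additive_on_diff)
  define rep where "rep y = (SOME v. v \<in> carr M \<and> \<kappa> v = y)" for y
  have rep: "rep (\<kappa> v) \<in> carr M" "\<kappa> (rep (\<kappa> v)) = \<kappa> v" "rep (\<kappa> v) - v \<in> S"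
    if v: "v \<in> carr M" for v
  proof -
    have "rep (\<kappa> v) \<in> carr M \<and> \<kappa> (rep (\<kappa> v)) = \<kappa> v"
      unfolding rep_def by (rule someI[of _ v]) (simp add: v)
    then show a: "rep (\<kappa> v) \<in> carr M" "\<kappa> (rep (\<kappa> v)) = \<kappa> v" by auto
    have "\<kappa> (rep (\<kappa> v) - v) = 0" using a v by (simp add: diff)
    then show "rep (\<kappa> v) - v \<in> S"
      using ker a(1) v add_subgroup_diff[OF mM(1)] by blast
  qed
  define Y :: "('k, 'b) ugmod" where
    "Y = \<lparr>carr = \<kappa> ` carr M, act = (\<lambda>b y. \<kappa> (act M b (rep y))), gr = (\<lambda>j. \<kappa> ` gr M j)\<rparr>"
  have Y: "carr Y = \<kappa> ` carr M" "gr Y j = \<kappa> ` gr M j" for j by (simp_all add: Y_def)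
  have act: "act Y b (\<kappa> v) = \<kappa> (act M b v)" if v: "v \<in> carr M" for b v
  proof -
    have c: "rep (\<kappa> v) - v \<in> carr M" using rep[OF v] sub(2) by blast
    have "act M b (rep (\<kappa> v)) = act M b (rep (\<kappa> v) - v) + act M b v"
      using mM(3)[OF c v] by simp
    moreover have "\<kappa> (act M b (rep (\<kappa> v) - v)) = 0"
      using ker[OF mM(2)[OF c]] sub(3)[OF rep(3)[OF v]] by simp
    ultimately show ?thesis using add mM(2)[OF c] mM(2)[OF v] by (simp add: Y_def)
  qed
  have grM: "v \<in> gr M j \<Longrightarrow> v \<in> carr M" for v j using graded_moduleD(6)[OF M] by blast
  have img: "add_subgroup (\<kappa> ` U)" if "add_subgroup U" "U \<subseteq> carr M" for U
    unfolding add_subgroup_def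
  proof (intro conjI ballI)
    show "0 \<in> \<kappa> ` U" using \<kappa>0 add_subgroup_0[OF that(1)] by force
    show "x + y \<in> \<kappa> ` U" if "x \<in> \<kappa> ` U" "y \<in> \<kappa> ` U" for x y
      using that \<open>U \<subseteq> carr M\<close> add[symmetric] add_subgroup_add[OF \<open>add_subgroup U\<close>]
      by (auto simp: subset_iff)
    show "- x \<in> \<kappa> ` U" if "x \<in> \<kappa> ` U" for x
      using that \<open>U \<subseteq> carr M\<close> neg[symmetric] add_subgroup_uminus[OF \<open>add_subgroup U\<close>]
      by (auto simp: subset_iff)
  qed
  have mod: "is_module Y"
    unfolding is_module_def Y(1)
    using img[OF mM(1)] by (auto simp: act mM add[symmetric] add_subgroup_add)
  have hom: "\<kappa> \<in> graded_hom M Y"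
    by (rule graded_homI) (auto simp: Y act add)
  have "graded_module B Y"
    unfolding graded_module_def
  proof (intro conjI allI ballI)
    obtain T where T: "finite T" "spanning M T"
      using graded_moduleD(1)[OF M] by (auto simp: fd_module_iff)
    have "spanning Y (\<kappa> ` T)"
      unfolding spanning_def
    proof (intro conjI allI impI)
      show "\<kappa> ` T \<subseteq> carr Y" using spanningD(1)[OF T(2)] by (auto simp: Y)
      fix W assume W: "subspace_of Y W \<and> \<kappa> ` T \<subseteq> W"
      have "subspace_of M {x \<in> carr M. \<kappa> x \<in> W}"
        by (rule subspace_of_vimage[OF graded_moduleD(2)[OF M] mod])
          (use W in \<open>auto simp: add scalar_act_def act\<close>)
      then have "carr M \<subseteq> {x \<in> carr M. \<kappa> x \<in> W}"
        by (rule spanningD(2)[OF T(2)]) (use W spanningD(1)[OF T(2)] in auto)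
      then show "carr Y \<subseteq> W" by (auto simp: Y)
    qed
    then show "fd_module B Y" using mod finite_imageI[OF T(1)] unfolding fd_module_iff by blast
    have c: "hcomp (gr M) (rep (\<kappa> v)) j - hcomp (gr M) v j \<in> S"
      and eq: "\<kappa> (hcomp (gr M) (rep (\<kappa> v)) j) = \<kappa> (hcomp (gr M) v j)" if v: "v \<in> carr M" for v j
    proof -
      note r = rep[OF v]
      have "hcomp (gr M) (rep (\<kappa> v)) j = hcomp (gr M) (rep (\<kappa> v) - v) j + hcomp (gr M) v j"
        using hcomp_add[OF d, of "rep (\<kappa> v) - v" v j] r v sub(2) by auto
      then show c: "hcomp (gr M) (rep (\<kappa> v)) j - hcomp (gr M) v j \<in> S"
        using homogeneous_submoduleD(2)[OF S r(3), of j] by simp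
      have "\<kappa> (hcomp (gr M) (rep (\<kappa> v)) j - hcomp (gr M) v j) = 0"
        using ker c sub(2) by blast
      then show "\<kappa> (hcomp (gr M) (rep (\<kappa> v)) j) = \<kappa> (hcomp (gr M) v j)"
        using diff hcomp_carr[OF M] r(1) v by simp
    qed
    show "direct_sum_decomposition (gr Y) (carr Y)"
    proof (rule direct_sum_decompositionI[where c = "\<lambda>y j. \<kappa> (hcomp (gr M) (rep y) j)"])
      show "add_subgroup (carr Y)" using mod by (simp add: is_module_def)
      show "add_subgroup (gr Y i)" for i
        unfolding Y by (rule img) (use graded_moduleD(5,6)[OF M] in auto)
      show "gr Y i \<subseteq> carr Y" for i using grM by (auto simp: Y)
    next
      fix y assume "y \<in> carr Y"
      then obtain v where v: "v \<in> carr M" "y = \<kappa> v" by (auto simp: Y)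
      show "\<kappa> (hcomp (gr M) (rep y) i) \<in> gr Y i" for i
        using eq v hcomp_props(1)[OF d] by (auto simp: Y)
      obtain J where J: "finite J" "\<And>i. i \<notin> J \<Longrightarrow> hcomp (gr M) v i = 0"
        "v = (\<Sum>i\<in>J. hcomp (gr M) v i)"
        using hcomp_sum[OF d v(1)] by blast
      have "\<kappa> v = \<kappa> (\<Sum>i\<in>J. hcomp (gr M) v i)" using J(3) by simp
      also have "\<dots> = (\<Sum>i\<in>J. \<kappa> (hcomp (gr M) v i))"
        using mM(1) add by (rule additive_on_sum) (use hcomp_carr[OF M v(1)] in auto)
      finally have "y = (\<Sum>i\<in>J. \<kappa> (hcomp (gr M) (rep y) i))"
        unfolding v(2) eq[OF v(1)] .
      moreover have "\<forall>i. i \<notin> J \<longrightarrow> \<kappa> (hcomp (gr M) (rep y) i) = 0"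
        unfolding v(2) eq[OF v(1)] using J(2) \<kappa>0 by simp
      ultimately show "\<exists>J. finite J \<and> (\<forall>i. i \<notin> J \<longrightarrow> \<kappa> (hcomp (gr M) (rep y) i) = 0) \<and>
          y = (\<Sum>i\<in>J. \<kappa> (hcomp (gr M) (rep y) i))"
        using J(1) by blast
      show "\<kappa> (hcomp (gr M) (rep (y + y')) i) =
          \<kappa> (hcomp (gr M) (rep y) i) + \<kappa> (hcomp (gr M) (rep y') i)" if y': "y' \<in> carr Y" for y' i
      proof -
        obtain v' where v': "v' \<in> carr M" "y' = \<kappa> v'" using y' by (auto simp: Y)
        have "y + y' = \<kappa> (v + v')" using v v' by (simp add: add)
        then have "\<kappa> (hcomp (gr M) (rep (y + y')) i) = \<kappa> (hcomp (gr M) (v + v') i)"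
          using eq[OF add_subgroup_add[OF mM(1) v(1) v'(1)]] by simp
        also have "\<dots> = \<kappa> (hcomp (gr M) v i) + \<kappa> (hcomp (gr M) v' i)"
          unfolding hcomp_add[OF d v(1) v'(1)]
          by (rule add) (intro hcomp_carr[OF M] v(1) v'(1))+
        finally show ?thesis unfolding v(2) v'(2) eq[OF v(1)] eq[OF v'(1)] .
      qed
    next
      fix w i j assume "w \<in> gr Y j"
      then obtain v where v: "v \<in> gr M j" "w = \<kappa> v" by (auto simp: Y)
      then show "\<kappa> (hcomp (gr M) (rep w) i) = (if i = j then w else 0)"
        using grM hcomp_homogeneous[OF d v(1)] by (simp add: eq \<kappa>0)
    qed
  next
    fix n j b y assume "b \<in> grading B n" "y \<in> gr Y j"
    then show "act Y b y \<in> gr Y (int n + j)"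
      using graded_moduleD(9)[OF M] grM by (auto simp: Y act)
  qed
  moreover have "mod_ker M \<kappa> = S" using *(2) by (simp add: mod_ker_def)
  ultimately show ?thesis using that hom Y by blast
qed


section \<open>Projective resolutions\<close>

lemma evens_hom: "evens \<in> graded_hom (sum_gmod M N) M"
  and odds_hom: "odds \<in> graded_hom (sum_gmod M N) N"
  for M N :: "('k, 'b) ugmod"
  by (auto intro!: graded_homI)

lemma zero_hom:
  fixes N :: "('b, 'n::ab_group_add) gmod"
  assumes "graded_module B N"
  shows "(\<lambda>_. 0) \<in> graded_hom M N"
  using graded_moduleD(7,8)[OF assms] act_0[OF graded_moduleD(2)[OF assms]]
  by (auto intro!: graded_homI)

lemma add_hom:
  fixes M :: "('b, 'm::ab_group_add) gmod" and N :: "('b, 'n::ab_group_add) gmod"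
  assumes N: "graded_module B N" and f: "f \<in> graded_hom M N" "g \<in> graded_hom M N"
  shows "(\<lambda>x. f x + g x) \<in> graded_hom M N"
  using graded_moduleD(4,5)[OF N] is_moduleD(3)[OF graded_moduleD(2)[OF N]]
  by (intro graded_homI)
    (simp_all add: graded_homD[OF f(1)] graded_homD[OF f(2)] add_subgroup_add algebra_simps)

lemma uminus_hom:
  fixes M :: "('b, 'm::ab_group_add) gmod" and N :: "('b, 'n::ab_group_add) gmod"
  assumes N: "graded_module B N" and f: "f \<in> graded_hom M N"
  shows "(\<lambda>x. - f x) \<in> graded_hom M N"
  using graded_moduleD(4,5)[OF N] act_uminus[OF graded_moduleD(2)[OF N]]
  by (intro graded_homI) (simp_all add: graded_homD[OF f] add_subgroup_uminus)

lemma interleave_hom: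
  fixes M N :: "('k, 'b) ugmod"
  assumes "f \<in> graded_hom K M" "g \<in> graded_hom K N"
  shows "(\<lambda>x. interleave (f x) (g x)) \<in> graded_hom K (sum_gmod M N)"
  using graded_homD[OF assms(1)] graded_homD[OF assms(2)]
  by (intro graded_homI) (simp_all add: interleave_add)

lemma id_hom: "(\<lambda>x. x) \<in> graded_hom M M"
  by (intro graded_homI) simp_all

lemma graded_projectiveD:
  fixes P :: "('b, 'm::ab_group_add) gmod" and X Y :: "('k, 'b) ugmod"
  assumes "graded_projective B P"
  shows "graded_module B P"
    "graded_module B X \<Longrightarrow> graded_module B Y \<Longrightarrow> g \<in> graded_hom X Y \<Longrightarrow> g ` carr X = carr Y \<Longrightarrow>
      h \<in> graded_hom P Y \<Longrightarrow> \<exists>h'\<in>graded_hom P X. \<forall>v\<in>carr P. g (h' v) = h v"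
  using assms by (auto simp: graded_projective_def)

text \<open>The definition of projectivity only mentions targets on the type \<open>nat \<Rightarrow> 'k\<close>. Lifting along
  \<open>g : X \<rightarrow> Y\<close> for \<open>Y\<close> on any type amounts to splitting the projection to \<open>Q\<close> of the fibre product
  of \<open>Q\<close> and \<open>X\<close> over \<open>Y\<close>, which lives on \<open>nat \<Rightarrow> 'k\<close> again.\<close>

lemma projective_lift:
  fixes Q X :: "('k, 'b) ugmod" and Y :: "('b, 'm::ab_group_add) gmod"
  assumes Q: "graded_projective B Q" and X: "graded_module B X" and Y: "graded_module B Y"
    and g: "g \<in> graded_hom X Y" and h: "h \<in> graded_hom Q Y" and sub: "h ` carr Q \<subseteq> g ` carr X"
  shows "\<exists>h'\<in>graded_hom Q X. \<forall>v\<in>carr Q. g (h' v) = h v"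
proof -
  note Q' = graded_projectiveD(1)[OF Q]
  define k where "k z = h (evens z) + - g (odds z)" for z
  have "k \<in> graded_hom (sum_gmod Q X) Y"
    unfolding k_def by (intro add_hom uminus_hom Y graded_hom_comp[OF evens_hom h] graded_hom_comp[OF odds_hom g])
  then have K: "homogeneous_submodule (sum_gmod Q X) (mod_ker (sum_gmod Q X) k)"
    by (rule homogeneous_submodule_ker[OF graded_module_sum[OF Q' X] Y])
  let ?E = "sub_gmod (sum_gmod Q X) (mod_ker (sum_gmod Q X) k)"
  have E: "z \<in> carr ?E \<longleftrightarrow> evens z \<in> carr Q \<and> odds z \<in> carr X \<and> h (evens z) = g (odds z)" for z
    by (auto simp: mod_ker_def k_def)
  have incl: "(\<lambda>z. z) \<in> graded_hom ?E (sum_gmod Q X)"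
    by (rule graded_homI) (auto simp: mod_ker_def)
  have "evens ` carr ?E = carr Q"
  proof (intro equalityI subsetI)
    fix q assume q: "q \<in> carr Q"
    then obtain x where "x \<in> carr X" "h q = g x" using sub by blast
    then show "q \<in> evens ` carr ?E" using q E[of "interleave q x"] by (force simp: image_iff)
  qed (use E in auto)
  then obtain s where s: "s \<in> graded_hom Q ?E" "\<forall>v\<in>carr Q. evens (s v) = v"
    using graded_projectiveD(2)[OF Q graded_module_sub[OF graded_module_sum[OF Q' X] K] Q'
        graded_hom_comp[OF incl evens_hom] _ id_hom] by blast
  show ?thesis
  proof (intro bexI ballI)
    show "(\<lambda>v. odds (s v)) \<in> graded_hom Q X"
      by (rule graded_hom_comp[OF graded_hom_comp[OF s(1) incl] odds_hom])
    show "g (odds (s v)) = h v" if "v \<in> carr Q" for v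
      using graded_homD(1)[OF s(1) that] E[of "s v"] s(2) that by simp
  qed
qed

lemma graded_projective_zero: "graded_projective B (zero_gmod :: ('k, 'b) ugmod)"
  unfolding graded_projective_def
proof (intro conjI allI impI graded_module_zero)
  fix X Y :: "('k, 'b) ugmod" and g h :: "(nat \<Rightarrow> 'k) \<Rightarrow> nat \<Rightarrow> 'k"
  assume A: "graded_module B X \<and> graded_module B Y \<and> g \<in> graded_hom X Y \<and> g ` carr X = carr Y \<and>
    h \<in> graded_hom zero_gmod Y"
  then show "\<exists>h'\<in>graded_hom zero_gmod X. \<forall>v\<in>carr zero_gmod. g (h' v) = h v"
    using graded_hom_0[of X g Y] graded_hom_0[OF graded_module_zero, of h Y]
    by (intro bexI[of _ "\<lambda>_. 0"] zero_hom) auto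
qed

lemma graded_projective_sum:
  fixes P Q :: "('k, 'b) ugmod"
  assumes P: "graded_projective B P" and Q: "graded_projective B Q"
  shows "graded_projective B (sum_gmod P Q)"
  unfolding graded_projective_def
proof (intro conjI allI impI)
  note P' = graded_projectiveD(1)[OF P] and Q' = graded_projectiveD(1)[OF Q]
  show "graded_module B (sum_gmod P Q)" by (rule graded_module_sum[OF P' Q'])
  fix X Y :: "('k, 'b) ugmod" and g h :: "(nat \<Rightarrow> 'k) \<Rightarrow> nat \<Rightarrow> 'k"
  assume "graded_module B X \<and> graded_module B Y \<and> g \<in> graded_hom X Y \<and> g ` carr X = carr Y \<and>
    h \<in> graded_hom (sum_gmod P Q) Y"
  then have X: "graded_module B X" and Y: "graded_module B Y" and g: "g \<in> graded_hom X Y"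
    "g ` carr X = carr Y" and h: "h \<in> graded_hom (sum_gmod P Q) Y" by auto
  have hP: "(\<lambda>x. h (interleave x 0)) \<in> graded_hom P Y"
    by (rule graded_hom_comp[OF interleave_hom[OF id_hom zero_hom[OF Q']] h])
  have hQ: "(\<lambda>x. h (interleave 0 x)) \<in> graded_hom Q Y"
    by (rule graded_hom_comp[OF interleave_hom[OF zero_hom[OF P'] id_hom] h])
  obtain a where a: "a \<in> graded_hom P X" "\<forall>v\<in>carr P. g (a v) = h (interleave v 0)"
    using graded_projectiveD(2)[OF P X Y g hP] by blast
  obtain b where b: "b \<in> graded_hom Q X" "\<forall>v\<in>carr Q. g (b v) = h (interleave 0 v)"
    using graded_projectiveD(2)[OF Q X Y g hQ] by blast
  show "\<exists>h'\<in>graded_hom (sum_gmod P Q) X. \<forall>v\<in>carr (sum_gmod P Q). g (h' v) = h v"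
  proof (intro bexI ballI)
    show "(\<lambda>z. a (evens z) + b (odds z)) \<in> graded_hom (sum_gmod P Q) X"
      by (intro add_hom X graded_hom_comp[OF evens_hom a(1)] graded_hom_comp[OF odds_hom b(1)])
    fix z assume z: "z \<in> carr (sum_gmod P Q)"
    then have "g (a (evens z) + b (odds z)) = h (interleave (evens z) 0) + h (interleave 0 (odds z))"
      using a b by (simp add: graded_homD(1)[OF a(1)] graded_homD(1)[OF b(1)] graded_homD(2)[OF g(1)])
    also have "\<dots> = h (interleave (evens z) 0 + interleave 0 (odds z))"
      using z graded_moduleD(7)[OF P'] graded_moduleD(7)[OF Q']
      by (intro graded_homD(2)[OF h, symmetric]) auto
    also have "\<dots> = h z" by (simp add: interleave_add[symmetric])
    finally show "g (a (evens z) + b (odds z)) = h z" .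
  qed
qed

lemma graded_hom_shift_left: "graded_hom (shift r P) Y = graded_hom P (shift (- r) Y)"
  for P :: "('b, 'm::ab_group_add) gmod" and Y :: "('b, 'n::ab_group_add) gmod"
  using graded_hom_shift[of r P "shift (- r) Y"] by (simp add: shift_shift)

lemma graded_projective_shift:
  fixes P :: "('b, 'm::ab_group_add) gmod"
  assumes P: "graded_projective B P"
  shows "graded_projective B (shift r P)"
  unfolding graded_projective_def
proof (intro conjI allI impI graded_module_shift graded_projectiveD(1)[OF P])
  fix X Y :: "('k, 'b) ugmod" and g h
  assume "graded_module B X \<and> graded_module B Y \<and> g \<in> graded_hom X Y \<and> g ` carr X = carr Y \<and>
    h \<in> graded_hom (shift r P) Y"
  then show "\<exists>h'\<in>graded_hom (shift r P) X. \<forall>v\<in>carr (shift r P). g (h' v) = h v"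
    using graded_projectiveD(2)[OF P graded_module_shift[of X "- r"] graded_module_shift[of Y "- r"], of g h]
      graded_hom_shift[of "- r" X Y]
    by (simp add: graded_hom_shift_left)
qed

definition regular_gmod :: "('b, 'b) gmod" where
  "regular_gmod =
     \<lparr>carr = UNIV, act = (*), gr = (\<lambda>j. if j \<ge> 0 then grading B (nat j) else {0})\<rparr>"

lemma regular_gmod_simps: "carr regular_gmod = UNIV" "act regular_gmod = (*)"
  by (simp_all add: regular_gmod_def)

lemma graded_module_regular: "graded_module B regular_gmod"
  unfolding graded_module_def
proof (intro conjI allI ballI)
  have mod: "is_module regular_gmod"
    by (simp add: is_module_def regular_gmod_def add_subgroup_def algebra_simps)
  obtain S where S: "finite S" "span S = UNIV"
    using pos_graded by (auto simp: positively_graded_algebra_def fd_algebra_def)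
  have "spanning regular_gmod S"
    unfolding spanning_def
  proof (intro conjI allI impI)
    fix W assume W: "subspace_of regular_gmod W \<and> S \<subseteq> W"
    have "scalar_act regular_gmod c v = scal B c v" for c v
      by (simp add: scalar_act_def regular_gmod_def scal_mult)
    then have "subspace W"
      using W by (auto simp: subspace_of_def add_subgroup_def subspace_def)
    then show "carr regular_gmod \<subseteq> W" using W S(2) span_minimal[of S W] by (simp add: regular_gmod_def)
  qed (simp add: regular_gmod_def)
  then show "fd_module B regular_gmod" using mod S(1) by (auto simp: fd_module_iff)
  note d = grading_dsd
  let ?c = "\<lambda>v j. if j \<ge> 0 then hcomp (grading B) v (nat j) else 0"
  show "direct_sum_decomposition (gr regular_gmod) (carr regular_gmod)"
  proof (rule direct_sum_decompositionI[where c = ?c])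
    fix v
    obtain J where J: "finite J" "\<And>i. i \<notin> J \<Longrightarrow> hcomp (grading B) v i = 0"
      "v = (\<Sum>i\<in>J. hcomp (grading B) v i)"
      using hcomp_sum[OF d UNIV_I, of v] by blast
    show "\<exists>J. finite J \<and> (\<forall>i. i \<notin> J \<longrightarrow> ?c v i = 0) \<and> v = (\<Sum>i\<in>J. ?c v i)"
    proof (intro exI[of _ "int ` J"] conjI allI impI)
      show "?c v i = 0" if "i \<notin> int ` J" for i
        using that J(2)[of "nat i"] by (force simp: image_iff)
      show "v = (\<Sum>i\<in>int ` J. ?c v i)" using J(3) by (simp add: sum.reindex)
    qed (use J in simp)
  next
    fix w i j assume "w \<in> gr regular_gmod j"
    then show "?c w i = (if i = j then w else 0)"
      using hcomp_homogeneous[OF d, of w "nat j" "nat i"] hcomp_0[OF d]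
      by (auto simp: regular_gmod_def split: if_splits)
  qed (use dsd_subgroups[OF d] hcomp_props(1)[OF d] hcomp_add[OF d] in \<open>auto simp: regular_gmod_def\<close>)
next
  fix n j b v assume "b \<in> grading B n" "v \<in> gr regular_gmod j"
  moreover have "\<forall>m n. \<forall>x\<in>grading B m. \<forall>y\<in>grading B n. x * y \<in> grading B (m + n)"
    using pos_graded by (simp add: positively_graded_algebra_def)
  moreover have "0 \<in> grading B m" for m using dsd_subgroups(2)[OF grading_dsd] by (rule add_subgroup_0)
  ultimately show "act regular_gmod b v \<in> gr regular_gmod (int n + j)"
    by (auto simp: regular_gmod_def nat_add_distrib split: if_splits)
qed

text \<open>Resolutions consist of modules on the type \<open>nat \<Rightarrow> 'k\<close>, so the regular module is moved there; \<open>e\<close>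
  is the image of 1.\<close>

lemma regular_copy:
  obtains F :: "('k, 'b) ugmod" and e where "graded_module B F" "e \<in> gr F 0"
    "bij_betw (\<lambda>b. act F b e) UNIV (carr F)" "\<And>j. gr F j = (\<lambda>b. act F b e) ` gr regular_gmod j"
proof -
  note R = graded_module_regular
  have "homogeneous_submodule regular_gmod {0}"
    unfolding homogeneous_submodule_def submodule_def
    by (simp add: regular_gmod_simps hcomp_0[OF graded_moduleD(3)[OF R]])
  then obtain F :: "('k, 'b) ugmod" and \<kappa> where F: "graded_module B F" "\<kappa> \<in> graded_hom regular_gmod F"
    "\<kappa> ` carr regular_gmod = carr F" "mod_ker regular_gmod \<kappa> = {0}"
    "\<And>j. gr F j = \<kappa> ` gr regular_gmod j"
    using quotient_gmod[OF R] by blast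
  have \<kappa>: "\<kappa> b = act F b (\<kappa> 1)" for b
    using graded_homD(3)[OF F(2), of 1 b] by (simp add: regular_gmod_def)
  then have eq: "\<kappa> = (\<lambda>b. act F b (\<kappa> 1))" by (rule ext)
  have "inj \<kappa>"
  proof (rule injI)
    fix x y assume "\<kappa> x = \<kappa> y"
    then have "x - y \<in> mod_ker regular_gmod \<kappa>"
      using graded_hom_diff[OF R F(2), of x y] by (simp add: mod_ker_def regular_gmod_def)
    then show "x = y" using F(4) by simp
  qed
  then have "bij_betw \<kappa> UNIV (carr F)" using F(3) by (simp add: bij_betw_def regular_gmod_def)
  moreover have "(1 :: 'b) \<in> gr regular_gmod 0"
    using pos_graded by (simp add: positively_graded_algebra_def regular_gmod_def)
  then have "\<kappa> 1 \<in> gr F 0" using F(5) by blast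
  ultimately show ?thesis using that[of F "\<kappa> 1"] F(1,5) unfolding eq[symmetric] by blast
qed

text \<open>The universal property of the graded free module of rank one.\<close>

lemma hom_from_regular_copy:
  fixes F :: "('k, 'b) ugmod" and X :: "('b, 'm::ab_group_add) gmod"
  assumes F: "graded_module B F" "e \<in> gr F 0" and bij: "bij_betw (\<lambda>b. act F b e) UNIV (carr F)"
    and grF: "\<And>j. gr F j = (\<lambda>b. act F b e) ` gr regular_gmod j"
    and X: "graded_module B X" and x: "x \<in> gr X j"
  shows "\<exists>h\<in>graded_hom (shift j F) X. h e = x"
proof -
  note mF = is_moduleD[OF graded_moduleD(2)[OF F(1)]] and mX = is_moduleD[OF graded_moduleD(2)[OF X]]
  have e: "e \<in> carr F" using F graded_moduleD(6) by blast
  have x': "x \<in> carr X" using x graded_moduleD(6)[OF X] by blast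
  define h where "h y = act X (inv_into UNIV (\<lambda>b. act F b e) y) x" for y
  have h: "h (act F b e) = act X b x" for b
    using bij inv_into_f_f[of "\<lambda>b. act F b e" UNIV b] by (simp add: h_def bij_betw_def)
  have F_ex: "\<exists>b. y = act F b e" if "y \<in> carr F" for y
    using bij that by (auto simp: bij_betw_def)
  have "h \<in> graded_hom (shift j F) X"
  proof (rule graded_homI)
    fix v assume "v \<in> carr (shift j F)"
    then obtain b where b: "v = act F b e" using F_ex by auto
    then show "h v \<in> carr X" using mX(2)[OF x'] by (simp add: h)
    show "h (act (shift j F) a v) = act X a (h v)" for a
      using b by (simp add: h mF(5)[OF e, symmetric] mX(5)[OF x'])
    fix w assume "w \<in> carr (shift j F)"
    then obtain c where c: "w = act F c e" using F_ex by auto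
    show "h (v + w) = h v + h w"
      using b c by (simp add: h mF(4)[OF e, symmetric] mX(4)[OF x'])
  next
    fix i v assume "v \<in> gr (shift j F) i"
    then obtain b where b: "b \<in> gr regular_gmod (i - j)" "v = act F b e" using grF by auto
    show "h v \<in> gr X i"
    proof (cases "i - j \<ge> 0")
      case True
      then have "act X b x \<in> gr X (int (nat (i - j)) + j)"
        using b by (intro graded_moduleD(9)[OF X _ x]) (simp add: regular_gmod_def)
      then show ?thesis using True b by (simp add: h)
    next
      case False
      then have "b = 0" using b by (simp add: regular_gmod_def)
      then show ?thesis
        using b graded_moduleD(8)[OF X] act_zero_left[OF graded_moduleD(2)[OF X] x'] by (simp add: h)
    qed
  qed
  moreover have "h e = x" using h[of 1] mF(6)[OF e] mX(6)[OF x'] by simp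
  ultimately show ?thesis by blast
qed

text \<open>A preimage of the image of the generator may be replaced by its component of degree \<open>j\<close>.\<close>

lemma graded_projective_regular_copy:
  fixes F :: "('k, 'b) ugmod"
  assumes F: "graded_module B F" "e \<in> gr F 0" and bij: "bij_betw (\<lambda>b. act F b e) UNIV (carr F)"
    and grF: "\<And>j. gr F j = (\<lambda>b. act F b e) ` gr regular_gmod j"
  shows "graded_projective B (shift j F)"
  unfolding graded_projective_def
proof (intro conjI allI impI graded_module_shift F)
  fix X Y :: "('k, 'b) ugmod" and g h
  assume "graded_module B X \<and> graded_module B Y \<and> g \<in> graded_hom X Y \<and> g ` carr X = carr Y \<and>
    h \<in> graded_hom (shift j F) Y"
  then have X: "graded_module B X" and Y: "graded_module B Y" and g: "g \<in> graded_hom X Y"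
    "g ` carr X = carr Y" and h: "h \<in> graded_hom (shift j F) Y" by auto
  have e: "e \<in> carr F" using F graded_moduleD(6) by blast
  have he: "h e \<in> gr Y j" using graded_homD(4)[OF h, of e j] F(2) by simp
  then have "h e \<in> carr Y" using graded_moduleD(6)[OF Y] by blast
  then obtain x where x: "x \<in> carr X" "g x = h e" using g(2) by force
  let ?x = "hcomp (gr X) x j"
  have "g ?x = hcomp (gr Y) (g x) j" by (rule hcomp_graded_hom[OF X Y g(1) x(1), symmetric])
  then have gx: "g ?x = h e" using x hcomp_homogeneous[OF graded_moduleD(3)[OF Y] he] by simp
  have x': "?x \<in> gr X j" by (rule hcomp_props(1)[OF graded_moduleD(3)[OF X] x(1)])
  then obtain k where k: "k \<in> graded_hom (shift j F) X" "k e = ?x"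
    using hom_from_regular_copy[OF F bij grF X] by blast
  have "g (k v) = h v" if "v \<in> carr F" for v
  proof -
    obtain b where b: "v = act F b e" using bij \<open>v \<in> carr F\<close> by (auto simp: bij_betw_def)
    have "g (k v) = act Y b (h e)"
      using graded_homD(3)[OF k(1), of e b] graded_homD(3)[OF g(1), of ?x b] e k(2) gx b x' 
        graded_moduleD(6)[OF X, of j] by auto
    then show ?thesis using graded_homD(3)[OF h, of e b] e b by simp
  qed
  then show "\<exists>h'\<in>graded_hom (shift j F) X. \<forall>v\<in>carr (shift j F). g (h' v) = h v"
    using k(1) by auto
qed

lemma hom_image_submodule:
  fixes M :: "('b, 'm::ab_group_add) gmod" and N :: "('b, 'n::ab_group_add) gmod"
  assumes M: "graded_module B M" and N: "graded_module B N" and f: "f \<in> graded_hom M N"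
  shows "submodule N (f ` carr M)"
  unfolding submodule_def add_subgroup_def
proof (intro conjI ballI allI)
  note mM = is_moduleD[OF graded_moduleD(2)[OF M]]
  show "0 \<in> f ` carr M" using graded_hom_0[OF M f] graded_moduleD(7)[OF M] by force
  show "x + y \<in> f ` carr M" if "x \<in> f ` carr M" "y \<in> f ` carr M" for x y
    using that graded_homD(2)[OF f, symmetric] add_subgroup_add[OF mM(1)] by auto
  show "- x \<in> f ` carr M" if "x \<in> f ` carr M" for x
    using that graded_hom_uminus[OF M f, symmetric] add_subgroup_uminus[OF mM(1)] by auto
  show "f ` carr M \<subseteq> carr N" using graded_homD(1)[OF f] by blast
  show "act N b x \<in> f ` carr M" if "x \<in> f ` carr M" for b x
    using that graded_homD(3)[OF f, symmetric] mM(2) by auto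
qed

text \<open>The homogeneous components of a finite spanning set are hit by a finite sum of shifted copies of
  the regular module.\<close>

lemma enough_projectives:
  fixes M :: "('b, 'm::ab_group_add) gmod"
  assumes M: "graded_module B M"
  obtains P :: "('k, 'b) ugmod" and p where "graded_projective B P" "p \<in> graded_hom P M"
    "p ` carr P = carr M"
proof -
  note d = graded_moduleD(3)[OF M]
  have cover: "\<exists>(P :: ('k, 'b) ugmod) p. graded_projective B P \<and> p \<in> graded_hom P M \<and> H \<subseteq> p ` carr P"
    if "finite H" "H \<subseteq> (\<Union>j. gr M j)" for H
    using that
  proof (induction H)
    case empty
    show ?case using graded_projective_zero zero_hom[OF M] by blast
  next
    case (insert x H)
    then obtain P :: "('k, 'b) ugmod" and p where
      P: "graded_projective B P" "p \<in> graded_hom P M" "H \<subseteq> p ` carr P" by auto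
    obtain F :: "('k, 'b) ugmod" and e where F: "graded_module B F" "e \<in> gr F 0"
      "bij_betw (\<lambda>b. act F b e) UNIV (carr F)" "\<And>j. gr F j = (\<lambda>b. act F b e) ` gr regular_gmod j"
      using regular_copy by metis
    obtain j where "x \<in> gr M j" using insert.prems by auto
    then obtain h where h: "h \<in> graded_hom (shift j F) M" "h e = x"
      using hom_from_regular_copy[OF F M] by blast
    let ?P = "sum_gmod P (shift j F)" and ?p = "\<lambda>z. p (evens z) + h (odds z)"
    have p: "?p \<in> graded_hom ?P M"
      by (intro add_hom M graded_hom_comp[OF evens_hom P(2)] graded_hom_comp[OF odds_hom h(1)])
    have "insert x H \<subseteq> ?p ` carr ?P"
    proof (intro subsetI, elim insertE)
      fix y assume "y = x"
      moreover have "e \<in> carr F" using F(1,2) graded_moduleD(6) by blast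
      moreover have "p 0 = 0" by (rule graded_hom_0[OF graded_projectiveD(1)[OF P(1)] P(2)])
      ultimately show "y \<in> ?p ` carr ?P"
        using h(2) graded_moduleD(7)[OF graded_projectiveD(1)[OF P(1)]]
        by (intro image_eqI[of _ _ "interleave 0 e"]) simp_all
    next
      fix y assume "y \<in> H"
      then obtain z where "z \<in> carr P" "y = p z" using P(3) by blast
      moreover have "h 0 = 0" by (rule graded_hom_0[OF graded_module_shift[OF F(1)] h(1)])
      ultimately show "y \<in> ?p ` carr ?P"
        using graded_moduleD(7)[OF F(1)]
        by (intro image_eqI[of _ _ "interleave z 0"]) simp_all
    qed
    then show ?case
      using graded_projective_sum[OF P(1) graded_projective_regular_copy[OF F]] p by blast
  qed
  obtain S where S: "finite S" "spanning M S"
    using graded_moduleD(1)[OF M] by (auto simp: fd_module_iff)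
  let ?H = "\<Union>s\<in>S. hcomp (gr M) s ` {i. hcomp (gr M) s i \<noteq> 0}"
  have SM: "s \<in> carr M" if "s \<in> S" for s using spanningD(1)[OF S(2)] that by blast
  have "finite ?H" using S(1) hcomp_props(2)[OF d SM] by blast
  moreover have "?H \<subseteq> (\<Union>j. gr M j)" using hcomp_props(1)[OF d SM] by blast
  ultimately obtain P :: "('k, 'b) ugmod" and p where
    P: "graded_projective B P" "p \<in> graded_hom P M" "?H \<subseteq> p ` carr P" using cover by meson
  have sub: "submodule M (p ` carr P)"
    by (rule hom_image_submodule[OF graded_projectiveD(1)[OF P(1)] M P(2)])
  have "S \<subseteq> p ` carr P"
  proof
    fix s assume s: "s \<in> S"
    have "(\<Sum>i | hcomp (gr M) s i \<noteq> 0. hcomp (gr M) s i) \<in> p ` carr P"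
      using P(3) s by (intro add_subgroup_sum[OF submoduleD(1)[OF sub]]) blast
    then show "s \<in> p ` carr P" using hcomp_props(3)[OF d SM[OF s]] by simp
  qed
  then have "p ` carr P = carr M"
    using spanningD(2)[OF S(2) submodule_subspace_of[OF sub]] submoduleD(2)[OF sub] by blast
  then show ?thesis using that P(1,2) by blast
qed

lemma resolution_exists:
  fixes M :: "('b, 'm::ab_group_add) gmod"
  assumes M: "graded_module B M"
  obtains P d \<epsilon> where "graded_projective_resolution B M P d \<epsilon>"
proof -
  obtain P0 :: "('k, 'b) ugmod" and \<epsilon> where P0: "graded_projective B P0" "\<epsilon> \<in> graded_hom P0 M"
    "\<epsilon> ` carr P0 = carr M"
    using enough_projectives[OF M] by blast
  have step: "\<exists>(P' :: ('k, 'b) ugmod) p'. graded_projective B P' \<and> p' \<in> graded_hom P' P \<and>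
      p' ` carr P' = mod_ker P p"
    if P: "graded_module B P" "graded_module B Y" "p \<in> graded_hom P Y"
    for P :: "('k, 'b) ugmod" and Y :: "('b, 'n::ab_group_add) gmod" and p
  proof -
    note K = homogeneous_submodule_ker[OF P]
    obtain P' :: "('k, 'b) ugmod" and p' where P': "graded_projective B P'"
      "p' \<in> graded_hom P' (sub_gmod P (mod_ker P p))"
      "p' ` carr P' = carr (sub_gmod P (mod_ker P p))"
      using enough_projectives[OF graded_module_sub[OF P(1) K]] by blast
    have "(\<lambda>x. x) \<in> graded_hom (sub_gmod P (mod_ker P p)) P"
      by (rule graded_homI) (auto simp: mod_ker_def)
    from graded_hom_comp[OF P'(2) this] P'(1,3) show ?thesis by auto
  qed
  \<comment> \<open>The state of the recursion is the last module constructed together with its differential; \<open>Y\<close>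
    only records that this differential is a homomorphism, so that its kernel is a graded module.\<close>
  define I where "I = (\<lambda>n :: nat. \<lambda>(P :: ('k, 'b) ugmod, p :: (nat \<Rightarrow> 'k) \<Rightarrow> nat \<Rightarrow> 'k).
    graded_projective B P \<and> (\<exists>Y. graded_module B Y \<and> p \<in> graded_hom P Y) \<and>
    (n = 0 \<longrightarrow> p \<in> graded_hom P P0 \<and> p ` carr P = mod_ker P0 \<epsilon>))"
  define R where "R = (\<lambda>n :: nat. \<lambda>(P :: ('k, 'b) ugmod, p :: (nat \<Rightarrow> 'k) \<Rightarrow> nat \<Rightarrow> 'k)
    (P' :: ('k, 'b) ugmod, p'). p' \<in> graded_hom P' P \<and> p' ` carr P' = mod_ker P p)"
  have "\<exists>f. \<forall>n. I n (f n) \<and> R n (f n) (f (Suc n))"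
  proof (rule dependent_nat_choice)
    show "\<exists>x. I 0 x"
      using step[OF graded_projectiveD(1)[OF P0(1)] M P0(2)] graded_projectiveD(1)[OF P0(1)]
      by (auto simp: I_def)
    show "\<exists>y. I (Suc n) y \<and> R n x y" if I: "I n x" for x n
    proof -
      obtain P p where x: "x = (P, p)" by fastforce
      then obtain Y :: "('k, 'b) ugmod" where Y: "graded_projective B P" "graded_module B Y" "p \<in> graded_hom P Y"
        using I by (auto simp: I_def)
      from step[OF graded_projectiveD(1)[OF Y(1)] Y(2,3)] graded_projectiveD(1)[OF Y(1)]
      show ?thesis by (auto simp: I_def R_def x)
    qed
  qed
  then obtain f where f: "\<And>n. I n (f n)" "\<And>n. R n (f n) (f (Suc n))" by blast
  define P where "P n = (case n of 0 \<Rightarrow> P0 | Suc m \<Rightarrow> fst (f m))" for n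
  define d where "d n = snd (f n)" for n
  have "graded_projective_resolution B M P d \<epsilon>"
    unfolding graded_projective_resolution_def
  proof (intro conjI allI P0)
    show "graded_projective B (P n)" for n
      using P0(1) f(1)[of "n - 1"] by (auto simp: P_def I_def split: nat.split)
    show "d n \<in> graded_hom (P (Suc n)) (P n)" for n
      using f(1)[of 0] f(2)[of "n - 1"] by (auto simp: P_def d_def I_def R_def split: nat.split)
    show "\<epsilon> \<in> graded_hom (P 0) M" "\<epsilon> ` carr (P 0) = carr M" using P0 by (simp_all add: P_def)
    show "mod_ker (P 0) \<epsilon> = d 0 ` carr (P 1)"
      using f(1)[of 0] by (auto simp: P_def d_def I_def)
    show "mod_ker (P (Suc n)) (d n) = d (Suc n) ` carr (P (Suc (Suc n)))" for n
      using f(2)[of n] by (auto simp: P_def d_def R_def)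
  qed
  then show ?thesis by (rule that)
qed

end


section \<open>The mapping cone and two exactness properties of Ext\<close>

text \<open>The complex \<open>Q\<close> moved up by one degree, so that it starts with the zero module; this lets the cone
  be treated uniformly in all degrees.\<close>

definition cone_tail :: "(nat \<Rightarrow> ('b, 'm::zero) gmod) \<Rightarrow> nat \<Rightarrow> ('b, 'm) gmod" where
  "cone_tail Q n = (case n of 0 \<Rightarrow> zero_gmod | Suc m \<Rightarrow> Q m)"

definition cone_tail_d :: "(nat \<Rightarrow> 'm \<Rightarrow> 'm) \<Rightarrow> nat \<Rightarrow> 'm \<Rightarrow> 'm::zero" where
  "cone_tail_d d n = (case n of 0 \<Rightarrow> (\<lambda>_. 0) | Suc m \<Rightarrow> d m)"

lemma cone_tail_simps [simp]:
  "cone_tail Q 0 = zero_gmod" "cone_tail Q (Suc n) = Q n"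
  "cone_tail_d d 0 = (\<lambda>_. 0)" "cone_tail_d d (Suc n) = d n"
  by (simp_all add: cone_tail_def cone_tail_d_def)

definition cone :: "(nat \<Rightarrow> ('b, nat \<Rightarrow> 'k::zero) gmod) \<Rightarrow> (nat \<Rightarrow> ('b, nat \<Rightarrow> 'k) gmod) \<Rightarrow> nat \<Rightarrow>
    ('b, nat \<Rightarrow> 'k) gmod" where
  "cone P Q n = sum_gmod (P n) (cone_tail Q n)"

text \<open>The sign on the second component is what makes the square of the differential vanish.\<close>

definition cone_d :: "(nat \<Rightarrow> (nat \<Rightarrow> 'k::ab_group_add) \<Rightarrow> nat \<Rightarrow> 'k) \<Rightarrow> (nat \<Rightarrow> (nat \<Rightarrow> 'k) \<Rightarrow> nat \<Rightarrow> 'k) \<Rightarrow>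
    (nat \<Rightarrow> (nat \<Rightarrow> 'k) \<Rightarrow> nat \<Rightarrow> 'k) \<Rightarrow> nat \<Rightarrow> (nat \<Rightarrow> 'k) \<Rightarrow> nat \<Rightarrow> 'k" where
  "cone_d dP dQ \<phi> n z = interleave (dP n (evens z) + \<phi> n (odds z)) (- cone_tail_d dQ n (odds z))"

context pos_graded_algebra
begin

lemma resolutionD:
  fixes M :: "('b, 'm::ab_group_add) gmod"
  assumes "graded_projective_resolution B M P d \<epsilon>"
  shows "graded_projective B (P n)" "graded_module B (P n)" "d n \<in> graded_hom (P (Suc n)) (P n)"
    "\<epsilon> \<in> graded_hom (P 0) M" "\<epsilon> ` carr (P 0) = carr M"
    "x \<in> carr (P 0) \<Longrightarrow> \<epsilon> x = 0 \<longleftrightarrow> x \<in> d 0 ` carr (P (Suc 0))"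
    "x \<in> carr (P (Suc n)) \<Longrightarrow> d n x = 0 \<longleftrightarrow> x \<in> d (Suc n) ` carr (P (Suc (Suc n)))"
    "x \<in> carr (P (Suc 0)) \<Longrightarrow> \<epsilon> (d 0 x) = 0"
    "x \<in> carr (P (Suc (Suc n))) \<Longrightarrow> d n (d (Suc n) x) = 0"
proof -
  have A: "mod_ker (P 0) \<epsilon> = d 0 ` carr (P (Suc 0))"
    "mod_ker (P (Suc n)) (d n) = d (Suc n) ` carr (P (Suc (Suc n)))" for n
    using assms unfolding graded_projective_resolution_def by auto
  show "graded_projective B (P n)" "d n \<in> graded_hom (P (Suc n)) (P n)"
    "\<epsilon> \<in> graded_hom (P 0) M" "\<epsilon> ` carr (P 0) = carr M"
    using assms unfolding graded_projective_resolution_def by auto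
  then show "graded_module B (P n)" by (simp add: graded_projectiveD(1))
  show "x \<in> carr (P 0) \<Longrightarrow> \<epsilon> x = 0 \<longleftrightarrow> x \<in> d 0 ` carr (P (Suc 0))"
    "x \<in> carr (P (Suc 0)) \<Longrightarrow> \<epsilon> (d 0 x) = 0"
    using A(1) unfolding mod_ker_def by blast+
  show "x \<in> carr (P (Suc n)) \<Longrightarrow> d n x = 0 \<longleftrightarrow> x \<in> d (Suc n) ` carr (P (Suc (Suc n)))"
    "x \<in> carr (P (Suc (Suc n))) \<Longrightarrow> d n (d (Suc n) x) = 0"
    using A(2)[of n] unfolding mod_ker_def by blast+
qed

text \<open>Each step lifts \<open>\<phi>\<^sub>n \<circ> dQ\<^sub>n\<close> along \<open>dP\<^sub>n\<close>, which is possible because \<open>dP\<close> is exact and the composite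
  is a cycle by the previous step.\<close>

lemma chain_map_lift:
  fixes M :: "('b, 'm::ab_group_add) gmod" and M' :: "('b, 'n::ab_group_add) gmod"
  assumes Q: "graded_projective_resolution B M' Q dQ eQ"
    and P: "graded_projective_resolution B M P dP eP"
    and M: "graded_module B M" and i: "i \<in> graded_hom M' M"  "i 0 = 0"
  obtains \<phi> where "\<And>n. \<phi> n \<in> graded_hom (Q n) (P n)"
    "\<And>x. x \<in> carr (Q 0) \<Longrightarrow> eP (\<phi> 0 x) = i (eQ x)"
    "\<And>n x. x \<in> carr (Q (Suc n)) \<Longrightarrow> \<phi> n (dQ n x) = dP n (\<phi> (Suc n) x)"
proof -
  note q = resolutionD[OF Q] and p = resolutionD[OF P]
  have "(\<lambda>x. i (eQ x)) ` carr (Q 0) \<subseteq> eP ` carr (P 0)"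
    using p(5) graded_homD(1)[OF i(1)] graded_homD(1)[OF q(4)] by auto
  then obtain \<phi>0 where \<phi>0: "\<phi>0 \<in> graded_hom (Q 0) (P 0)" "\<And>x. x \<in> carr (Q 0) \<Longrightarrow> eP (\<phi>0 x) = i (eQ x)"
    using projective_lift[OF q(1) p(2) M p(4) graded_hom_comp[OF q(4) i(1)]] by blast
  define I where "I n \<psi> \<longleftrightarrow> \<psi> \<in> graded_hom (Q n) (P n) \<and>
    (\<forall>x\<in>carr (Q (Suc n)). \<psi> (dQ n x) \<in> dP n ` carr (P (Suc n))) \<and> (n = 0 \<longrightarrow> \<psi> = \<phi>0)" for n \<psi>
  define R where "R n \<psi> \<psi>' \<longleftrightarrow> (\<forall>x\<in>carr (Q (Suc n)). \<psi> (dQ n x) = dP n (\<psi>' x))" for n \<psi> \<psi>'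
  have "\<exists>\<phi>. \<forall>n. I n (\<phi> n) \<and> R n (\<phi> n) (\<phi> (Suc n))"
  proof (rule dependent_nat_choice)
    have "\<phi>0 (dQ 0 x) \<in> dP 0 ` carr (P (Suc 0))" if x: "x \<in> carr (Q (Suc 0))" for x
    proof -
      have c: "dQ 0 x \<in> carr (Q 0)" using graded_homD(1)[OF q(3) x] .
      then have "eP (\<phi>0 (dQ 0 x)) = 0" using \<phi>0(2) q(8)[OF x] i(2) by simp
      then show ?thesis using p(6)[OF graded_homD(1)[OF \<phi>0(1) c]] by simp
    qed
    then show "\<exists>\<psi>. I 0 \<psi>" using \<phi>0(1) unfolding I_def by blast
  next
    fix \<psi> n assume "I n \<psi>"
    then have \<psi>: "\<psi> \<in> graded_hom (Q n) (P n)"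
      "(\<lambda>x. \<psi> (dQ n x)) ` carr (Q (Suc n)) \<subseteq> dP n ` carr (P (Suc n))"
      unfolding I_def by auto
    obtain \<psi>' where \<psi>': "\<psi>' \<in> graded_hom (Q (Suc n)) (P (Suc n))"
      "\<And>x. x \<in> carr (Q (Suc n)) \<Longrightarrow> dP n (\<psi>' x) = \<psi> (dQ n x)"
      using projective_lift[OF q(1) p(2,2) p(3) graded_hom_comp[OF q(3) \<psi>(1)] \<psi>(2)] by blast
    have "\<psi>' (dQ (Suc n) x) \<in> dP (Suc n) ` carr (P (Suc (Suc n)))" if x: "x \<in> carr (Q (Suc (Suc n)))" for x
    proof -
      have c: "dQ (Suc n) x \<in> carr (Q (Suc n))" using graded_homD(1)[OF q(3) x] .
      have "dP n (\<psi>' (dQ (Suc n) x)) = 0"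
        using \<psi>'(2)[OF c] q(9)[OF x] graded_hom_0[OF q(2) \<psi>(1)] by simp
      then show ?thesis using p(7)[OF graded_homD(1)[OF \<psi>'(1) c]] by simp
    qed
    then show "\<exists>\<psi>'. I (Suc n) \<psi>' \<and> R n \<psi> \<psi>'"
      using \<psi>' unfolding I_def R_def by (intro exI[of _ \<psi>']) simp
  qed
  then obtain \<phi> where \<phi>: "\<And>n. I n (\<phi> n)" "\<And>n. R n (\<phi> n) (\<phi> (Suc n))" by blast
  show ?thesis
  proof (rule that[of \<phi>])
    show "\<phi> n \<in> graded_hom (Q n) (P n)" for n using \<phi>(1)[of n] by (simp add: I_def)
    show "eP (\<phi> 0 x) = i (eQ x)" if "x \<in> carr (Q 0)" for x
      using \<phi>(1)[of 0] \<phi>0(2)[OF that] by (simp add: I_def)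
    show "\<phi> n (dQ n x) = dP n (\<phi> (Suc n) x)" if "x \<in> carr (Q (Suc n))" for n x
      using \<phi>(2)[of n] that by (simp add: R_def)
  qed
qed

text \<open>Exactness in degree 0 and 1 uses that \<open>M'\<close> is the kernel of \<open>\<pi>\<close> and that \<open>i\<close> is injective,
  respectively; in higher degrees it is exactness of \<open>P\<close> and \<open>Q\<close>.\<close>

lemma cone_resolution:
  fixes M :: "('b, 'm::ab_group_add) gmod" and M' :: "('b, 'n::ab_group_add) gmod"
    and M'' :: "('b, 'q::ab_group_add) gmod"
  assumes Q: "graded_projective_resolution B M' Q dQ eQ"
    and P: "graded_projective_resolution B M P dP eP"
    and M: "graded_module B M'" "graded_module B M" "graded_module B M''"
    and i: "i \<in> graded_hom M' M" "inj_on i (carr M')"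
    and \<pi>: "\<pi> \<in> graded_hom M M''" "\<pi> ` carr M = carr M''" "mod_ker M \<pi> = i ` carr M'"
    and \<phi>: "\<And>n. \<phi> n \<in> graded_hom (Q n) (P n)"
      "\<And>x. x \<in> carr (Q 0) \<Longrightarrow> eP (\<phi> 0 x) = i (eQ x)"
      "\<And>n x. x \<in> carr (Q (Suc n)) \<Longrightarrow> \<phi> n (dQ n x) = dP n (\<phi> (Suc n) x)"
  shows "graded_projective_resolution B M'' (cone P Q) (cone_d dP dQ \<phi>) (\<lambda>z. \<pi> (eP (evens z)))"
proof -
  note q = resolutionD[OF Q] and p = resolutionD[OF P]
  have tail: "graded_projective B (cone_tail Q n)" for n
    using q(1) graded_projective_zero by (cases n) simp_all
  have tail_d: "cone_tail_d dQ n \<in> graded_hom (cone_tail Q (Suc n)) (cone_tail Q n)" for n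
    using q(3) zero_hom[OF graded_module_zero] by (cases n) simp_all
  have d: "cone_d dP dQ \<phi> n \<in> graded_hom (cone P Q (Suc n)) (cone P Q n)" for n
    unfolding cone_d_def cone_def
    by (intro interleave_hom add_hom uminus_hom graded_hom_comp[OF evens_hom p(3)]
        graded_hom_comp[OF odds_hom, of "\<phi> n"] graded_hom_comp[OF odds_hom tail_d] p(2)
        graded_projectiveD(1)[OF tail]) (simp add: \<phi>(1))
  have e: "(\<lambda>z. \<pi> (eP (evens z))) \<in> graded_hom (cone P Q 0) M''"
    unfolding cone_def by (rule graded_hom_comp[OF graded_hom_comp[OF evens_hom p(4)] \<pi>(1)])
  have \<phi>c: "\<phi> n x \<in> carr (P n)" if "x \<in> carr (Q n)" for n x
    using graded_homD(1)[OF \<phi>(1) that] .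
  have dPc: "dP n x \<in> carr (P n)" if "x \<in> carr (P (Suc n))" for n x
    using graded_homD(1)[OF p(3) that] .
  have dQc: "dQ n x \<in> carr (Q n)" if "x \<in> carr (Q (Suc n))" for n x
    using graded_homD(1)[OF q(3) that] .
  have negQ: "- x \<in> carr (Q n)" if "x \<in> carr (Q n)" for n x
    using add_subgroup_uminus[OF graded_moduleD(4)[OF q(2)] that] .
  have i0: "i 0 = 0" by (rule graded_hom_0[OF M(1) i(1)])
  have ker_\<pi>: "\<pi> v = 0 \<longleftrightarrow> v \<in> i ` carr M'" if "v \<in> carr M" for v
    using \<pi>(3) that unfolding mod_ker_def by blast
  show ?thesis
    unfolding graded_projective_resolution_def
  proof (intro conjI allI d e)
    show "graded_projective B (cone P Q n)" for n
      unfolding cone_def by (intro graded_projective_sum p(1) tail)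
    show "(\<lambda>z. \<pi> (eP (evens z))) ` carr (cone P Q 0) = carr M''"
    proof (intro equalityI subsetI)
      fix y assume "y \<in> carr M''"
      then obtain x where "x \<in> carr (P 0)" "y = \<pi> (eP x)" using \<pi>(2) p(5) by (metis imageE)
      then show "y \<in> (\<lambda>z. \<pi> (eP (evens z))) ` carr (cone P Q 0)"
        by (intro image_eqI[of _ _ "interleave x 0"]) (simp_all add: cone_def)
    qed (use graded_homD(1)[OF e] in blast)
    show "mod_ker (cone P Q 0) (\<lambda>z. \<pi> (eP (evens z))) = cone_d dP dQ \<phi> 0 ` carr (cone P Q 1)"
    proof (intro equalityI subsetI)
      fix z assume "z \<in> mod_ker (cone P Q 0) (\<lambda>z. \<pi> (eP (evens z)))"
      then have z: "evens z \<in> carr (P 0)" "odds z = 0" "\<pi> (eP (evens z)) = 0"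
        by (auto simp: mod_ker_def cone_def)
      then obtain m where m: "m \<in> carr M'" "eP (evens z) = i m"
        using ker_\<pi> graded_homD(1)[OF p(4)] by blast
      then obtain x where x: "x \<in> carr (Q 0)" "m = eQ x" using q(5) by blast
      have "eP (evens z - \<phi> 0 x) = 0"
        using graded_hom_diff[OF p(2,4) z(1) \<phi>c[OF x(1)]] \<phi>(2)[OF x(1)] m x by simp
      moreover have "evens z - \<phi> 0 x \<in> carr (P 0)"
        by (rule add_subgroup_diff[OF graded_moduleD(4)[OF p(2)] z(1) \<phi>c[OF x(1)]])
      ultimately obtain y where y: "y \<in> carr (P (Suc 0))" "evens z - \<phi> 0 x = dP 0 y"
        using p(6) by blast
      have "z = cone_d dP dQ \<phi> 0 (interleave y x)"
        by (rule interleave_eqI) (use y(2) z(2) in \<open>simp_all add: cone_d_def diff_eq_eq\<close>)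
      then show "z \<in> cone_d dP dQ \<phi> 0 ` carr (cone P Q 1)"
        using y x by (intro image_eqI[of _ _ "interleave y x"]) (simp_all add: cone_def)
    next
      fix z assume "z \<in> cone_d dP dQ \<phi> 0 ` carr (cone P Q 1)"
      then obtain w where w: "evens w \<in> carr (P (Suc 0))" "odds w \<in> carr (Q 0)" "w \<in> carr (cone P Q 1)"
        and z: "z = cone_d dP dQ \<phi> 0 w"
        by (auto simp: cone_def)
      have "eP (evens z) = eP (dP 0 (evens w)) + eP (\<phi> 0 (odds w))"
        using graded_homD(2)[OF p(4) dPc[OF w(1)] \<phi>c[OF w(2)]] by (simp add: z cone_d_def)
      also have "\<dots> = i (eQ (odds w))" using p(8)[OF w(1)] \<phi>(2)[OF w(2)] by simp
      finally have "\<pi> (eP (evens z)) = 0"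
        using ker_\<pi> graded_homD(1)[OF q(4) w(2)] graded_homD(1)[OF i(1)] by simp
      then show "z \<in> mod_ker (cone P Q 0) (\<lambda>z. \<pi> (eP (evens z)))"
        using graded_homD(1)[OF d[of 0]] w(3) by (simp add: mod_ker_def z)
    qed
    fix n
    show "mod_ker (cone P Q (Suc n)) (cone_d dP dQ \<phi> n) =
        cone_d dP dQ \<phi> (Suc n) ` carr (cone P Q (Suc (Suc n)))"
    proof (intro equalityI subsetI)
      fix z assume "z \<in> mod_ker (cone P Q (Suc n)) (cone_d dP dQ \<phi> n)"
      then have z: "evens z \<in> carr (P (Suc n))" "odds z \<in> carr (Q n)" and "cone_d dP dQ \<phi> n z = 0"
        by (auto simp: mod_ker_def cone_def)
      then have "evens (cone_d dP dQ \<phi> n z) = 0" "odds (cone_d dP dQ \<phi> n z) = 0" by simp_all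
      then have z1: "dP n (evens z) + \<phi> n (odds z) = 0" and z2: "cone_tail_d dQ n (odds z) = 0"
        by (simp_all add: cone_d_def)
      have "odds z \<in> dQ n ` carr (Q (Suc n))"
      proof (cases n)
        case 0
        have "eP (dP 0 (evens z) + \<phi> 0 (odds z)) = eP 0" using z1 0 by simp
        then have "i (eQ (odds z)) = 0"
          using graded_homD(2)[OF p(4) dPc \<phi>c, of "evens z" "odds z"] z 0 p(8) \<phi>(2) graded_hom_0[OF p(2,4)]
          by simp
        then have "eQ (odds z) = 0"
          using inj_onD[OF i(2), of "eQ (odds z)" 0] i0 graded_homD(1)[OF q(4)] z 0 graded_moduleD(7)[OF M(1)]
          by simp
        then show ?thesis using q(6) z 0 by simp
      next
        case (Suc m)
        then show ?thesis using q(7)[of "odds z" m] z z2 by simp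
      qed
      then obtain y where y: "y \<in> carr (Q (Suc n))" "odds z = dQ n y" by blast
      have "dP n (evens z + \<phi> (Suc n) y) = dP n (evens z) + dP n (\<phi> (Suc n) y)"
        by (rule graded_homD(2)[OF p(3) z(1) \<phi>c[OF y(1)]])
      then have "dP n (evens z + \<phi> (Suc n) y) = 0" using \<phi>(3)[OF y(1)] z1 y(2) by simp
      moreover have "evens z + \<phi> (Suc n) y \<in> carr (P (Suc n))"
        by (rule add_subgroup_add[OF graded_moduleD(4)[OF p(2)] z(1) \<phi>c[OF y(1)]])
      ultimately obtain x where x: "x \<in> carr (P (Suc (Suc n)))" "evens z + \<phi> (Suc n) y = dP (Suc n) x"
        using p(7) by blast
      have "z = cone_d dP dQ \<phi> (Suc n) (interleave x (- y))"
      proof (rule interleave_eqI)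
        have "\<phi> (Suc n) (- y) = - \<phi> (Suc n) y" "dQ n (- y) = - dQ n y"
          by (rule graded_hom_uminus[OF q(2) \<phi>(1) y(1)], rule graded_hom_uminus[OF q(2,3) y(1)])
        then show "evens z = evens (cone_d dP dQ \<phi> (Suc n) (interleave x (- y)))"
          "odds z = odds (cone_d dP dQ \<phi> (Suc n) (interleave x (- y)))"
          using x(2) y(2) by (simp_all add: cone_d_def eq_diff_eq)
      qed
      then show "z \<in> cone_d dP dQ \<phi> (Suc n) ` carr (cone P Q (Suc (Suc n)))"
        using x(1) negQ[OF y(1)] by (intro image_eqI[of _ _ "interleave x (- y)"]) (simp_all add: cone_def)
    next
      fix z assume "z \<in> cone_d dP dQ \<phi> (Suc n) ` carr (cone P Q (Suc (Suc n)))"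
      then obtain w where w: "evens w \<in> carr (P (Suc (Suc n)))" "odds w \<in> carr (Q (Suc n))"
        "w \<in> carr (cone P Q (Suc (Suc n)))" and z: "z = cone_d dP dQ \<phi> (Suc n) w"
        by (auto simp: cone_def)
      have "dP n (evens z) = dP n (dP (Suc n) (evens w)) + dP n (\<phi> (Suc n) (odds w))"
        using graded_homD(2)[OF p(3) dPc[OF w(1)] \<phi>c[OF w(2)]] by (simp add: z cone_d_def)
      also have "\<dots> = \<phi> n (dQ n (odds w))" using p(9)[OF w(1)] \<phi>(3)[OF w(2)] by simp
      finally have "dP n (evens z) + \<phi> n (odds z) = 0"
        using graded_hom_uminus[OF q(2) \<phi>(1) dQc[OF w(2)]] by (simp add: z cone_d_def)
      moreover have "cone_tail_d dQ n (odds z) = 0"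
      proof (cases n)
        case (Suc m)
        then show ?thesis
          using graded_hom_uminus[OF q(2,3) dQc, of "odds w" m] w(2) q(9)[of "odds w" m]
          by (simp add: z cone_d_def)
      qed simp
      ultimately have "cone_d dP dQ \<phi> n z = 0" by (simp add: cone_d_def)
      then show "z \<in> mod_ker (cone P Q (Suc n)) (cone_d dP dQ \<phi> n)"
        using graded_homD(1)[OF d[of "Suc n"]] w(3) by (simp add: mod_ker_def z)
    qed
  qed
qed


section \<open>Ext along a short exact sequence\<close>

definition short_exact ::
    "('b, 'm::ab_group_add) gmod \<Rightarrow> ('m \<Rightarrow> 'n) \<Rightarrow> ('b, 'n::ab_group_add) gmod \<Rightarrow> ('n \<Rightarrow> 'q) \<Rightarrow>
     ('b, 'q::ab_group_add) gmod \<Rightarrow> bool" where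
  "short_exact M' i M \<pi> M'' \<longleftrightarrow>
     graded_module B M' \<and> graded_module B M \<and> graded_module B M'' \<and>
     i \<in> graded_hom M' M \<and> inj_on i (carr M') \<and>
     \<pi> \<in> graded_hom M M'' \<and> \<pi> ` carr M = carr M'' \<and> mod_ker M \<pi> = i ` carr M'"

lemma cone_of_short_exact:
  assumes ses: "short_exact M' i M \<pi> M''"
    and Q: "graded_projective_resolution B M' Q dQ eQ"
    and P: "graded_projective_resolution B M P dP eP"
  obtains \<phi> where "\<And>n. \<phi> n \<in> graded_hom (Q n) (P n)"
    "\<And>n x. x \<in> carr (Q (Suc n)) \<Longrightarrow> \<phi> n (dQ n x) = dP n (\<phi> (Suc n) x)"
    "graded_projective_resolution B M'' (cone P Q) (cone_d dP dQ \<phi>) (\<lambda>z. \<pi> (eP (evens z)))"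
proof -
  have s: "graded_module B M'" "graded_module B M" "graded_module B M''"
    "i \<in> graded_hom M' M" "inj_on i (carr M')"
    "\<pi> \<in> graded_hom M M''" "\<pi> ` carr M = carr M''" "mod_ker M \<pi> = i ` carr M'"
    using ses unfolding short_exact_def by blast+
  obtain \<phi> where \<phi>: "\<And>n. \<phi> n \<in> graded_hom (Q n) (P n)"
    "\<And>x. x \<in> carr (Q 0) \<Longrightarrow> eP (\<phi> 0 x) = i (eQ x)"
    "\<And>n x. x \<in> carr (Q (Suc n)) \<Longrightarrow> \<phi> n (dQ n x) = dP n (\<phi> (Suc n) x)"
    using chain_map_lift[OF Q P s(2,4) graded_hom_0[OF s(1,4)]] by blast
  show ?thesis
    by (rule that[OF \<phi>(1,3) cone_resolution[OF Q P s \<phi>]])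
qed

lemma ext_coboundaries_subset:
  assumes "graded_projective_resolution B M P d \<epsilon>" "graded_module B N"
  shows "ext_coboundaries P d n N \<subseteq> ext_cocycles P d n N"
proof
  note p = resolutionD[OF assms(1)]
  fix f assume f: "f \<in> ext_coboundaries P d n N"
  show "f \<in> ext_cocycles P d n N"
  proof (cases n)
    case 0
    then show ?thesis
      using f graded_homD(1)[OF p(3)] by (auto simp: ext_coboundaries_def ext_cocycles_def)
  next
    case (Suc m)
    then obtain g where g: "f \<in> graded_hom (P (Suc m)) N" "g \<in> graded_hom (P m) N"
      "\<forall>x\<in>carr (P (Suc m)). f x = g (d m x)"
      using f by (auto simp: ext_coboundaries_def)
    then show ?thesis
      using Suc graded_homD(1)[OF p(3)] p(9) graded_hom_0[OF p(2) g(2)]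
      by (auto simp: ext_cocycles_def)
  qed
qed

lemma ext_nonzeroE:
  assumes "ext_nonzero B n M N" "graded_module B N"
  obtains P d \<epsilon> f where "graded_projective_resolution B M P d \<epsilon>"
    "f \<in> graded_hom (P n) N" "\<And>x. x \<in> carr (P (Suc n)) \<Longrightarrow> f (d n x) = 0"
    "f \<notin> ext_coboundaries P d n N"
proof -
  obtain P d \<epsilon> where P: "graded_projective_resolution B M P d \<epsilon>"
    "ext_cocycles P d n N \<noteq> ext_coboundaries P d n N"
    using assms(1) unfolding ext_nonzero_def by blast
  then obtain f where "f \<in> ext_cocycles P d n N" "f \<notin> ext_coboundaries P d n N"
    using ext_coboundaries_subset[OF P(1) assms(2), of n] by blast
  then show ?thesis using that[OF P(1)] by (auto simp: ext_cocycles_def)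
qed

lemma ext_zeroD:
  assumes "\<not> ext_nonzero B n M N" "graded_projective_resolution B M P d \<epsilon>"
    "f \<in> graded_hom (P n) N" "\<And>x. x \<in> carr (P (Suc n)) \<Longrightarrow> f (d n x) = 0"
  shows "f \<in> ext_coboundaries P d n N"
proof -
  have "ext_cocycles P d n N = ext_coboundaries P d n N"
    using assms(1,2) unfolding ext_nonzero_def by blast
  moreover have "f \<in> ext_cocycles P d n N"
    using assms(3,4) by (simp add: ext_cocycles_def)
  ultimately show ?thesis by blast
qed

lemma ext_zeroE:
  assumes "f \<in> ext_coboundaries P d (Suc m) N"
  obtains g where "g \<in> graded_hom (P m) N" "\<And>x. x \<in> carr (P (Suc m)) \<Longrightarrow> f x = g (d m x)"
  using assms by (auto simp: ext_coboundaries_def)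

text \<open>Suppose a cocycle \<open>f\<close> on \<open>P\<^sub>n\<close> restricts to a coboundary \<open>g \<circ> dQ\<close> on \<open>Q\<^sub>n\<close>. Then \<open>f\<close> and \<open>g\<close>
  together form a cocycle on the cone, and if this is the coboundary of some \<open>h\<close>, the restriction
  of \<open>h\<close> to \<open>P\<close> shows that \<open>f\<close> is a coboundary.\<close>

lemma ext_nonzero_middle:
  assumes ses: "short_exact M' i M \<pi> M''" and N: "graded_module B N"
    and ext: "ext_nonzero B n M N"
  shows "ext_nonzero B n M' N \<or> ext_nonzero B n M'' N"
proof (rule ccontr)
  assume "\<not> (ext_nonzero B n M' N \<or> ext_nonzero B n M'' N)"
  then have zero: "\<not> ext_nonzero B n M' N" "\<not> ext_nonzero B n M'' N" by auto
  obtain P dP eP f where P: "graded_projective_resolution B M P dP eP"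
    and f: "f \<in> graded_hom (P n) N" "\<And>x. x \<in> carr (P (Suc n)) \<Longrightarrow> f (dP n x) = 0"
      "f \<notin> ext_coboundaries P dP n N"
    using ext_nonzeroE[OF ext N] by blast
  have "graded_module B M'" using ses by (simp add: short_exact_def)
  then obtain Q dQ eQ where Q: "graded_projective_resolution B M' Q dQ eQ"
    by (rule resolution_exists)
  obtain \<phi> where \<phi>: "\<And>n. \<phi> n \<in> graded_hom (Q n) (P n)"
    "\<And>n x. x \<in> carr (Q (Suc n)) \<Longrightarrow> \<phi> n (dQ n x) = dP n (\<phi> (Suc n) x)"
    and C: "graded_projective_resolution B M'' (cone P Q) (cone_d dP dQ \<phi>) (\<lambda>z. \<pi> (eP (evens z)))"
    using cone_of_short_exact[OF ses Q P] by blast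
  note q = resolutionD[OF Q] and p = resolutionD[OF P]
  have \<phi>c: "\<phi> n x \<in> carr (P n)" if "x \<in> carr (Q n)" for n x
    using graded_homD(1)[OF \<phi>(1) that] .
  have dPc: "dP n x \<in> carr (P n)" if "x \<in> carr (P (Suc n))" for n x
    using graded_homD(1)[OF p(3) that] .
  have f\<phi>: "(\<lambda>x. f (\<phi> n x)) \<in> ext_coboundaries Q dQ n N"
    by (rule ext_zeroD[OF zero(1) Q graded_hom_comp[OF \<phi>(1) f(1)]])
      (simp add: \<phi>(2) f(2)[OF \<phi>c])
  show False
  proof (cases n)
    case 0
    have "(\<lambda>z. f (evens z)) \<in> ext_coboundaries (cone P Q) (cone_d dP dQ \<phi>) n N"
    proof (rule ext_zeroD[OF zero(2) C])
      show "(\<lambda>z. f (evens z)) \<in> graded_hom (cone P Q n) N"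
        unfolding cone_def by (rule graded_hom_comp[OF evens_hom f(1)])
      fix z assume z: "z \<in> carr (cone P Q (Suc n))"
      then have "f (dP n (evens z) + \<phi> n (odds z)) = f (dP n (evens z)) + f (\<phi> n (odds z))"
        by (intro graded_homD(2)[OF f(1)] dPc \<phi>c) (simp_all add: cone_def)
      also have "\<dots> = 0" using z 0 f(2) f\<phi> by (simp add: cone_def ext_coboundaries_def)
      finally show "f (evens (cone_d dP dQ \<phi> n z)) = 0" by (simp add: cone_d_def)
    qed
    then have "f x = 0" if "x \<in> carr (P 0)" for x
      using that 0 bspec[of "carr (cone P Q 0)" "\<lambda>z. f (evens z) = 0" "interleave x 0"]
      by (simp add: ext_coboundaries_def cone_def)
    then show False using f(1,3) 0 by (simp add: ext_coboundaries_def)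
  next
    case (Suc m)
    obtain g where g: "g \<in> graded_hom (Q m) N"
      "\<And>x. x \<in> carr (Q (Suc m)) \<Longrightarrow> f (\<phi> n x) = g (dQ m x)"
      using ext_zeroE[OF f\<phi>[unfolded Suc]] unfolding Suc by blast
    let ?F = "\<lambda>z. f (evens z) + g (odds z)"
    have "?F \<in> ext_coboundaries (cone P Q) (cone_d dP dQ \<phi>) n N"
    proof (rule ext_zeroD[OF zero(2) C])
      show "?F \<in> graded_hom (cone P Q n) N"
        using graded_hom_comp[OF evens_hom f(1)] graded_hom_comp[OF odds_hom g(1)]
        unfolding cone_def Suc cone_tail_simps by (intro add_hom N) blast+
      fix z assume z: "z \<in> carr (cone P Q (Suc n))"
      then have z': "evens z \<in> carr (P (Suc n))" "odds z \<in> carr (Q (Suc m))"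
        by (simp_all add: cone_def Suc)
      have "f (dP n (evens z) + \<phi> n (odds z)) = f (dP n (evens z)) + f (\<phi> n (odds z))"
        using z' Suc by (intro graded_homD(2)[OF f(1)] dPc \<phi>c) simp_all
      also have "\<dots> = g (dQ m (odds z))" using f(2)[OF z'(1)] g(2)[OF z'(2)] by simp
      finally show "?F (cone_d dP dQ \<phi> n z) = 0"
        using graded_hom_uminus[OF q(2) g(1) graded_homD(1)[OF q(3) z'(2)]]
        by (simp add: cone_d_def Suc)
    qed
    then obtain h where h: "h \<in> graded_hom (cone P Q m) N"
      "\<And>z. z \<in> carr (cone P Q (Suc m)) \<Longrightarrow> ?F z = h (cone_d dP dQ \<phi> m z)"
      using ext_zeroE unfolding Suc by blast
    have tail0: "graded_module B (cone_tail Q k)" for k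
      using q(2) graded_module_zero by (cases k) simp_all
    have "f x = h (interleave (dP m x) 0)" if x: "x \<in> carr (P (Suc m))" for x
    proof -
      have c0: "cone_tail_d dQ m 0 = 0"
        using graded_hom_0[OF q(2) q(3)] by (cases m) simp_all
      have "f x = ?F (interleave x 0)" using graded_hom_0[OF q(2) g(1)] by simp
      also have "\<dots> = h (cone_d dP dQ \<phi> m (interleave x 0))"
        using x graded_moduleD(7)[OF q(2)] by (intro h(2)) (simp add: cone_def)
      also have "cone_d dP dQ \<phi> m (interleave x 0) = interleave (dP m x) 0"
        using graded_hom_0[OF q(2) \<phi>(1)] c0 by (simp add: cone_d_def)
      finally show ?thesis .
    qed
    moreover have "(\<lambda>x. h (interleave x 0)) \<in> graded_hom (P m) N"
      using h(1) unfolding cone_def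
      by (rule graded_hom_comp[OF interleave_hom[OF id_hom zero_hom[OF tail0]]])
    ultimately show False using f(1,3) Suc by (auto simp: ext_coboundaries_def)
  qed
qed

text \<open>A cocycle \<open>f\<close> on \<open>Q\<^sub>n\<close>, extended by zero, is a cocycle on the cone in degree \<open>n + 1\<close>. If it is the
  coboundary of \<open>h\<close>, then the restriction \<open>a\<close> of \<open>h\<close> to \<open>P\<^sub>n\<close> is a cocycle, and \<open>f\<close> differs from
  \<open>a \<circ> \<phi>\<^sub>n\<close> by a coboundary. So \<open>f\<close> is a coboundary as soon as \<open>a\<close> is one.\<close>

lemma ext_nonzero_sub:
  assumes ses: "short_exact M' i M \<pi> M''" and N: "graded_module B N"
    and ext: "ext_nonzero B n M' N"
  shows "ext_nonzero B n M N \<or> ext_nonzero B (Suc n) M'' N"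
proof (rule ccontr)
  assume "\<not> (ext_nonzero B n M N \<or> ext_nonzero B (Suc n) M'' N)"
  then have zero: "\<not> ext_nonzero B n M N" "\<not> ext_nonzero B (Suc n) M'' N" by auto
  obtain Q dQ eQ f where Q: "graded_projective_resolution B M' Q dQ eQ"
    and f: "f \<in> graded_hom (Q n) N" "\<And>x. x \<in> carr (Q (Suc n)) \<Longrightarrow> f (dQ n x) = 0"
      "f \<notin> ext_coboundaries Q dQ n N"
    using ext_nonzeroE[OF ext N] by blast
  have "graded_module B M" using ses by (simp add: short_exact_def)
  then obtain P dP eP where P: "graded_projective_resolution B M P dP eP"
    by (rule resolution_exists)
  obtain \<phi> where \<phi>: "\<And>n. \<phi> n \<in> graded_hom (Q n) (P n)"
    "\<And>n x. x \<in> carr (Q (Suc n)) \<Longrightarrow> \<phi> n (dQ n x) = dP n (\<phi> (Suc n) x)"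
    and C: "graded_projective_resolution B M'' (cone P Q) (cone_d dP dQ \<phi>) (\<lambda>z. \<pi> (eP (evens z)))"
    using cone_of_short_exact[OF ses Q P] by blast
  note q = resolutionD[OF Q] and p = resolutionD[OF P]
  have tail: "graded_module B (cone_tail Q k)" for k
    using q(2) graded_module_zero by (cases k) simp_all
  have "(\<lambda>z. f (odds z)) \<in> ext_coboundaries (cone P Q) (cone_d dP dQ \<phi>) (Suc n) N"
  proof (rule ext_zeroD[OF zero(2) C])
    show "(\<lambda>z. f (odds z)) \<in> graded_hom (cone P Q (Suc n)) N"
      using graded_hom_comp[OF odds_hom f(1)] by (simp add: cone_def)
    fix z assume z: "z \<in> carr (cone P Q (Suc (Suc n)))"
    then have z': "odds z \<in> carr (Q (Suc n))" by (simp add: cone_def)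
    have "f (- dQ n (odds z)) = - f (dQ n (odds z))"
      by (rule graded_hom_uminus[OF q(2) f(1) graded_homD(1)[OF q(3) z']])
    then show "f (odds (cone_d dP dQ \<phi> (Suc n) z)) = 0"
      using f(2)[OF z'] by (simp add: cone_d_def)
  qed
  then obtain h where h: "h \<in> graded_hom (cone P Q n) N"
    "\<And>z. z \<in> carr (cone P Q (Suc n)) \<Longrightarrow> f (odds z) = h (cone_d dP dQ \<phi> n z)"
    by (rule ext_zeroE) blast
  define a where "a x = h (interleave x 0)" for x
  have a: "a \<in> graded_hom (P n) N"
    using h(1) unfolding cone_def a_def
    by (rule graded_hom_comp[OF interleave_hom[OF id_hom zero_hom[OF tail]]])
  have "a (dP n x) = 0" if x: "x \<in> carr (P (Suc n))" for x
  proof -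
    have c0: "cone_tail_d dQ n 0 = 0"
      using graded_hom_0[OF q(2) q(3)] by (cases n) simp_all
    have "cone_d dP dQ \<phi> n (interleave x 0) = interleave (dP n x) 0"
      using graded_hom_0[OF q(2) \<phi>(1)] c0 by (simp add: cone_d_def)
    then have "a (dP n x) = f (odds (interleave x 0))"
      using x h(2)[of "interleave x 0"] graded_moduleD(7)[OF q(2)] by (simp add: cone_def a_def)
    then show ?thesis using graded_hom_0[OF q(2) f(1)] by simp
  qed
  then have a_cob: "a \<in> ext_coboundaries P dP n N"
    by (rule ext_zeroD[OF zero(1) P a])
  have fx: "f x = a (\<phi> n x) + h (interleave 0 (- cone_tail_d dQ n x))" if x: "x \<in> carr (Q n)" for x
  proof -
    have c: "\<phi> n x \<in> carr (P n)" by (rule graded_homD(1)[OF \<phi>(1) x])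
    have t: "cone_tail_d dQ n x \<in> carr (cone_tail Q n)"
      using x graded_homD(1)[OF q(3)] by (cases n) simp_all
    have dP0: "dP n 0 = 0" by (rule graded_hom_0[OF p(2,3)])
    have "f x = h (interleave (\<phi> n x) (- cone_tail_d dQ n x))"
      using h(2)[of "interleave 0 x"] x graded_moduleD(7)[OF p(2)] dP0 by (simp add: cone_def cone_d_def)
    also have "interleave (\<phi> n x) (- cone_tail_d dQ n x) = interleave (\<phi> n x) 0 + interleave 0 (- cone_tail_d dQ n x)"
      by (simp add: interleave_add[symmetric])
    also have "h \<dots> = h (interleave (\<phi> n x) 0) + h (interleave 0 (- cone_tail_d dQ n x))"
      using c t graded_moduleD(7)[OF p(2)] graded_moduleD(7)[OF tail]
      by (intro graded_homD(2)[OF h(1)])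
        (simp_all add: cone_def add_subgroup_uminus[OF graded_moduleD(4)[OF tail]])
    finally show ?thesis by (simp add: a_def)
  qed
  have "f \<in> ext_coboundaries Q dQ n N"
  proof (cases n)
    case 0
    have "f x = 0" if x: "x \<in> carr (Q 0)" for x
    proof -
      have "a (\<phi> 0 x) = 0"
        using a_cob graded_homD(1)[OF \<phi>(1) x] 0 by (simp add: ext_coboundaries_def)
      moreover have "h 0 = 0"
        using graded_hom_0[OF _ h(1)] resolutionD(2)[OF C] by blast
      ultimately show ?thesis using fx x 0 by simp
    qed
    then show ?thesis using f(1) 0 by (simp add: ext_coboundaries_def)
  next
    case (Suc m)
    obtain a' where a': "a' \<in> graded_hom (P m) N"
      "\<And>x. x \<in> carr (P (Suc m)) \<Longrightarrow> a x = a' (dP m x)"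
      using ext_zeroE[OF a_cob[unfolded Suc]] by blast
    let ?g = "\<lambda>x. a' (\<phi> m x) + h (interleave 0 (- x))"
    have "(\<lambda>x. h (interleave 0 (- x))) \<in> graded_hom (Q m) N"
    proof (rule graded_hom_comp[OF interleave_hom[OF zero_hom[OF p(2)] uminus_hom[OF q(2) id_hom]]])
      show "h \<in> graded_hom (sum_gmod (P n) (Q m)) N" using h(1) by (simp add: cone_def Suc)
    qed
    then have "?g \<in> graded_hom (Q m) N"
      by (intro add_hom N graded_hom_comp[OF \<phi>(1) a'(1)])
    moreover have "f x = ?g (dQ m x)" if x: "x \<in> carr (Q (Suc m))" for x
      using fx[of x] a'(2)[OF graded_homD(1)[OF \<phi>(1) x]] \<phi>(2)[OF x] x by (simp add: Suc)
    ultimately show ?thesis using f(1) Suc by (auto simp: ext_coboundaries_def)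
  qed
  then show False using f(3) by blast
qed

text \<open>A resolution of \<open>Y\<close> becomes one of \<open>Z\<close> after changing only the augmentation.\<close>

lemma ext_nonzero_iso:
  fixes Y :: "('b, 'm::ab_group_add) gmod" and Z :: "('b, 'n::ab_group_add) gmod"
  assumes Y: "graded_module B Y" and f: "f \<in> graded_hom Y Z" "bij_betw f (carr Y) (carr Z)"
    and ext: "ext_nonzero B n Y N"
  shows "ext_nonzero B n Z N"
proof -
  obtain P d \<epsilon> where P: "graded_projective_resolution B Y P d \<epsilon>"
    "ext_cocycles P d n N \<noteq> ext_coboundaries P d n N"
    using ext unfolding ext_nonzero_def by blast
  note p = resolutionD[OF P(1)]
  have "f v = 0 \<longleftrightarrow> v = 0" if "v \<in> carr Y" for v
    using inj_onD[OF bij_betw_imp_inj_on[OF f(2)], of v 0] that graded_moduleD(7)[OF Y]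
      graded_hom_0[OF Y f(1)] by auto
  then have ker: "mod_ker (P 0) (\<lambda>x. f (\<epsilon> x)) = mod_ker (P 0) \<epsilon>"
    using graded_homD(1)[OF p(4)] by (auto simp: mod_ker_def)
  have "(\<lambda>x. f (\<epsilon> x)) ` carr (P 0) = f ` (\<epsilon> ` carr (P 0))" by (simp add: image_image)
  then have im: "(\<lambda>x. f (\<epsilon> x)) ` carr (P 0) = carr Z"
    using p(5) f(2) by (simp add: bij_betw_def)
  have "graded_projective_resolution B Z P d (\<lambda>x. f (\<epsilon> x))"
    using P(1) graded_hom_comp[OF p(4) f(1)] ker im
    unfolding graded_projective_resolution_def by simp
  then show ?thesis using P(2) unfolding ext_nonzero_def by blast
qed

lemma ext_nonzero_shift:
  fixes M :: "('b, 'm::ab_group_add) gmod" and N :: "('b, 'n::ab_group_add) gmod"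
  assumes "ext_nonzero B n (shift s M) N"
  shows "ext_nonzero B n M (shift (- s) N)"
proof -
  obtain P d \<epsilon> where P: "graded_projective_resolution B (shift s M) P d \<epsilon>"
    "ext_cocycles P d n N \<noteq> ext_coboundaries P d n N"
    using assms unfolding ext_nonzero_def by blast
  let ?P = "\<lambda>n. shift (- s) (P n)"
  have "\<epsilon> \<in> graded_hom (?P 0) M"
    using resolutionD(4)[OF P(1)] by (simp add: graded_hom_shift_left)
  then have "graded_projective_resolution B M ?P d \<epsilon>"
    using P(1) unfolding graded_projective_resolution_def
    by (simp add: graded_projective_shift graded_hom_shift mod_ker_def)
  moreover have "ext_cocycles ?P d n (shift (- s) N) = ext_cocycles P d n N"
    by (simp add: ext_cocycles_def graded_hom_shift)
  moreover have "ext_coboundaries ?P d n (shift (- s) N) = ext_coboundaries P d n N"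
    by (simp add: ext_coboundaries_def graded_hom_shift split: nat.split)
  ultimately show ?thesis using P(2) unfolding ext_nonzero_def by metis
qed

end


section \<open>Truncations and irreducible quotients\<close>

definition trunc_set :: "('b, 'm::ab_group_add) gmod \<Rightarrow> int \<Rightarrow> 'm set" where
  "trunc_set M i = {v \<in> carr M. \<forall>j<i. hcomp (gr M) v j = 0}"

context pos_graded_algebra
begin

lemma hcomp_trunc_set:
  fixes M :: "('b, 'm::ab_group_add) gmod"
  assumes M: "graded_module B M" and w: "w \<in> gr M j" and j: "j \<ge> i \<or> w = 0"
  shows "w \<in> trunc_set M i"
  using w j graded_moduleD(6)[OF M, of j] hcomp_homogeneous[OF graded_moduleD(3)[OF M] w]
  by (auto simp: trunc_set_def)

lemma trunc_set_subgroup: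
  fixes M :: "('b, 'm::ab_group_add) gmod"
  assumes M: "graded_module B M"
  shows "add_subgroup (trunc_set M i)"
  using graded_moduleD(4)[OF M]
  by (auto simp: add_subgroup_def trunc_set_def hcomp_0[OF graded_moduleD(3)[OF M]]
      hcomp_add[OF graded_moduleD(3)[OF M]] hcomp_uminus[OF graded_moduleD(3)[OF M]])

text \<open>This is where positivity of the grading enters: no element of the algebra lowers degrees.\<close>

lemma homogeneous_submodule_trunc:
  fixes M :: "('b, 'm::ab_group_add) gmod"
  assumes M: "graded_module B M"
  shows "homogeneous_submodule M (trunc_set M i)"
  unfolding homogeneous_submodule_def submodule_def
proof (intro conjI ballI allI trunc_set_subgroup[OF M])
  note d = graded_moduleD(3)[OF M] and mM = is_moduleD[OF graded_moduleD(2)[OF M]]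
  show "trunc_set M i \<subseteq> carr M" by (auto simp: trunc_set_def)
  fix v assume v: "v \<in> trunc_set M i"
  then have v': "v \<in> carr M" by (simp add: trunc_set_def)
  have c: "j \<ge> i \<or> hcomp (gr M) v j = 0" for j
    using v by (cases "j < i") (auto simp: trunc_set_def)
  show "hcomp (gr M) v j \<in> trunc_set M i" for j
    by (rule hcomp_trunc_set[OF M hcomp_props(1)[OF d v'] c])
  fix b
  obtain J where J: "finite J" "v = (\<Sum>j\<in>J. hcomp (gr M) v j)" using hcomp_sum[OF d v'] by metis
  obtain K where K: "finite K" "b = (\<Sum>n\<in>K. hcomp (grading B) b n)"
    using hcomp_sum[OF grading_dsd UNIV_I, of b] by metis
  have b_sum: "act M b v = (\<Sum>n\<in>K. act M (hcomp (grading B) b n) v)"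
    using K(2) act_sum_left[OF graded_moduleD(2)[OF M] v'] by metis
  have "act M (hcomp (grading B) b n) v \<in> trunc_set M i" for n
  proof -
    have v_sum: "act M (hcomp (grading B) b n) v = (\<Sum>j\<in>J. act M (hcomp (grading B) b n) (hcomp (gr M) v j))"
      using J(2) act_sum[OF graded_moduleD(2)[OF M], of J "hcomp (gr M) v"] hcomp_carr[OF M v'] by metis
    have "act M (hcomp (grading B) b n) (hcomp (gr M) v j) \<in> trunc_set M i" for j
    proof (rule hcomp_trunc_set[OF M])
      show "act M (hcomp (grading B) b n) (hcomp (gr M) v j) \<in> gr M (int n + j)"
        by (rule graded_moduleD(9)[OF M hcomp_props(1)[OF grading_dsd UNIV_I] hcomp_props(1)[OF d v']])
      show "i \<le> int n + j \<or> act M (hcomp (grading B) b n) (hcomp (gr M) v j) = 0"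
        using c[of j] act_0[OF graded_moduleD(2)[OF M]] by auto
    qed
    then show ?thesis unfolding v_sum by (rule add_subgroup_sum[OF trunc_set_subgroup[OF M]])
  qed
  then show "act M b v \<in> trunc_set M i"
    unfolding b_sum by (rule add_subgroup_sum[OF trunc_set_subgroup[OF M]])
qed

lemma gr_trunc:
  fixes M :: "('b, 'm::ab_group_add) gmod"
  assumes M: "graded_module B M"
  shows "gr M j \<inter> trunc_set M i = (if j \<ge> i then gr M j else {0})"
proof -
  note d = graded_moduleD(3)[OF M]
  have "w = 0" if "w \<in> gr M j" "w \<in> trunc_set M i" "\<not> j \<ge> i" for w
    using that hcomp_homogeneous[OF d that(1), of j] by (auto simp: trunc_set_def)
  moreover have "0 \<in> gr M j \<inter> trunc_set M i"
    using graded_moduleD(8)[OF M] add_subgroup_0[OF trunc_set_subgroup[OF M]] by blast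
  ultimately show ?thesis using hcomp_trunc_set[OF M] by auto
qed

lemma truncate_ge_eq:
  fixes M :: "('b, 'm::ab_group_add) gmod"
  assumes M: "graded_module B M"
  shows "truncate_ge i M = sub_gmod M (trunc_set M i)"
proof -
  note d = graded_moduleD(3)[OF M]
  let ?S = "{\<Sum>j\<in>J. f j |J f. finite J \<and> J \<subseteq> {i..} \<and> (\<forall>j\<in>J. f j \<in> gr M j)}"
  have "?S = trunc_set M i"
  proof (intro equalityI subsetI)
    fix v assume "v \<in> ?S"
    then obtain J f where "J \<subseteq> {i..}" "\<forall>j\<in>J. f j \<in> gr M j" "v = (\<Sum>j\<in>J. f j)" by blast
    then have "f j \<in> trunc_set M i" if "j \<in> J" for j
      using that by (intro hcomp_trunc_set[OF M, of "f j" j]) auto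
    then show "v \<in> trunc_set M i"
      unfolding \<open>v = _\<close> by (rule add_subgroup_sum[OF trunc_set_subgroup[OF M]])
  next
    fix v assume v: "v \<in> trunc_set M i"
    then have v': "v \<in> carr M" by (simp add: trunc_set_def)
    have "{j. hcomp (gr M) v j \<noteq> 0} \<subseteq> {i..}"
      using v by (force simp: trunc_set_def not_le[symmetric])
    then show "v \<in> ?S"
      using hcomp_props[OF d v'] by (intro CollectI exI[of _ "{j. hcomp (gr M) v j \<noteq> 0}"]
          exI[of _ "hcomp (gr M) v"]) auto
  qed
  moreover have "(\<lambda>j. if j \<ge> i then gr M j else {0}) = (\<lambda>j. gr M j \<inter> trunc_set M i)"
    using gr_trunc[OF M] by auto
  ultimately show ?thesis by (simp add: truncate_ge_def sub_gmod_def)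
qed

lemma short_exact_quotient:
  fixes M :: "('b, 'm::ab_group_add) gmod"
  assumes M: "graded_module B M" and S: "homogeneous_submodule M S"
  obtains Y :: "('k, 'b) ugmod" and \<kappa> where "short_exact (sub_gmod M S) (\<lambda>v. v) M \<kappa> Y"
    "\<And>j. gr Y j = \<kappa> ` gr M j"
proof -
  obtain Y :: "('k, 'b) ugmod" and \<kappa> where Y: "graded_module B Y" "\<kappa> \<in> graded_hom M Y"
    "\<kappa> ` carr M = carr Y" "mod_ker M \<kappa> = S" "\<And>j. gr Y j = \<kappa> ` gr M j"
    using quotient_gmod[OF M S] by blast
  have "(\<lambda>v. v) \<in> graded_hom (sub_gmod M S) M"
    using submoduleD(2)[OF homogeneous_submoduleD(1)[OF S]] by (auto intro!: graded_homI)
  then have "short_exact (sub_gmod M S) (\<lambda>v. v) M \<kappa> Y"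
    using Y(1-4) M graded_module_sub[OF M S] by (simp add: short_exact_def)
  then show ?thesis using that Y(5) by blast
qed

text \<open>Scalars act by graded endomorphisms, so the elements with support in a given set of degrees form
  a subspace; take the degrees that occur in a finite spanning set.\<close>

lemma finite_degrees:
  fixes M :: "('b, 'm::ab_group_add) gmod"
  assumes M: "graded_module B M"
  shows "finite {j. gr M j \<noteq> {0}}"
proof -
  note d = graded_moduleD(3)[OF M] and mM = is_moduleD[OF graded_moduleD(2)[OF M]]
  obtain T where T: "finite T" "spanning M T"
    using graded_moduleD(1)[OF M] by (auto simp: fd_module_iff)
  define D where "D = (\<Union>t\<in>T. {j. hcomp (gr M) t j \<noteq> 0})"
  have fin: "finite D" unfolding D_def using T hcomp_props(2)[OF d] spanningD(1)[OF T(2)] by blast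
  have sm: "scalar_act M c \<in> graded_hom M M" for c
  proof (rule graded_homI)
    note m = scalar_act_props[OF graded_moduleD(2)[OF M]]
    show "scalar_act M c v \<in> carr M" if "v \<in> carr M" for v using m(1) that by blast
    show "scalar_act M c (v + w) = scalar_act M c v + scalar_act M c w" if "v \<in> carr M" "w \<in> carr M" for v w
      using m(2) that by blast
    show "scalar_act M c (act M b v) = act M b (scalar_act M c v)" if "v \<in> carr M" for b v
      using that unfolding scalar_act_def mM(5)[OF that, symmetric] by (simp add: scal_mult)
    show "scalar_act M c v \<in> gr M j" if "v \<in> gr M j" for j v
      using graded_moduleD(9)[OF M scal_1_grading that] by (simp add: scalar_act_def)
  qed
  let ?W = "{v \<in> carr M. \<forall>j. j \<notin> D \<longrightarrow> hcomp (gr M) v j = 0}"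
  have "subspace_of M ?W"
    unfolding subspace_of_def add_subgroup_def
    using add_subgroup_0[OF mM(1)] add_subgroup_add[OF mM(1)] add_subgroup_uminus[OF mM(1)]
      graded_homD(1)[OF sm] graded_hom_0[OF M sm]
    by (auto simp: hcomp_0[OF d] hcomp_add[OF d] hcomp_uminus[OF d] hcomp_graded_hom[OF M M sm])
  moreover have "T \<subseteq> ?W" using spanningD(1)[OF T(2)] by (auto simp: D_def)
  ultimately have W: "carr M \<subseteq> ?W" by (rule spanningD(2)[OF T(2)])
  have "gr M j = {0}" if "j \<notin> D" for j
  proof -
    have "w = 0" if w: "w \<in> gr M j" for w
    proof -
      have "w \<in> ?W" using W w graded_moduleD(6)[OF M, of j] by blast
      then show ?thesis using hcomp_homogeneous[OF d w, of j] \<open>j \<notin> D\<close> by simp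
    qed
    then show ?thesis using graded_moduleD(8)[OF M, of j] by blast
  qed
  then have "{j. gr M j \<noteq> {0}} \<subseteq> D" by blast
  then show ?thesis using fin finite_subset by blast
qed

text \<open>Let \<open>j\<close> be the lowest degree of \<open>M\<close>. A proper submodule that contains \<open>M\<^bsub>>j\<^esub>\<close> is automatically
  homogeneous, because an element differs from its component of degree \<open>j\<close> by an element of \<open>M\<^bsub>>j\<^esub>\<close>.
  Hence a maximal such submodule is maximal among all submodules.\<close>

lemma maximal_graded_submodule:
  fixes M :: "('b, 'm::ab_group_add) gmod"
  assumes M: "graded_module B M" and nz: "carr M \<noteq> {0}"
  obtains K j where "homogeneous_submodule M K" "K \<noteq> carr M" "gr M j \<noteq> {0}"
    "\<And>T. submodule M T \<Longrightarrow> K \<subseteq> T \<Longrightarrow> T = K \<or> T = carr M"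
    "\<And>v. v \<in> carr M \<Longrightarrow> v - hcomp (gr M) v j \<in> K"
proof -
  note d = graded_moduleD(3)[OF M] and mM = is_moduleD[OF graded_moduleD(2)[OF M]]
  let ?D = "{j. gr M j \<noteq> {0}}"
  obtain v where v: "v \<in> carr M" "v \<noteq> 0" using nz graded_moduleD(7)[OF M] by blast
  have "?D \<noteq> {}"
  proof
    assume "?D = {}"
    then have "hcomp (gr M) v j = hcomp (gr M) 0 j" for j
      using hcomp_props(1)[OF d v(1), of j] hcomp_0[OF d] by auto
    then show False using hcomp_eqI[OF d v(1) graded_moduleD(7)[OF M]] v(2) by blast
  qed
  define j where "j = Min ?D"
  have j: "gr M j \<noteq> {0}"
    using Min_in[OF finite_degrees[OF M] \<open>?D \<noteq> {}\<close>] by (simp add: j_def)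
  have less_j: "gr M l = {0}" if "l < j" for l
    using that Min_le[OF finite_degrees[OF M], of l] unfolding j_def by force
  let ?G = "trunc_set M (j + 1)"
  have G: "v - hcomp (gr M) v j \<in> ?G" if v: "v \<in> carr M" for v
  proof -
    have c: "hcomp (gr M) v l \<in> gr M l" for l by (rule hcomp_props(1)[OF d v])
    have "hcomp (gr M) (v - hcomp (gr M) v j) l = 0" if "l < j + 1" for l
    proof -
      have "hcomp (gr M) (v - hcomp (gr M) v j) l = hcomp (gr M) v l - hcomp (gr M) (hcomp (gr M) v j) l"
        using hcomp_add[OF d v, of "- hcomp (gr M) v j" l] hcomp_uminus[OF d hcomp_carr[OF M v]]
          add_subgroup_uminus[OF mM(1) hcomp_carr[OF M v]] by simp
      also have "\<dots> = 0"
        using that hcomp_homogeneous[OF d c[of j], of l] less_j[of l] c[of l] by (cases "l = j") auto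
      finally show ?thesis .
    qed
    then show ?thesis
      using add_subgroup_diff[OF mM(1) v hcomp_carr[OF M v]] by (simp add: trunc_set_def)
  qed
  obtain \<delta> :: "'m set \<Rightarrow> nat" where
    \<delta>: "\<And>U W. subspace_of M U \<Longrightarrow> subspace_of M W \<Longrightarrow> U \<subset> W \<Longrightarrow> \<delta> U < \<delta> W"
    using dimension_function[OF graded_moduleD(1)[OF M]] by blast
  let ?Q = "\<lambda>K. submodule M K \<and> ?G \<subseteq> K \<and> K \<noteq> carr M"
  obtain w where w: "w \<in> gr M j" "w \<noteq> 0" using j graded_moduleD(8)[OF M, of j] by blast
  have "w \<notin> ?G" using hcomp_homogeneous[OF d w(1), of j] w(2) by (auto simp: trunc_set_def)
  then have "?Q ?G" using homogeneous_submodule_trunc[OF M] w(1) graded_moduleD(6)[OF M, of j] by (auto simp: homogeneous_submodule_def)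
  moreover have "\<forall>K. ?Q K \<longrightarrow> \<delta> K < \<delta> (carr M)"
    using \<delta> submodule_subspace_of subspace_of_carr[OF graded_moduleD(2)[OF M]] submoduleD(2)
    by (metis psubsetI)
  ultimately obtain K where K: "?Q K" and max: "\<And>T. ?Q T \<Longrightarrow> \<delta> T \<le> \<delta> K"
    using ex_has_greatest_nat[of ?Q ?G \<delta> "\<delta> (carr M)"] by blast
  note KG = submoduleD(1)[OF conjunct1[OF K]]
  have rest: "v - hcomp (gr M) v j \<in> K" if "v \<in> carr M" for v using G[OF that] K by blast
  have "hcomp (gr M) v l \<in> K" if v: "v \<in> K" for v l
  proof -
    have v': "v \<in> carr M" using v K submoduleD(2) by blast
    have c: "hcomp (gr M) v l \<in> gr M l" by (rule hcomp_props(1)[OF d v'])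
    consider "l < j" | "l = j" | "l > j" by linarith
    then show ?thesis
    proof cases
      case 1
      then show ?thesis using c less_j add_subgroup_0[OF KG] by auto
    next
      case 2
      have "v - (v - hcomp (gr M) v j) \<in> K" by (rule add_subgroup_diff[OF KG v rest[OF v']])
      then show ?thesis using 2 by simp
    next
      case 3
      then show ?thesis using hcomp_trunc_set[OF M c, of "j + 1"] K by auto
    qed
  qed
  then have homogeneous_submodule: "homogeneous_submodule M K" using K by (simp add: homogeneous_submodule_def)
  have "T = K \<or> T = carr M" if T: "submodule M T" "K \<subseteq> T" for T
  proof (rule ccontr)
    assume "\<not> (T = K \<or> T = carr M)"
    then have "?Q T" "\<delta> K < \<delta> T" using T K by (auto intro!: \<delta> submodule_subspace_of)
    then show False using max[of T] by simp
  qed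
  then show ?thesis using that[OF homogeneous_submodule _ j _ rest] K by simp
qed

text \<open>Maximality makes the quotient irreducible, and it has pure grade because \<open>K\<close> contains everything
  outside degree \<open>j\<close>.\<close>

lemma irreducible_quotient:
  fixes M :: "('b, 'm::ab_group_add) gmod"
  assumes M: "graded_module B M" and nz: "carr M \<noteq> {0}"
  obtains K j and Y :: "('k, 'b) ugmod" and \<kappa> where
    "homogeneous_submodule M K" "K \<noteq> carr M" "gr M j \<noteq> {0}" "short_exact (sub_gmod M K) (\<lambda>v. v) M \<kappa> Y"
    "carr Y = gr Y j" "irreducible_module B Y"
proof -
  note d = graded_moduleD(3)[OF M] and mM = is_moduleD[OF graded_moduleD(2)[OF M]]
  obtain K j where K: "homogeneous_submodule M K" "K \<noteq> carr M" "gr M j \<noteq> {0}"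
    "\<And>T. submodule M T \<Longrightarrow> K \<subseteq> T \<Longrightarrow> T = K \<or> T = carr M"
    "\<And>v. v \<in> carr M \<Longrightarrow> v - hcomp (gr M) v j \<in> K"
    using maximal_graded_submodule[OF M nz] by blast
  note sub = submoduleD[OF homogeneous_submoduleD(1)[OF K(1)]]
  obtain Y :: "('k, 'b) ugmod" and \<kappa> where Y: "short_exact (sub_gmod M K) (\<lambda>v. v) M \<kappa> Y"
    "\<And>j. gr Y j = \<kappa> ` gr M j"
    by (rule short_exact_quotient[OF M K(1)]) (rule that)
  then have Ym: "graded_module B Y" and \<kappa>: "\<kappa> \<in> graded_hom M Y" "\<kappa> ` carr M = carr Y"
    "mod_ker M \<kappa> = K" by (auto simp: short_exact_def)
  have ker: "\<kappa> v = 0 \<longleftrightarrow> v \<in> K" if "v \<in> carr M" for v using \<kappa>(3) that by (auto simp: mod_ker_def)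
  have "\<kappa> v \<in> gr Y j" if v: "v \<in> carr M" for v
  proof -
    have "\<kappa> (v - hcomp (gr M) v j) = 0"
      using ker[OF add_subgroup_diff[OF mM(1) v hcomp_carr[OF M v]]] K(5)[OF v] by simp
    then have "\<kappa> v = \<kappa> (hcomp (gr M) v j)"
      using graded_hom_diff[OF M \<kappa>(1) v hcomp_carr[OF M v, of j]] by simp
    moreover have "\<kappa> (hcomp (gr M) v j) \<in> gr Y j"
      unfolding Y(2) by (intro imageI hcomp_props(1)[OF d v])
    ultimately show ?thesis by (simp only:)
  qed
  then have "\<kappa> ` carr M \<subseteq> gr Y j" by (rule image_subsetI)
  then have pure: "carr Y = gr Y j"
    unfolding \<kappa>(2) using graded_moduleD(6)[OF Ym, of j] by (rule equalityI)
  have "irreducible_module B Y"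
    unfolding irreducible_module_def
  proof (intro conjI allI impI)
    show "fd_module B Y" by (rule graded_moduleD(1)[OF Ym])
    obtain v where "v \<in> carr M" "v \<notin> K" using K(2) sub(2) by blast
    then show "carr Y \<noteq> {0}" using ker \<kappa>(2) by blast
    fix S assume S: "submodule Y S"
    let ?T = "{v \<in> carr M. \<kappa> v \<in> S}"
    have "submodule M ?T"
      unfolding submodule_def
    proof (intro conjI ballI allI)
      have "subspace_of M ?T"
        by (rule subspace_of_vimage[OF graded_moduleD(2)[OF M] graded_moduleD(2)[OF Ym] _ _ submodule_subspace_of[OF S]])
          (simp_all add: graded_homD[OF \<kappa>(1)] scalar_act_def)
      then show "add_subgroup ?T" by (rule subspace_ofD(1))
      show "act M b v \<in> ?T" if "v \<in> ?T" for b v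
        using that mM(2) submoduleD(3)[OF S] by (simp add: graded_homD(3)[OF \<kappa>(1)])
    qed auto
    moreover have "v \<in> ?T" if "v \<in> K" for v
      using that sub(2) ker[of v] add_subgroup_0[OF submoduleD(1)[OF S]] by auto
    then have "K \<subseteq> ?T" by blast
    ultimately consider "?T = K" | "?T = carr M" using K(4) by blast
    then show "S = {0} \<or> S = carr Y"
    proof cases
      case 1
      have "y = 0" if y: "y \<in> S" for y
      proof -
        have "y \<in> \<kappa> ` carr M" using y submoduleD(2)[OF S] \<kappa>(2) by blast
        then obtain v where v: "v \<in> carr M" "y = \<kappa> v" by (rule imageE)
        then have "v \<in> K" using 1 y by blast
        then show ?thesis using ker[OF v(1)] v(2) by simp
      qed
      then show ?thesis using add_subgroup_0[OF submoduleD(1)[OF S]] by blast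
    next
      case 2
      then have "\<kappa> ` carr M \<subseteq> S" by auto
      then show ?thesis using \<kappa>(2) submoduleD(2)[OF S] by simp
    qed
  qed
  then show ?thesis by (rule that[OF K(1-3) Y(1) pure])
qed

text \<open>A homogeneous element of \<open>Y\<close> outside degree \<open>j\<close> is zero, so only degree \<open>j\<close> has to be compared.\<close>

lemma graded_hom_pure_grade:
  fixes Y Z :: "('k, 'b) ugmod"
  assumes Y: "graded_module B Y" "carr Y = gr Y j" and Z: "graded_module B Z" "pure_grade 0 Z"
    and f: "f \<in> mod_hom Y Z"
  shows "f \<in> graded_hom Y (shift j Z)"
proof (rule graded_homI)
  note d = graded_moduleD(3)[OF Y(1)]
  show "f v \<in> gr (shift j Z) l" if v: "v \<in> gr Y l" for v l
  proof (cases "l = j")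
    case True
    then show ?thesis using v Y(2) Z(2) mod_homD(1)[OF f] by (simp add: pure_grade_def)
  next
    case False
    have "v \<in> gr Y j" using v Y graded_moduleD(6)[OF Y(1)] by blast
    then have "v = 0"
      using hcomp_homogeneous[OF d v, of j] hcomp_homogeneous[OF d, of v j j] False by auto
    moreover have "f 0 = 0"
      using additive_on_0[OF graded_moduleD(4)[OF Y(1)], of f] mod_homD(2)[OF f] by blast
    ultimately show ?thesis using graded_moduleD(8)[OF Z(1)] by simp
  qed
qed (use mod_homD[OF f] in auto)

section \<open>Degrees of Ext groups\<close>

text \<open>Induction on graded submodules of \<open>M\<close>: an irreducible quotient in degree \<open>j\<close> is
  split off, and Ext of the submodule being treated is nonzero only if that of the smaller submodule
  or that of the quotient, a shift \<open>L(\<mu>)\<langle>j\<rangle>\<close>, is.\<close>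

lemma ext_degree:
  fixes M :: "('b, 'm::ab_group_add) gmod" and N :: "('k, 'b) ugmod"
    and L :: "'g \<Rightarrow> ('k, 'b) ugmod"
  assumes L: "classifies_irreducibles B \<Gamma> L" "\<And>\<mu>. \<mu> \<in> \<Gamma> \<Longrightarrow> graded_module B (L \<mu>)"
      "\<And>\<mu>. \<mu> \<in> \<Gamma> \<Longrightarrow> pure_grade 0 (L \<mu>)" "\<Gamma> \<noteq> {}"
    and N: "graded_module B N"
    and L_ext: "\<And>\<mu> n r. \<mu> \<in> \<Gamma> \<Longrightarrow> ext_nonzero B n (L \<mu>) (shift r N) \<Longrightarrow> int n = r"
    and M: "graded_module B M" and ext: "ext_nonzero B n M (shift r N)"
  shows "\<exists>j. gr M j \<noteq> {0} \<and> r = int n + j"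
proof -
  obtain \<delta> :: "'m set \<Rightarrow> nat" where
    \<delta>: "\<And>U W. subspace_of M U \<Longrightarrow> subspace_of M W \<Longrightarrow> U \<subset> W \<Longrightarrow> \<delta> U < \<delta> W"
    using dimension_function[OF graded_moduleD(1)[OF M]] by blast
  have L_shift: "r = int n + j" if "\<mu> \<in> \<Gamma>" "ext_nonzero B n (shift j (L \<mu>)) (shift r N)" for \<mu> n j
    using L_ext[OF that(1), of n "r - j"] ext_nonzero_shift[OF that(2)] by (simp add: shift_shift)
  have "\<exists>j. gr M j \<inter> K \<noteq> {0} \<and> r = int n + j"
    if "homogeneous_submodule M K" "ext_nonzero B n (sub_gmod M K) (shift r N)" for K
    using that
  proof (induction "\<delta> K" arbitrary: K rule: less_induct)
    case less
    let ?M = "sub_gmod M K"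
    note M' = graded_module_sub[OF M less.prems(1)]
    show ?case
    proof (cases "K = {0}")
      case True
      obtain \<mu> where \<mu>: "\<mu> \<in> \<Gamma>" using L(4) by blast
      \<comment> \<open>Ext from the zero module vanishes: in the sequence \<open>0 \<rightarrow> 0 \<rightarrow> Z \<rightarrow> Z \<rightarrow> 0\<close> the shift of
        \<open>Z = L(\<mu>)\<langle>r - n + 1\<rangle>\<close> is one for which Ext from \<open>Z\<close> vanishes in degrees \<open>n\<close> and \<open>n + 1\<close>.\<close>
      let ?Z = "shift (r - int n + 1) (L \<mu>)"
      have Z: "graded_module B ?Z" by (rule graded_module_shift[OF L(2)[OF \<mu>]])
      have "short_exact ?M (\<lambda>_. 0) ?Z (\<lambda>x. x) ?Z"
        using True M' Z zero_hom[OF Z] id_hom graded_moduleD(7)[OF Z]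
        by (auto simp: short_exact_def mod_ker_def)
      from ext_nonzero_sub[OF this graded_module_shift[OF N] less.prems(2)] L_shift[OF \<mu>]
      show ?thesis by fastforce
    next
      case False
      then have "carr ?M \<noteq> {0}" by simp
      then obtain K' j and Y :: "('k, 'b) ugmod" and \<kappa> where K': "homogeneous_submodule ?M K'" "K' \<noteq> carr ?M"
        "gr ?M j \<noteq> {0}" "short_exact (sub_gmod ?M K') (\<lambda>v. v) ?M \<kappa> Y"
        "carr Y = gr Y j" "irreducible_module B Y"
        by (rule irreducible_quotient[OF M']) (rule that)
      have sub: "K' \<subseteq> K" using submoduleD(2)[OF homogeneous_submoduleD(1)[OF K'(1)]] by simp
      have hK': "homogeneous_submodule M K'"
        using K'(1) less.prems(1) sub hcomp_sub[OF M less.prems(1)]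
        unfolding homogeneous_submodule_def submodule_def by (auto simp: subset_iff)
      have "sub_gmod ?M K' = sub_gmod M K'"
        using sub by (simp add: sub_gmod_def Int_assoc Int_absorb1)
      then have ses: "short_exact (sub_gmod M K') (\<lambda>v. v) ?M \<kappa> Y" using K'(4) by simp
      from ext_nonzero_middle[OF ses graded_module_shift[OF N] less.prems(2)]
      show ?thesis
      proof
        assume "ext_nonzero B n (sub_gmod M K') (shift r N)"
        moreover have "\<delta> K' < \<delta> K"
          using sub K'(2) by (intro \<delta> submodule_subspace_of homogeneous_submoduleD(1) hK' less.prems(1)) auto
        ultimately obtain l where "gr M l \<inter> K' \<noteq> {0}" "r = int n + l"
          using less.hyps hK' by blast
        moreover have "0 \<in> gr M l \<inter> K'"
          using graded_moduleD(8)[OF graded_module_sub[OF M hK'], of l] by simp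
        ultimately show ?thesis using sub by blast
      next
        assume Yext: "ext_nonzero B n Y (shift r N)"
        have Y: "graded_module B Y" using ses by (simp add: short_exact_def)
        let ?X = "\<lparr>carr = carr Y, act = act Y\<rparr> :: ('k, 'b) umod"
        have "irreducible_module B ?X"
          using K'(6) by (simp add: irreducible_module_def fd_module_def submodule_def)
        then obtain \<mu> where \<mu>: "\<mu> \<in> \<Gamma>" "mod_iso ?X (L \<mu>)"
          using L(1) unfolding classifies_irreducibles_def by blast
        then obtain f where f: "f \<in> mod_hom Y (L \<mu>)" "bij_betw f (carr Y) (carr (L \<mu>))"
          by (auto simp: mod_iso_def mod_hom_def)
        have "ext_nonzero B n (shift j (L \<mu>)) (shift r N)"
          by (rule ext_nonzero_iso[OF Y graded_hom_pure_grade[OF Y K'(5) L(2,3)[OF \<mu>(1)] f(1)] _ Yext])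
            (simp add: f(2))
        then have "r = int n + j" by (rule L_shift[OF \<mu>(1)])
        then show ?thesis using K'(3) by auto
      qed
    qed
  qed
  moreover have "sub_gmod M (carr M) = M"
    using graded_moduleD(6)[OF M] by (simp add: sub_gmod_def Int_absorb2)
  moreover have "homogeneous_submodule M (carr M)"
    using graded_moduleD(4)[OF M] is_moduleD(2)[OF graded_moduleD(2)[OF M]] hcomp_carr[OF M]
    by (simp add: homogeneous_submodule_def submodule_def)
  ultimately obtain j where "gr M j \<inter> carr M \<noteq> {0}" "r = int n + j" using ext by metis
  then show ?thesis using graded_moduleD(6)[OF M, of j] by (auto simp: Int_absorb2)
qed

end

theorem mainTheorem5:
  fixes B :: "('k::alg_closed_field, 'b::{ring,monoid_mult}) graded_alg"
    and \<Gamma> :: "'g::order set"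
    and L \<Delta> nabla :: "'g \<Rightarrow> ('k, 'b) ugmod"
    and M :: "('b, 'm::ab_group_add) gmod"
    and i :: int
  assumes "standard_koszul B \<Gamma> L \<Delta> nabla"
    and "strongly_linear B \<Gamma> nabla M"
    and "i \<ge> 0"
  shows "strongly_linear B \<Gamma> nabla (shift (- i) (truncate_ge i M))"
proof -
  have gqh: "graded_quasi_hereditary B \<Gamma> L \<Delta> nabla"
    and L_nabla: "\<And>\<gamma> \<mu> n r. \<gamma> \<in> \<Gamma> \<Longrightarrow> \<mu> \<in> \<Gamma> \<Longrightarrow> ext_nonzero B n (L \<mu>) (shift r (nabla \<gamma>)) \<Longrightarrow> int n = r"
    using assms(1) unfolding standard_koszul_def by blast+
  then interpret pos_graded_algebra B
    by unfold_locales (simp add: graded_quasi_hereditary_def)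
  have L: "classifies_irreducibles B \<Gamma> L" "\<And>\<mu>. \<mu> \<in> \<Gamma> \<Longrightarrow> graded_module B (L \<mu>)"
    "\<And>\<mu>. \<mu> \<in> \<Gamma> \<Longrightarrow> pure_grade 0 (L \<mu>)" "\<And>\<gamma>. \<gamma> \<in> \<Gamma> \<Longrightarrow> graded_module B (nabla \<gamma>)"
    using gqh unfolding graded_quasi_hereditary_def quasi_hereditary_def by blast+
  have M: "graded_module B M"
    and M_ext: "\<And>\<gamma> n r. \<gamma> \<in> \<Gamma> \<Longrightarrow> ext_nonzero B n M (shift r (nabla \<gamma>)) \<Longrightarrow> int n = r"
    using assms(2) unfolding strongly_linear_def by blast+
  let ?M = "truncate_ge i M"
  obtain Y :: "('k, 'b) ugmod" and \<kappa> where ses: "short_exact ?M (\<lambda>v. v) M \<kappa> Y"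
    and grY: "\<And>j. gr Y j = \<kappa> ` gr M j"
    by (rule short_exact_quotient[OF M homogeneous_submodule_trunc[OF M, of i], folded truncate_ge_eq[OF M]]) (rule that)
  then have M': "graded_module B ?M" and Y: "graded_module B Y" and ker: "mod_ker M \<kappa> = carr ?M"
    by (auto simp: short_exact_def)
  have gr_ge: "j \<ge> i" if "gr ?M j \<noteq> {0}" for j
    using that by (simp add: truncate_ge_def split: if_splits)
  have gr_less: "j < i" if "gr Y j \<noteq> {0}" for j
  proof (rule ccontr)
    assume "\<not> j < i"
    then have "gr M j \<subseteq> mod_ker M \<kappa>"
      unfolding ker using graded_moduleD(6)[OF M', of j] by (simp add: truncate_ge_def)
    then have "gr Y j \<subseteq> {0}" unfolding grY by (auto simp: mod_ker_def)
    then show False using that graded_moduleD(8)[OF Y, of j] by blast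
  qed
  have "int n = r"
    if \<gamma>: "\<gamma> \<in> \<Gamma>" and ext: "ext_nonzero B n (shift (- i) ?M) (shift r (nabla \<gamma>))" for \<gamma> n r
  proof -
    have \<Gamma>: "\<Gamma> \<noteq> {}" using \<gamma> by blast
    have ext': "ext_nonzero B n ?M (shift (r + i) (nabla \<gamma>))"
      using ext_nonzero_shift[OF ext] by (simp add: shift_shift add.commute)
    have "\<exists>j. gr ?M j \<noteq> {0} \<and> r + i = int n + j"
      by (rule ext_degree[OF L(1-3) \<Gamma> L(4)[OF \<gamma>] _ M' ext']) (assumption | rule L_nabla[OF \<gamma>])+
    then have lower: "r \<ge> int n" using gr_ge by force
    \<comment> \<open>Both alternatives of the long exact sequence give \<open>r \<le> n\<close>.\<close>
    from ext_nonzero_sub[OF ses graded_module_shift[OF L(4)[OF \<gamma>]] ext'] show ?thesis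
    proof
      assume "ext_nonzero B n M (shift (r + i) (nabla \<gamma>))"
      then show ?thesis using M_ext[OF \<gamma>, of n "r + i"] lower assms(3) by simp
    next
      assume ext'': "ext_nonzero B (Suc n) Y (shift (r + i) (nabla \<gamma>))"
      have "\<exists>j. gr Y j \<noteq> {0} \<and> r + i = int (Suc n) + j"
        by (rule ext_degree[OF L(1-3) \<Gamma> L(4)[OF \<gamma>] _ Y ext'']) (assumption | rule L_nabla[OF \<gamma>])+
      then show ?thesis using gr_less lower by force
    qed
  qed
  then show ?thesis
    unfolding strongly_linear_def using graded_module_shift[OF M'] by blast
qed

end
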